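(* Let $\Gamma$ be a discrete countable group acting on a countable set $X$, let $C^*_\tau(\Gamma)$ be a $C^*$-completion of the group algebra $\mathbb{C}[\Gamma]$, and suppose that the Calkin representation $C^*\Gamma \rightarrow \mathbb{B}(\ell^2 X)/\mathbb{K}(\ell^2 X)$ associated with the action is $\tau$-continuous. Let $\Lambda$ be a subgroup of $\Gamma$ which fixes a probability measure on $\partial_\beta X$. Then $\Lambda$ is a $\tau$-group, i.e. the trivial representation of $\Lambda$ is $\tau$-continuous.
   Context: $\Delta_\beta X$ denotes the Stone-Čech compactification of the discrete set $X$ (the Gelfand spectrum of $\ell^\infty X$) and $\partial_\beta X = \Delta_\beta X \setminus X$ the Stone-Čech boundary; the action of $\Gamma$ on $X$ extends to an action by homeomorphisms on $\Delta_\beta X$ preserving $\partial_\beta X$. "$\Lambda$ fixes a probability measure on $\partial_\beta X$" means that there is a regular Borel probability measure on $\partial_\beta X$ that is invariant under the action of $\Lambda$. $C^*\Gamma$ is the full group $C^*$-algebra. The action of $\Gamma$ on $X$ induces a unitary (permutation) representation of $\Gamma$ on $\ell^2 X$; composing the associated $*$-homomorphism $C^*\Gamma \to \mathbb{B}(\ell^2 X)$ with the quotient map onto the Calkin algebra $\mathbb{B}(\ell^2 X)/\mathbb{K}(\ell^2 X)$, where $\mathbb{K}$ denotes the compact operators, gives the Calkin representation. A $C^*$-completion $C^*_\tau(\Gamma)$ is the completion of $\mathbb{C}[\Gamma]$ with respect to some $C^*$-norm $\|\cdot\|_\tau$; there is a canonical surjection $C^*\Gamma \to C^*_\tau\Gamma$.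 A unitary representation of $\Gamma$ (or more generally a $*$-homomorphism from $C^*\Gamma$ to a $C^*$-algebra, such as the Calkin representation) is $\tau$-continuous if the associated homomorphism on $C^*\Gamma$ factors through the canonical surjection $C^*\Gamma \to C^*_\tau \Gamma$. A group is called a $\tau$-group if its trivial representation is $\tau$-continuous. For the subgroup $\Lambda \subset \Gamma$, $\tau$ refers to the $C^*$-norm on $\mathbb{C}[\Lambda]$ obtained by restricting $\|\cdot\|_\tau$ from $\mathbb{C}[\Gamma]$ to $\mathbb{C}[\Lambda]$; thus $\Lambda$ is a $\tau$-group iff $\left|\sum_{g\in\Lambda} a_g\right| \le \left\|\sum_{g\in\Lambda} a_g g\right\|_\tau$ for every $\sum_{g\in \Lambda} a_g g \in \mathbb{C}[\Lambda]$. *)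

theory Defs
  imports "HOL-Analysis.Analysis" "HOL-Probability.Probability_Measure" "HOL-Algebra.QuotRing"
    "HOL-Algebra.Group_Action"
begin

section \<open>Unital complex *-algebras with explicit carrier\<close>

record 'a star_algebra = "'a ring" +
  scale :: "complex \<Rightarrow> 'a \<Rightarrow> 'a"
  star :: "'a \<Rightarrow> 'a"

record 'a normed_star_algebra = "'a star_algebra" +
  nrm :: "'a \<Rightarrow> real"

definition star_hom ::
    "('a, 'm) star_algebra_scheme \<Rightarrow> ('b, 'n) star_algebra_scheme \<Rightarrow> ('a \<Rightarrow> 'b) set" where
  "star_hom A B = {h \<in> ring_hom A B.
     (\<forall>c. \<forall>a\<in>carrier A. h (scale A c a) = scale B c (h a)) \<and>
     (\<forall>a\<in>carrier A. h (star A a) = star B (h a))}"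

definition cstar_seminorm :: "('a, 'm) star_algebra_scheme \<Rightarrow> ('a \<Rightarrow> real) \<Rightarrow> bool" where
  "cstar_seminorm A p \<longleftrightarrow>
     (\<forall>a\<in>carrier A. 0 \<le> p a) \<and>
     (\<forall>a\<in>carrier A. \<forall>b\<in>carrier A. p (a \<oplus>\<^bsub>A\<^esub> b) \<le> p a + p b) \<and>
     (\<forall>c. \<forall>a\<in>carrier A. p (scale A c a) = cmod c * p a) \<and>
     (\<forall>a\<in>carrier A. \<forall>b\<in>carrier A. p (a \<otimes>\<^bsub>A\<^esub> b) \<le> p a * p b) \<and>
     (\<forall>a\<in>carrier A. p (star A a \<otimes>\<^bsub>A\<^esub> a) = (p a)\<^sup>2)"

definition cstar_norm :: "('a, 'm) star_algebra_scheme \<Rightarrow> ('a \<Rightarrow> real) \<Rightarrow> bool" where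
  "cstar_norm A p \<longleftrightarrow> cstar_seminorm A p \<and> (\<forall>a\<in>carrier A. p a = 0 \<longrightarrow> a = \<zero>\<^bsub>A\<^esub>)"

definition complex_algebra :: "complex normed_star_algebra" where
  "complex_algebra = \<lparr>carrier = UNIV, mult = (*), one = 1, ring.zero = 0, add = (+),
     scale = (*), star = cnj, nrm = cmod\<rparr>"

text \<open>The quotient by a closed *-ideal \<open>I\<close>, with the quotient norm; the ring part is the
  library's quotient ring.\<close>

definition quotient_algebra ::
    "('a, 'm) normed_star_algebra_scheme \<Rightarrow> 'a set \<Rightarrow> 'a set normed_star_algebra" where
  "quotient_algebra A I =
     \<lparr>carrier = carrier (A Quot I), mult = mult (A Quot I), one = one (A Quot I),
      ring.zero = ring.zero (A Quot I), add = add (A Quot I),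
      scale = (\<lambda>c C. \<Union>a\<in>C. I +>\<^bsub>A\<^esub> scale A c a),
      star = (\<lambda>C. \<Union>a\<in>C. I +>\<^bsub>A\<^esub> star A a),
      nrm = (\<lambda>C. INF a\<in>C. nrm A a)\<rparr>"

section \<open>Completions\<close>

definition cauchy_algebra ::
    "('a, 'm) star_algebra_scheme \<Rightarrow> ('a \<Rightarrow> real) \<Rightarrow> (nat \<Rightarrow> 'a) normed_star_algebra" where
  "cauchy_algebra A p =
     \<lparr>carrier = {s. (\<forall>n. s n \<in> carrier A) \<and>
                    (\<forall>e>0. \<exists>N. \<forall>m\<ge>N. \<forall>n\<ge>N. p (s m \<ominus>\<^bsub>A\<^esub> s n) < e)},
      mult = (\<lambda>s t n. s n \<otimes>\<^bsub>A\<^esub> t n), one = (\<lambda>n. \<one>\<^bsub>A\<^esub>),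
      ring.zero = (\<lambda>n. \<zero>\<^bsub>A\<^esub>), add = (\<lambda>s t n. s n \<oplus>\<^bsub>A\<^esub> t n),
      scale = (\<lambda>c s n. scale A c (s n)), star = (\<lambda>s n. star A (s n)),
      nrm = (\<lambda>s. lim (\<lambda>n. p (s n)))\<rparr>"

definition null_seqs :: "('a, 'm) star_algebra_scheme \<Rightarrow> ('a \<Rightarrow> real) \<Rightarrow> (nat \<Rightarrow> 'a) set" where
  "null_seqs A p = {s. (\<forall>n. s n \<in> carrier A) \<and> (\<lambda>n. p (s n)) \<longlonglongrightarrow> 0}"

text \<open>Elements of the completion are classes of \<open>p\<close>-Cauchy sequences. The seminorm of
  \<^const>\<open>cauchy_algebra\<close> is constant on each class, so the infimum in
  \<^const>\<open>quotient_algebra\<close> is just \<open>lim p (s n)\<close> for any representative \<open>s\<close>.\<close>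

definition completion ::
    "('a, 'm) star_algebra_scheme \<Rightarrow> ('a \<Rightarrow> real) \<Rightarrow> (nat \<Rightarrow> 'a) set normed_star_algebra" where
  "completion A p = quotient_algebra (cauchy_algebra A p) (null_seqs A p)"

definition to_completion ::
    "('a, 'm) star_algebra_scheme \<Rightarrow> ('a \<Rightarrow> real) \<Rightarrow> 'a \<Rightarrow> (nat \<Rightarrow> 'a) set" where
  "to_completion A p a = null_seqs A p +>\<^bsub>cauchy_algebra A p\<^esub> (\<lambda>n. a)"

text \<open>The extension by continuity, to a completion of \<open>A\<close>, of a map \<open>\<phi>\<close> from \<open>A\<close> into a
  C*-algebra \<open>B\<close>: a class \<open>c\<close> is sent to the limit of \<open>\<phi> (s n)\<close> for \<open>s \<in> c\<close>.\<close>

definition continuous_extension ::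
    "('b, 'n) normed_star_algebra_scheme \<Rightarrow> ('a \<Rightarrow> 'b) \<Rightarrow> (nat \<Rightarrow> 'a) set \<Rightarrow> 'b" where
  "continuous_extension B \<phi> c =
     (THE y. y \<in> carrier B \<and> (\<exists>s\<in>c. (\<lambda>n. nrm B (\<phi> (s n) \<ominus>\<^bsub>B\<^esub> y)) \<longlonglongrightarrow> 0))"

section \<open>Group C*-algebras\<close>

definition group_algebra :: "('g, 'm) monoid_scheme \<Rightarrow> ('g \<Rightarrow> complex) star_algebra" where
  "group_algebra G =
     \<lparr>carrier = {a. finite {g. a g \<noteq> 0} \<and> {g. a g \<noteq> 0} \<subseteq> carrier G},
      mult = (\<lambda>a b g. if g \<in> carrier G
                then \<Sum>h\<in>{h \<in> carrier G. a h \<noteq> 0}. a h * b (inv\<^bsub>G\<^esub> h \<otimes>\<^bsub>G\<^esub> g) else 0),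
      one = (\<lambda>g. if g = \<one>\<^bsub>G\<^esub> then 1 else 0),
      ring.zero = (\<lambda>g. 0),
      add = (\<lambda>a b g. a g + b g),
      scale = (\<lambda>c a g. c * a g),
      star = (\<lambda>a g. if g \<in> carrier G then cnj (a (inv\<^bsub>G\<^esub> g)) else 0)\<rparr>"

text \<open>The universal C*-norm, as the largest C*-seminorm on the group algebra. It is finite: every
  C*-seminorm is at most \<open>1\<close> on group elements, hence is dominated by the l1-norm.\<close>

definition full_norm :: "('g, 'm) monoid_scheme \<Rightarrow> ('g \<Rightarrow> complex) \<Rightarrow> real" where
  "full_norm G a = (SUP p\<in>{p. cstar_seminorm (group_algebra G) p}. p a)"

type_synonym 'g group_cstar = "(nat \<Rightarrow> 'g \<Rightarrow> complex) set"

definition group_cstar_completion ::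
    "('g, 'm) monoid_scheme \<Rightarrow> (('g \<Rightarrow> complex) \<Rightarrow> real) \<Rightarrow> 'g group_cstar normed_star_algebra" where
  "group_cstar_completion G \<tau> = completion (group_algebra G) \<tau>"

definition full_group_cstar ::
    "('g, 'm) monoid_scheme \<Rightarrow> 'g group_cstar normed_star_algebra" where
  "full_group_cstar G = group_cstar_completion G (full_norm G)"

definition canonical_surjection ::
    "('g, 'm) monoid_scheme \<Rightarrow> (('g \<Rightarrow> complex) \<Rightarrow> real) \<Rightarrow> 'g group_cstar \<Rightarrow> 'g group_cstar" where
  "canonical_surjection G \<tau> =
     continuous_extension (group_cstar_completion G \<tau>) (to_completion (group_algebra G) \<tau>)"

text \<open>The homomorphism on the full group C*-algebra associated with a unitary representation \<open>u\<close>
  of \<open>G\<close> by unitary elements of a C*-algebra \<open>B\<close>.\<close>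

definition linear_extension ::
    "('b, 'n) star_algebra_scheme \<Rightarrow> ('g \<Rightarrow> 'b) \<Rightarrow> ('g \<Rightarrow> complex) \<Rightarrow> 'b" where
  "linear_extension B u a = (\<Oplus>\<^bsub>B\<^esub>g\<in>{g. a g \<noteq> 0}. scale B (a g) (u g))"

definition associated_hom ::
    "('b, 'n) normed_star_algebra_scheme \<Rightarrow> ('g \<Rightarrow> 'b) \<Rightarrow> 'g group_cstar \<Rightarrow> 'b" where
  "associated_hom B u = continuous_extension B (linear_extension B u)"

definition tau_continuous ::
    "('g, 'm) monoid_scheme \<Rightarrow> (('g \<Rightarrow> complex) \<Rightarrow> real) \<Rightarrow>
     ('b, 'n) star_algebra_scheme \<Rightarrow> ('g group_cstar \<Rightarrow> 'b) \<Rightarrow> bool" where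
  "tau_continuous G \<tau> B \<Phi> \<longleftrightarrow>
     (\<exists>\<Psi>\<in>star_hom (group_cstar_completion G \<tau>) B.
        \<forall>c\<in>carrier (full_group_cstar G). \<Phi> c = \<Psi> (canonical_surjection G \<tau> c))"

definition tau_group :: "('g, 'm) monoid_scheme \<Rightarrow> (('g \<Rightarrow> complex) \<Rightarrow> real) \<Rightarrow> bool" where
  "tau_group G \<tau> \<longleftrightarrow>
     tau_continuous G \<tau> complex_algebra (associated_hom complex_algebra (\<lambda>g. 1))"

section \<open>Operators on l2 and the Calkin representation\<close>

text \<open>Functions on \<open>X\<close> are represented by functions on the ambient type vanishing off \<open>X\<close>.\<close>

definition ell2 :: "'x set \<Rightarrow> ('x \<Rightarrow> complex) set" where
  "ell2 X = {f. (\<forall>x. x \<notin> X \<longrightarrow> f x = 0) \<and> (\<lambda>x. (cmod (f x))\<^sup>2) summable_on X}"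

definition ell2_inner :: "'x set \<Rightarrow> ('x \<Rightarrow> complex) \<Rightarrow> ('x \<Rightarrow> complex) \<Rightarrow> complex" where
  "ell2_inner X f g = (\<Sum>\<^sub>\<infinity>x\<in>X. f x * cnj (g x))"

definition ell2_norm :: "'x set \<Rightarrow> ('x \<Rightarrow> complex) \<Rightarrow> real" where
  "ell2_norm X f = sqrt (\<Sum>\<^sub>\<infinity>x\<in>X. (cmod (f x))\<^sup>2)"

definition ell2_topology :: "'x set \<Rightarrow> ('x \<Rightarrow> complex) topology" where
  "ell2_topology X =
     Metric_space.mtopology (ell2 X) (\<lambda>f g. ell2_norm X (\<lambda>x. f x - g x))"

type_synonym 'x operator = "('x \<Rightarrow> complex) \<Rightarrow> 'x \<Rightarrow> complex"

definition bounded_operators :: "'x set \<Rightarrow> 'x operator set" where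
  "bounded_operators X = {T \<in> ell2 X \<rightarrow>\<^sub>E ell2 X.
     (\<forall>f\<in>ell2 X. \<forall>g\<in>ell2 X. T (\<lambda>x. f x + g x) = (\<lambda>x. T f x + T g x)) \<and>
     (\<forall>c. \<forall>f\<in>ell2 X. T (\<lambda>x. c * f x) = (\<lambda>x. c * T f x)) \<and>
     (\<exists>C. \<forall>f\<in>ell2 X. ell2_norm X (T f) \<le> C * ell2_norm X f)}"

definition adjoint_operator :: "'x set \<Rightarrow> 'x operator \<Rightarrow> 'x operator" where
  "adjoint_operator X T = (THE S. S \<in> bounded_operators X \<and>
     (\<forall>f\<in>ell2 X. \<forall>g\<in>ell2 X. ell2_inner X (T f) g = ell2_inner X f (S g)))"

definition operator_algebra :: "'x set \<Rightarrow> 'x operator normed_star_algebra" where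
  "operator_algebra X =
     \<lparr>carrier = bounded_operators X,
      mult = compose (ell2 X),
      one = (\<lambda>f\<in>ell2 X. f),
      ring.zero = (\<lambda>f\<in>ell2 X. \<lambda>x. 0),
      add = (\<lambda>S T. \<lambda>f\<in>ell2 X. \<lambda>x. S f x + T f x),
      scale = (\<lambda>c T. \<lambda>f\<in>ell2 X. \<lambda>x. c * T f x),
      star = adjoint_operator X,
      nrm = (\<lambda>T. SUP f\<in>{f \<in> ell2 X. ell2_norm X f \<le> 1}. ell2_norm X (T f))\<rparr>"

definition compact_operators :: "'x set \<Rightarrow> 'x operator set" where
  "compact_operators X = {T \<in> bounded_operators X.
     compactin (ell2_topology X)
       (ell2_topology X closure_of (T ` {f \<in> ell2 X. ell2_norm X f \<le> 1}))}"

definition calkin_algebra :: "'x set \<Rightarrow> 'x operator set normed_star_algebra" where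
  "calkin_algebra X = quotient_algebra (operator_algebra X) (compact_operators X)"

definition permutation_rep ::
    "('g, 'm) monoid_scheme \<Rightarrow> 'x set \<Rightarrow> ('g \<Rightarrow> 'x \<Rightarrow> 'x) \<Rightarrow> 'g \<Rightarrow> 'x operator" where
  "permutation_rep G X \<alpha> g =
     (\<lambda>f\<in>ell2 X. \<lambda>x. if x \<in> X then f (\<alpha> (inv\<^bsub>G\<^esub> g) x) else 0)"

definition calkin_rep ::
    "('g, 'm) monoid_scheme \<Rightarrow> 'x set \<Rightarrow> ('g \<Rightarrow> 'x \<Rightarrow> 'x) \<Rightarrow> 'g group_cstar \<Rightarrow> 'x operator set" where
  "calkin_rep G X \<alpha> c =
     compact_operators X +>\<^bsub>operator_algebra X\<^esub>
       associated_hom (operator_algebra X) (permutation_rep G X \<alpha>) c"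

section \<open>The Stone-Cech boundary\<close>

definition ell_infty :: "'x set \<Rightarrow> ('x \<Rightarrow> complex) normed_star_algebra" where
  "ell_infty X =
     \<lparr>carrier = {f. (\<forall>x. x \<notin> X \<longrightarrow> f x = 0) \<and> bounded (f ` X)},
      mult = (\<lambda>f g x. f x * g x), one = indicator X, ring.zero = (\<lambda>x. 0),
      add = (\<lambda>f g x. f x + g x), scale = (\<lambda>c f x. c * f x), star = (\<lambda>f x. cnj (f x)),
      nrm = (\<lambda>f. SUP x\<in>X. cmod (f x))\<rparr>"

definition characters :: "('a, 'm) star_algebra_scheme \<Rightarrow> ('a \<Rightarrow> complex) set" where
  "characters A = {\<omega> \<in> ring_hom A complex_algebra \<inter> extensional (carrier A).
     \<forall>c. \<forall>a\<in>carrier A. \<omega> (scale A c a) = c * \<omega> a}"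

text \<open>The topology of the spectrum is the weak-* topology, that is, pointwise convergence.\<close>

definition gelfand_spectrum :: "('a, 'm) star_algebra_scheme \<Rightarrow> ('a \<Rightarrow> complex) topology" where
  "gelfand_spectrum A =
     subtopology (product_topology (\<lambda>a. euclidean) (carrier A)) (characters A)"

type_synonym 'x sc_point = "('x \<Rightarrow> complex) \<Rightarrow> complex"

definition stone_cech :: "'x set \<Rightarrow> 'x sc_point topology" where
  "stone_cech X = gelfand_spectrum (ell_infty X)"

definition point_evaluation :: "'x set \<Rightarrow> 'x \<Rightarrow> 'x sc_point" where
  "point_evaluation X x = (\<lambda>f\<in>carrier (ell_infty X). f x)"

definition stone_cech_boundary :: "'x set \<Rightarrow> 'x sc_point topology" where
  "stone_cech_boundary X =
     subtopology (stone_cech X) (topspace (stone_cech X) - point_evaluation X ` X)"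

text \<open>The homeomorphism of the Stone-Cech compactification extending a permutation \<open>\<pi>\<close> of \<open>X\<close>: it
  sends evaluation at \<open>x\<close> to evaluation at \<open>\<pi> x\<close>.\<close>

definition stone_cech_extension :: "'x set \<Rightarrow> ('x \<Rightarrow> 'x) \<Rightarrow> 'x sc_point \<Rightarrow> 'x sc_point" where
  "stone_cech_extension X \<pi> \<omega> =
     (\<lambda>f\<in>carrier (ell_infty X). \<omega> (\<lambda>x. if x \<in> X then f (\<pi> x) else 0))"

definition regular_borel_probability :: "'a topology \<Rightarrow> 'a measure \<Rightarrow> bool" where
  "regular_borel_probability T M \<longleftrightarrow>
     prob_space M \<and>
     sets M = sets (sigma (topspace T) {U. openin T U}) \<and>
     (\<forall>A\<in>sets M.
        emeasure M A = (SUP K\<in>{K. compactin T K \<and> K \<in> sets M \<and> K \<subseteq> A}. emeasure M K) \<and>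
        emeasure M A = (INF U\<in>{U. openin T U \<and> A \<subseteq> U}. emeasure M U))"

definition fixes_boundary_probability ::
    "'g set \<Rightarrow> 'x set \<Rightarrow> ('g \<Rightarrow> 'x \<Rightarrow> 'x) \<Rightarrow> bool" where
  "fixes_boundary_probability \<Lambda> X \<alpha> \<longleftrightarrow>
     (\<exists>M. regular_borel_probability (stone_cech_boundary X) M \<and>
        (\<forall>g\<in>\<Lambda>. \<forall>A\<in>sets M. emeasure M (stone_cech_extension X (\<alpha> g) ` A) = emeasure M A))"

end

theory Submission
  imports Defs
begin

text \<open>Suppose some \<open>a\<close> in the group algebra of \<open>\<Lambda>\<close> has \<open>\<tau> a < \<bar>\<Sum>\<^sub>g a g\<bar>\<close>. A multiple \<open>z\<close> of
  \<open>a* a\<close> then satisfies \<open>\<tau> z < 1 < \<Sum>\<^sub>g z g\<close>, so \<open>1 - z\<close> has a square root in the completion, and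
  \<open>\<tau>\<close>-continuity makes the image of \<open>1 - z\<close> in the Calkin algebra positive. On \<open>\<ell>\<^sup>2 X\<close> this says that,
  off a finite set \<open>F\<close>, the sum of the permutation operators over the support \<open>S\<close> of \<open>z\<close> has quadratic
  form at most \<open>\<bar>S\<bar> - \<delta>\<close>. Such a spectral gap yields a function \<open>u > 0\<close> on \<open>X - F\<close> with
  \<open>\<Sum>\<^sub>g u (g x) \<le> (\<bar>S\<bar> - \<delta>/2) u x\<close>. The functions \<open>h g x = ln (u (g x)) - ln (u x)\<close> are bounded, and
  since \<open>ln r \<le> r - 1\<close> their sum over \<open>S\<close> is at most \<open>-\<delta>/2\<close> off a finite set. An invariant measure on
  the boundary is a \<open>\<Lambda>\<close>-invariant mean that ignores finite sets, so the mean of this sum is negative;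
  but \<open>S\<close> is symmetric and \<open>h\<close> is a cocycle, which forces the mean to vanish. This replaces the
  convexity argument that produces almost invariant vectors.\<close>

section \<open>Complex star-algebras\<close>

text \<open>The obstacle is that \<open>tau_continuous\<close> provides a homomorphism
  \<open>\<Psi>\<close> about which only algebra is known. Positivity must therefore be carried by
  an identity, and the square root supplies one: \<open>y* y = 1 - z\<close> survives every
  star-homomorphism. Lifted to operators it acquires a compact error \<open>k\<close>, whose form is
  negligible on functions vanishing on a large finite set; this is the origin of \<open>F\<close>.

  The coefficients of \<open>z\<close> are complex, whereas a supersolution needs an operator that
  preserves positivity. They disappear because every translate of a real \<open>f\<close> has
  correlation at most \<open>||f||^2\<close> with \<open>f\<close>: all deficits are nonnegative,
  and raising each weight to the l1-norm \<open>C\<close> of \<open>z\<close> only enlarges their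
  weighted sum. With trivial value \<open>1 + 2 e\<close> and compact error \<open>e\<close>, the
  gap left for the unweighted sum is \<open>\<delta> = e / C\<close>.

  The function \<open>ln u\<close> may be unbounded, so it need not have a mean; only its increments
  along \<open>S\<close> do. Their two-sided bound is a Harnack inequality: one summand is at most
  the whole sum, and symmetry of \<open>S\<close> gives the reverse estimate.\<close>

locale complex_star_algebra = ring A
  for A :: "('a, 'm) star_algebra_scheme" (structure) +
  assumes scale_closed [simp, intro]: "a \<in> carrier A \<Longrightarrow> scale A c a \<in> carrier A"
    and scale_add: "a \<in> carrier A \<Longrightarrow> b \<in> carrier A \<Longrightarrow>
      scale A c (a \<oplus> b) = scale A c a \<oplus> scale A c b"
    and add_scale: "a \<in> carrier A \<Longrightarrow> scale A (c + d) a = scale A c a \<oplus> scale A d a"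
    and scale_scale: "a \<in> carrier A \<Longrightarrow> scale A c (scale A d a) = scale A (c * d) a"
    and scale_one: "a \<in> carrier A \<Longrightarrow> scale A 1 a = a"
    and scale_mult_left: "a \<in> carrier A \<Longrightarrow> b \<in> carrier A \<Longrightarrow>
      scale A c a \<otimes> b = scale A c (a \<otimes> b)"
    and scale_mult_right: "a \<in> carrier A \<Longrightarrow> b \<in> carrier A \<Longrightarrow>
      a \<otimes> scale A c b = scale A c (a \<otimes> b)"
    and star_closed [simp, intro]: "a \<in> carrier A \<Longrightarrow> star A a \<in> carrier A"
    and star_add: "a \<in> carrier A \<Longrightarrow> b \<in> carrier A \<Longrightarrow>
      star A (a \<oplus> b) = star A a \<oplus> star A b"
    and star_scale: "a \<in> carrier A \<Longrightarrow> star A (scale A c a) = scale A (cnj c) (star A a)"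
    and star_mult: "a \<in> carrier A \<Longrightarrow> b \<in> carrier A \<Longrightarrow>
      star A (a \<otimes> b) = star A b \<otimes> star A a"
    and star_star [simp]: "a \<in> carrier A \<Longrightarrow> star A (star A a) = a"
begin

lemma add_self_eq_zeroD: "x \<in> carrier A \<Longrightarrow> x \<oplus> x = x \<Longrightarrow> x = \<zero>"
  using add.l_cancel_one by blast

lemma scale_zero_left [simp]: "a \<in> carrier A \<Longrightarrow> scale A 0 a = \<zero>"
  using add_scale[of a 0 0] add_self_eq_zeroD by (metis add_0 scale_closed)

lemma scale_zero_right [simp]: "scale A c \<zero> = \<zero>"
  by (metis add_self_eq_zeroD l_zero scale_add scale_closed zero_closed)

lemma minus_eq_scale: "a \<in> carrier A \<Longrightarrow> \<ominus> a = scale A (-1) a"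
  using add_scale[of a "-1" 1] by (simp add: minus_equality scale_one)

lemma star_one [simp]: "star A \<one> = \<one>"
  using star_mult[of "star A \<one>" \<one>] by simp

lemma star_minus: "a \<in> carrier A \<Longrightarrow> star A (\<ominus> a) = \<ominus> star A a"
  by (simp add: minus_eq_scale star_scale)

lemma star_diff: "a \<in> carrier A \<Longrightarrow> b \<in> carrier A \<Longrightarrow> star A (a \<ominus> b) = star A a \<ominus> star A b"
  by (simp add: a_minus_def star_add star_minus)

lemma scale_diff: "a \<in> carrier A \<Longrightarrow> b \<in> carrier A \<Longrightarrow>
    scale A c (a \<ominus> b) = scale A c a \<ominus> scale A c b"
  by (simp add: a_minus_def minus_eq_scale scale_add scale_scale mult.commute)

lemma mult_diff_mult:
  assumes "a \<in> carrier A" "b \<in> carrier A" "c \<in> carrier A" "d \<in> carrier A"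
  shows "a \<otimes> b \<ominus> c \<otimes> d = a \<otimes> (b \<ominus> d) \<oplus> (a \<ominus> c) \<otimes> d"
proof -
  have "a \<otimes> (b \<ominus> d) \<oplus> (a \<ominus> c) \<otimes> d
      = a \<otimes> b \<oplus> (\<ominus> (a \<otimes> d) \<oplus> (a \<otimes> d \<oplus> \<ominus> (c \<otimes> d)))"
    using assms by (simp add: a_minus_def r_distr l_distr r_minus l_minus a_assoc)
  also have "\<dots> = a \<otimes> b \<ominus> c \<otimes> d"
    using assms by (simp add: r_neg1 a_minus_def)
  finally show ?thesis ..
qed

lemma add_diff_add:
  assumes "a \<in> carrier A" "b \<in> carrier A" "c \<in> carrier A" "d \<in> carrier A"
  shows "(a \<oplus> b) \<ominus> (c \<oplus> d) = (a \<ominus> c) \<oplus> (b \<ominus> d)"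
  using assms by (simp add: a_minus_def minus_add a_ac)

lemma diff_add_diff:
  assumes "a \<in> carrier A" "b \<in> carrier A" "c \<in> carrier A"
  shows "(a \<ominus> b) \<oplus> (b \<ominus> c) = a \<ominus> c"
  using assms by (simp add: a_minus_def a_assoc r_neg1)

lemma eq_if_diff_zero: "a \<in> carrier A \<Longrightarrow> b \<in> carrier A \<Longrightarrow> a \<ominus> b = \<zero> \<Longrightarrow> a = b"
  using minus_equality[of a "\<ominus> b"] by (simp add: a_minus_def)

end

text \<open>A seminorm rather than a norm, because \<open>full_norm\<close> arises only as a
  supremum of C*-seminorms. Where limits in such an algebra have to be unique,
  \<open>separating_if_cstar_norm\<close> adds the separation.\<close>

locale cstar_seminormed_algebra = complex_star_algebra +
  fixes p :: "'a \<Rightarrow> real"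
  assumes seminorm: "cstar_seminorm A p"
begin

lemma p_nonneg [simp]: "a \<in> carrier A \<Longrightarrow> 0 \<le> p a"
  and p_add: "a \<in> carrier A \<Longrightarrow> b \<in> carrier A \<Longrightarrow> p (a \<oplus> b) \<le> p a + p b"
  and p_scale: "a \<in> carrier A \<Longrightarrow> p (scale A c a) = cmod c * p a"
  and p_mult: "a \<in> carrier A \<Longrightarrow> b \<in> carrier A \<Longrightarrow> p (a \<otimes> b) \<le> p a * p b"
  and p_star_mult: "a \<in> carrier A \<Longrightarrow> p (star A a \<otimes> a) = (p a)\<^sup>2"
  using seminorm unfolding cstar_seminorm_def by auto

lemma p_zero [simp]: "p \<zero> = 0"
  using p_scale[of \<zero> 0] by simp

lemma p_minus [simp]: "a \<in> carrier A \<Longrightarrow> p (\<ominus> a) = p a"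
  by (simp add: minus_eq_scale p_scale)

lemma p_diff: "a \<in> carrier A \<Longrightarrow> b \<in> carrier A \<Longrightarrow> p (a \<ominus> b) \<le> p a + p b"
  unfolding a_minus_def using p_add[of a "\<ominus> b"] by simp

lemma p_diff_commute: "a \<in> carrier A \<Longrightarrow> b \<in> carrier A \<Longrightarrow> p (a \<ominus> b) = p (b \<ominus> a)"
  using p_minus[of "b \<ominus> a"] by (simp add: a_minus_def minus_add a_comm)

lemma p_diff_triangle: "a \<in> carrier A \<Longrightarrow> b \<in> carrier A \<Longrightarrow> c \<in> carrier A \<Longrightarrow>
    p (a \<ominus> c) \<le> p (a \<ominus> b) + p (b \<ominus> c)"
  using p_add[of "a \<ominus> b" "b \<ominus> c"] by (simp add: diff_add_diff)

lemma p_le_add_diff: "a \<in> carrier A \<Longrightarrow> b \<in> carrier A \<Longrightarrow> p a \<le> p b + p (a \<ominus> b)"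
  using p_diff_triangle[of a b \<zero>] by (simp add: a_minus_def)

lemma p_abs_diff: "a \<in> carrier A \<Longrightarrow> b \<in> carrier A \<Longrightarrow> \<bar>p a - p b\<bar> \<le> p (a \<ominus> b)"
  using p_le_add_diff[of a b] p_le_add_diff[of b a] p_diff_commute[of a b] by linarith

text \<open>The C*-identity gives
  \<open>(p a)^2 = p (star A a \<otimes> a) \<le> p (star A a) * p a\<close>, and one factor
  cancels. Applied to \<open>star A a\<close> as well, it makes the star isometric.\<close>

lemma p_le_star:
  assumes "a \<in> carrier A" shows "p a \<le> p (star A a)"
proof (cases "p a = 0")
  case False
  then have "p a > 0" using assms by (simp add: order_less_le)
  moreover have "p a * p a \<le> p (star A a) * p a"
    using p_mult[of "star A a" a] p_star_mult[of a] assms by (simp add: power2_eq_square)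
  ultimately show ?thesis by simp
qed (simp add: assms)

lemma p_star [simp]: "a \<in> carrier A \<Longrightarrow> p (star A a) = p a"
  using p_le_star[of a] p_le_star[of "star A a"] by simp

text \<open>The C*-identity at the unit makes \<open>p \<one>\<close> an idempotent real number,
  hence 0 or 1; the value 0 occurs for the zero seminorm.\<close>

lemma p_one_le: "p \<one> \<le> 1"
proof -
  have "p \<one> = (p \<one>)\<^sup>2" using p_star_mult[of \<one>] by simp
  then have "p \<one> * (p \<one> - 1) = 0" by (simp add: power2_eq_square algebra_simps)
  then show ?thesis by auto
qed

lemma separating_if_cstar_norm:
  "cstar_norm A p \<Longrightarrow> a \<in> carrier A \<Longrightarrow> b \<in> carrier A \<Longrightarrow> p (a \<ominus> b) \<le> 0 \<Longrightarrow> a = b"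
  unfolding cstar_norm_def by (simp add: eq_if_diff_zero order_antisym)

end

text \<open>Evaluates the definite description in \<open>continuous_extension\<close>. The metric
  facts are hypotheses so that the lemma serves both completions, whose norm is an infimum over a
  coset, and algebras with a C*-norm. Measuring from a common point \<open>x\<close> lets two limits
  be compared without a separate symmetry law.\<close>

lemma continuous_extension_eqI:
  assumes tri: "\<And>x y z. x \<in> carrier B \<Longrightarrow> y \<in> carrier B \<Longrightarrow> z \<in> carrier B \<Longrightarrow>
      nrm B (y \<ominus>\<^bsub>B\<^esub> z) \<le> nrm B (x \<ominus>\<^bsub>B\<^esub> y) + nrm B (x \<ominus>\<^bsub>B\<^esub> z)"
    and sep: "\<And>y z. y \<in> carrier B \<Longrightarrow> z \<in> carrier B \<Longrightarrow> nrm B (y \<ominus>\<^bsub>B\<^esub> z) \<le> 0 \<Longrightarrow> y = z"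
    and s: "s \<in> c" "(\<lambda>n. nrm B (\<phi> (s n) \<ominus>\<^bsub>B\<^esub> y)) \<longlonglongrightarrow> 0" and y: "y \<in> carrier B"
    and closed: "\<And>t n. t \<in> c \<Longrightarrow> \<phi> (t n) \<in> carrier B"
    and null: "\<And>t. t \<in> c \<Longrightarrow> (\<lambda>n. nrm B (\<phi> (t n) \<ominus>\<^bsub>B\<^esub> \<phi> (s n))) \<longlonglongrightarrow> 0"
  shows "continuous_extension B \<phi> c = y"
  unfolding continuous_extension_def
proof (rule the_equality)
  show "y \<in> carrier B \<and> (\<exists>s\<in>c. (\<lambda>n. nrm B (\<phi> (s n) \<ominus>\<^bsub>B\<^esub> y)) \<longlonglongrightarrow> 0)"
    using s y by blast
next
  fix z assume "z \<in> carrier B \<and> (\<exists>t\<in>c. (\<lambda>n. nrm B (\<phi> (t n) \<ominus>\<^bsub>B\<^esub> z)) \<longlonglongrightarrow> 0)"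
  then obtain t where z: "z \<in> carrier B" and t: "t \<in> c"
    and lim: "(\<lambda>n. nrm B (\<phi> (t n) \<ominus>\<^bsub>B\<^esub> z)) \<longlonglongrightarrow> 0" by blast
  \<comment> \<open>The chain runs from \<open>z\<close> through \<open>\<phi> (t n)\<close> and
    \<open>\<phi> (s n)\<close> to \<open>y\<close>; all three links tend to 0.\<close>
  let ?f = "\<lambda>n. (nrm B (\<phi> (t n) \<ominus>\<^bsub>B\<^esub> \<phi> (s n)) + nrm B (\<phi> (t n) \<ominus>\<^bsub>B\<^esub> z)) + nrm B (\<phi> (s n) \<ominus>\<^bsub>B\<^esub> y)"
  have "nrm B (z \<ominus>\<^bsub>B\<^esub> y) \<le> ?f n" for n
    using tri[of "\<phi> (s n)" z y] tri[of "\<phi> (t n)" "\<phi> (s n)" z] closed s(1) t z y by fastforce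
  moreover have "?f \<longlonglongrightarrow> 0" using null[OF t] lim s(2) by (intro tendsto_add_zero)
  ultimately have "nrm B (z \<ominus>\<^bsub>B\<^esub> y) \<le> 0" by (intro LIMSEQ_le_const) auto
  then show "z = y" using sep z y by blast
qed

section \<open>Completions\<close>

context cstar_seminormed_algebra
begin

abbreviation "C \<equiv> cauchy_algebra A p"
abbreviation "N \<equiv> null_seqs A p"

lemma cauchy_carrier_iff: "s \<in> carrier C \<longleftrightarrow> (\<forall>n. s n \<in> carrier A) \<and>
    (\<forall>e>0. \<exists>M. \<forall>m\<ge>M. \<forall>n\<ge>M. p (s m \<ominus> s n) < e)"
  by (simp add: cauchy_algebra_def)

lemma cauchy_in_carrier: "s \<in> carrier C \<Longrightarrow> s n \<in> carrier A"
  by (simp add: cauchy_carrier_iff)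

text \<open>One Lipschitz estimate covers the closure properties of Cauchy sequences: two input
  sequences for sums and products, the same one twice for unary operations.\<close>

lemma cauchyI_le:
  assumes s: "s \<in> carrier C" and t: "t \<in> carrier C" and u: "\<And>n. u n \<in> carrier A"
    and le: "\<And>m n. p (u m \<ominus> u n) \<le> K * (p (s m \<ominus> s n) + p (t m \<ominus> t n))" and "K > 0"
  shows "u \<in> carrier C"
  unfolding cauchy_carrier_iff
proof (intro conjI allI impI)
  fix e :: real assume "e > 0"
  then have e: "e / (2 * K) > 0" using \<open>K > 0\<close> by simp
  obtain M1 where M1: "\<forall>m\<ge>M1. \<forall>n\<ge>M1. p (s m \<ominus> s n) < e / (2 * K)"
    using s e unfolding cauchy_carrier_iff by blast
  obtain M2 where M2: "\<forall>m\<ge>M2. \<forall>n\<ge>M2. p (t m \<ominus> t n) < e / (2 * K)"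
    using t e unfolding cauchy_carrier_iff by blast
  show "\<exists>M. \<forall>m\<ge>M. \<forall>n\<ge>M. p (u m \<ominus> u n) < e"
  proof (intro exI allI impI)
    fix m n assume "m \<ge> max M1 M2" "n \<ge> max M1 M2"
    then have "p (s m \<ominus> s n) + p (t m \<ominus> t n) < e / (2 * K) + e / (2 * K)"
      using M1 M2 by (intro add_strict_mono) auto
    also have "\<dots> = e / K" by (simp add: field_simps)
    finally have "K * (p (s m \<ominus> s n) + p (t m \<ominus> t n)) < e"
      using \<open>K > 0\<close> by (simp add: field_simps)
    then show "p (u m \<ominus> u n) < e" using le[of m n] by linarith
  qed
qed (rule u)

lemma cauchy_const: "a \<in> carrier A \<Longrightarrow> (\<lambda>n. a) \<in> carrier C"
  by (simp add: cauchy_carrier_iff a_minus_def r_neg)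

lemma cauchy_convergent:
  assumes "s \<in> carrier C" shows "convergent (\<lambda>n. p (s n))"
proof -
  have "Cauchy (\<lambda>n. p (s n))"
  proof (rule metric_CauchyI)
    fix e :: real assume "e > 0"
    then obtain M where "\<forall>m\<ge>M. \<forall>n\<ge>M. p (s m \<ominus> s n) < e"
      using assms unfolding cauchy_carrier_iff by blast
    then show "\<exists>M. \<forall>m\<ge>M. \<forall>n\<ge>M. dist (p (s m)) (p (s n)) < e"
      using p_abs_diff cauchy_in_carrier[OF assms] unfolding dist_real_def
      by (meson le_less_trans)
  qed
  then show ?thesis by (simp add: Cauchy_convergent_iff)
qed

lemma cauchy_bounded:
  assumes "s \<in> carrier C" obtains K where "K > 0" "\<And>n. p (s n) \<le> K"
proof -
  have "Bseq (\<lambda>n. p (s n))"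
    using cauchy_convergent[OF assms] by (simp add: convergent_imp_Bseq)
  then obtain K where "K > 0" "\<And>n. norm (p (s n)) \<le> K" by (auto simp: Bseq_def)
  then have "p (s n) \<le> K" for n by (metis abs_le_D1 real_norm_def)
  then show ?thesis using that \<open>K > 0\<close> by blast
qed

lemma cauchy_add:
  assumes "s \<in> carrier C" "t \<in> carrier C" shows "(\<lambda>n. s n \<oplus> t n) \<in> carrier C"
  by (rule cauchyI_le[OF assms, where K = 1])
     (use assms in \<open>auto simp: add_diff_add cauchy_in_carrier intro!: p_add\<close>)

lemma cauchy_minus:
  assumes "s \<in> carrier C" shows "(\<lambda>n. \<ominus> s n) \<in> carrier C"
proof (rule cauchyI_le[OF assms assms, where K = 1])
  fix m n
  have "\<ominus> s m \<ominus> \<ominus> s n = \<ominus> (s m \<ominus> s n)"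
    using cauchy_in_carrier[OF assms] by (simp add: a_minus_def minus_add)
  then show "p (\<ominus> s m \<ominus> \<ominus> s n) \<le> 1 * (p (s m \<ominus> s n) + p (s m \<ominus> s n))"
    using cauchy_in_carrier[OF assms] by simp
qed (use assms in \<open>auto simp: cauchy_in_carrier\<close>)

lemma p_mult_diff_le:
  assumes "a \<in> carrier A" "b \<in> carrier A" "c \<in> carrier A" "d \<in> carrier A"
  shows "p (a \<otimes> b \<ominus> c \<otimes> d) \<le> p a * p (b \<ominus> d) + p (a \<ominus> c) * p d"
  unfolding mult_diff_mult[OF assms]
  using assms by (intro order.trans[OF p_add] add_mono p_mult) auto

lemma cauchy_mult:
  assumes s: "s \<in> carrier C" and t: "t \<in> carrier C"
  shows "(\<lambda>n. s n \<otimes> t n) \<in> carrier C"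
proof -
  obtain K where K: "K > 0" "\<And>n. p (s n) \<le> K" using cauchy_bounded[OF s] by blast
  obtain L where L: "L > 0" "\<And>n. p (t n) \<le> L" using cauchy_bounded[OF t] by blast
  note [simp] = cauchy_in_carrier[OF s] cauchy_in_carrier[OF t]
  show ?thesis
  proof (rule cauchyI_le[OF s t, where K = "K + L"])
    fix m n
    have "p (s m \<otimes> t m \<ominus> s n \<otimes> t n)
        \<le> p (s m) * p (t m \<ominus> t n) + p (s m \<ominus> s n) * p (t n)"
      by (rule p_mult_diff_le) auto
    also have "\<dots> \<le> (K + L) * p (t m \<ominus> t n) + p (s m \<ominus> s n) * (K + L)"
      using K(2)[of m] L(2)[of n] K(1) L(1) by (intro add_mono mult_mono) auto
    finally show "p (s m \<otimes> t m \<ominus> s n \<otimes> t n)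
        \<le> (K + L) * (p (s m \<ominus> s n) + p (t m \<ominus> t n))"
      by (simp add: algebra_simps)
  qed (use K L in auto)
qed

lemma cauchy_scale:
  assumes s: "s \<in> carrier C" shows "(\<lambda>n. scale A c (s n)) \<in> carrier C"
proof (rule cauchyI_le[OF s s, where K = "cmod c + 1"])
  fix m n
  show "p (scale A c (s m) \<ominus> scale A c (s n))
      \<le> (cmod c + 1) * (p (s m \<ominus> s n) + p (s m \<ominus> s n))"
    using cauchy_in_carrier[OF s] by (auto simp: scale_diff[symmetric] p_scale algebra_simps)
next
  show "0 < cmod c + 1" by (simp add: add_nonneg_pos)
qed (use cauchy_in_carrier[OF s] in auto)

lemma cauchy_star:
  assumes s: "s \<in> carrier C" shows "(\<lambda>n. star A (s n)) \<in> carrier C"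
  by (rule cauchyI_le[OF s s, where K = 1])
     (use cauchy_in_carrier[OF s] in \<open>auto simp: star_diff[symmetric]\<close>)

lemma cauchy_algebra_simps:
  "mult C s t = (\<lambda>n. s n \<otimes> t n)" "add C s t = (\<lambda>n. s n \<oplus> t n)"
  "one C = (\<lambda>n. \<one>)" "ring.zero C = (\<lambda>n. \<zero>)"
  "scale C c s = (\<lambda>n. scale A c (s n))" "star C s = (\<lambda>n. star A (s n))"
  "nrm C s = lim (\<lambda>n. p (s n))"
  by (simp_all add: cauchy_algebra_def)

lemma ring_cauchy: "ring C"
proof (rule ringI)
  show "abelian_group C"
  proof (rule abelian_groupI)
    fix s assume "s \<in> carrier C"
    then show "\<exists>t\<in>carrier C. add C t s = ring.zero C"
      by (intro bexI[where x = "\<lambda>n. \<ominus> s n"] cauchy_minus)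
         (auto simp: cauchy_algebra_simps l_neg cauchy_in_carrier)
  qed (auto simp: cauchy_algebra_simps cauchy_add cauchy_const cauchy_in_carrier intro!: ext a_ac)
  show "Group.monoid C"
    by (rule monoidI)
       (auto simp: cauchy_algebra_simps cauchy_mult cauchy_const cauchy_in_carrier intro!: ext m_assoc)
qed (auto simp: cauchy_algebra_simps cauchy_in_carrier l_distr r_distr)

lemma cauchy_a_inv: "s \<in> carrier C \<Longrightarrow> a_inv C s = (\<lambda>n. \<ominus> s n)"
  by (rule abelian_group.minus_equality[OF ring.is_abelian_group[OF ring_cauchy]])
     (auto simp: cauchy_algebra_simps cauchy_minus l_neg cauchy_in_carrier)

lemma cauchy_a_minus:
  "s \<in> carrier C \<Longrightarrow> t \<in> carrier C \<Longrightarrow> a_minus C s t = (\<lambda>n. s n \<ominus> t n)"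
  by (simp add: a_minus_def cauchy_a_inv cauchy_algebra_simps)

lemma null_seqs_iff: "s \<in> N \<longleftrightarrow> (\<forall>n. s n \<in> carrier A) \<and> (\<lambda>n. p (s n)) \<longlonglongrightarrow> 0"
  by (simp add: null_seqs_def)

lemma null_seqsI:
  assumes "\<And>n. s n \<in> carrier A" "\<And>n. p (s n) \<le> f n" "f \<longlonglongrightarrow> 0" shows "s \<in> N"
  unfolding null_seqs_iff
proof (intro conjI allI)
  show "(\<lambda>n. p (s n)) \<longlonglongrightarrow> 0"
    by (rule Lim_null_comparison[OF always_eventually assms(3)]) (use assms in auto)
qed (rule assms)

lemma null_seqs_cauchy:
  assumes "s \<in> N" shows "s \<in> carrier C"
  unfolding cauchy_carrier_iff
proof (intro conjI allI impI)
  fix e :: real assume "e > 0"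
  then have "\<forall>\<^sub>F n in sequentially. p (s n) < e / 2"
    using assms unfolding null_seqs_iff by (auto dest!: order_tendstoD(2)[of _ 0 _ "e / 2"])
  then obtain M where M: "\<forall>n\<ge>M. p (s n) < e / 2" by (auto simp: eventually_sequentially)
  have "p (s m \<ominus> s n) < e" if "m \<ge> M" "n \<ge> M" for m n
  proof -
    have "p (s m \<ominus> s n) \<le> p (s m) + p (s n)"
      using assms by (intro p_diff) (auto simp: null_seqs_iff)
    then show ?thesis using M that by (smt (verit) field_sum_of_halves)
  qed
  then show "\<exists>M. \<forall>m\<ge>M. \<forall>n\<ge>M. p (s m \<ominus> s n) < e" by blast
qed (use assms in \<open>auto simp: null_seqs_iff\<close>)

lemma null_seqs_add:
  assumes "s \<in> N" "t \<in> N" shows "(\<lambda>n. s n \<oplus> t n) \<in> N"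
  by (rule null_seqsI[where f = "\<lambda>n. p (s n) + p (t n)"])
     (use assms in \<open>auto simp: null_seqs_iff intro!: p_add tendsto_add_zero\<close>)

lemma null_seqs_minus: "s \<in> N \<Longrightarrow> (\<lambda>n. \<ominus> s n) \<in> N"
  by (auto simp: null_seqs_iff)

lemma null_seqs_mult_left:
  assumes s: "s \<in> N" and t: "t \<in> carrier C" shows "(\<lambda>n. t n \<otimes> s n) \<in> N"
proof -
  obtain K where K: "K > 0" "\<And>n. p (t n) \<le> K" using cauchy_bounded[OF t] by blast
  show ?thesis
  proof (rule null_seqsI[where f = "\<lambda>n. K * p (s n)"])
    fix n
    have "p (t n \<otimes> s n) \<le> p (t n) * p (s n)"
      using s t by (intro p_mult) (auto simp: cauchy_in_carrier null_seqs_iff)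
    also have "\<dots> \<le> K * p (s n)" using K s by (intro mult_right_mono) (auto simp: null_seqs_iff)
    finally show "p (t n \<otimes> s n) \<le> K * p (s n)" .
  qed (use s t in \<open>auto simp: cauchy_in_carrier null_seqs_iff intro: tendsto_mult_right_zero\<close>)
qed

lemma null_seqs_mult_right:
  assumes s: "s \<in> N" and t: "t \<in> carrier C" shows "(\<lambda>n. s n \<otimes> t n) \<in> N"
proof -
  obtain K where K: "K > 0" "\<And>n. p (t n) \<le> K" using cauchy_bounded[OF t] by blast
  show ?thesis
  proof (rule null_seqsI[where f = "\<lambda>n. p (s n) * K"])
    fix n
    have "p (s n \<otimes> t n) \<le> p (s n) * p (t n)"
      using s t by (intro p_mult) (auto simp: cauchy_in_carrier null_seqs_iff)
    also have "\<dots> \<le> p (s n) * K" using K s by (intro mult_left_mono) (auto simp: null_seqs_iff)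
    finally show "p (s n \<otimes> t n) \<le> p (s n) * K" .
  qed (use s t in \<open>auto simp: cauchy_in_carrier null_seqs_iff intro: tendsto_mult_left_zero\<close>)
qed

text \<open>Absorption works because a Cauchy sequence is bounded, so multiplying by it keeps the
  seminorm tending to 0. The ideal property opens the coset calculus of quotient rings for the
  completion.\<close>

lemma ideal_null_seqs: "ideal N C"
proof (rule idealI[OF ring_cauchy])
  show "subgroup N (add_monoid C)"
  proof (rule subgroup.intro)
    fix s assume "s \<in> N"
    then show "inv\<^bsub>add_monoid C\<^esub> s \<in> N"
      using cauchy_a_inv[OF null_seqs_cauchy] null_seqs_minus by (simp add: a_inv_def)
  qed (auto simp: null_seqs_cauchy cauchy_algebra_simps null_seqs_add, simp add: null_seqs_iff)
qed (auto simp: cauchy_algebra_simps null_seqs_mult_left null_seqs_mult_right)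

section \<open>Arithmetic and norm of the completion on representatives\<close>

definition cls :: "(nat \<Rightarrow> 'a) \<Rightarrow> (nat \<Rightarrow> 'a) set" where
  "cls s = N +>\<^bsub>C\<^esub> s"

lemma mem_cls_iff:
  assumes "s \<in> carrier C"
  shows "t \<in> cls s \<longleftrightarrow> t \<in> carrier C \<and> (\<lambda>n. t n \<ominus> s n) \<in> N"
proof -
  interpret I: ideal N C by (rule ideal_null_seqs)
  have "t \<in> carrier C" if "t \<in> cls s"
    using that I.a_elemrcos_carrier[OF assms] by (simp add: cls_def)
  then show ?thesis
    using I.a_rcos_module_minus[OF ring_cauchy assms] cauchy_a_minus[OF _ assms]
    by (auto simp: cls_def)
qed

lemma cls_self: "s \<in> carrier C \<Longrightarrow> s \<in> cls s"
  by (simp add: mem_cls_iff null_seqs_iff cauchy_in_carrier a_minus_def r_neg)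

lemma cls_eq: "s \<in> carrier C \<Longrightarrow> t \<in> cls s \<Longrightarrow> cls t = cls s"
  using ideal.axioms(1)[OF ideal_null_seqs] ideal_null_seqs
  by (metis abelian_subgroup.a_repr_independence' abelian_subgroupI3 cls_def ring.is_abelian_group
      ring_cauchy)

lemma cls_eq_iff:
  assumes "s \<in> carrier C" "t \<in> carrier C"
  shows "cls s = cls t \<longleftrightarrow> (\<lambda>n. p (s n \<ominus> t n)) \<longlonglongrightarrow> 0"
proof -
  have "cls s = cls t \<longleftrightarrow> s \<in> cls t" using assms cls_self cls_eq by metis
  then show ?thesis
    using assms by (auto simp: mem_cls_iff null_seqs_iff cauchy_in_carrier)
qed

abbreviation "CP \<equiv> completion A p"

lemma carrier_completion: "carrier CP = cls ` carrier C"
  unfolding completion_def quotient_algebra_def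
  by (auto simp: FactRing_def A_RCOSETS_def' cls_def a_r_coset_def')

lemma completion_carrierE:
  assumes "x \<in> carrier CP" obtains s where "s \<in> carrier C" "x = cls s"
  using assms by (auto simp: carrier_completion)

lemma completion_mult: "s \<in> carrier C \<Longrightarrow> t \<in> carrier C \<Longrightarrow>
    mult CP (cls s) (cls t) = cls (\<lambda>n. s n \<otimes> t n)"
  using ideal.rcoset_mult_add[OF ideal_null_seqs, of s t]
  by (simp add: completion_def quotient_algebra_def FactRing_def cls_def cauchy_algebra_simps)

lemma completion_add: "s \<in> carrier C \<Longrightarrow> t \<in> carrier C \<Longrightarrow>
    add CP (cls s) (cls t) = cls (\<lambda>n. s n \<oplus> t n)"
  using ideal.a_rcos_sum[OF ideal_null_seqs, of s t]
  by (simp add: completion_def quotient_algebra_def FactRing_def cls_def cauchy_algebra_simps)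

lemma completion_one: "one CP = cls (\<lambda>n. \<one>)"
  by (simp add: completion_def quotient_algebra_def FactRing_def cls_def cauchy_algebra_simps)

lemma completion_zero: "ring.zero CP = cls (\<lambda>n. \<zero>)"
proof -
  interpret I: ideal N C by (rule ideal_null_seqs)
  show ?thesis
    using I.a_coset_add_zero[OF I.a_subset]
    by (simp add: completion_def quotient_algebra_def FactRing_def cls_def cauchy_algebra_simps)
qed

text \<open>The quotient defines the star as a union over all representatives. Since the star is
  isometric, each of them contributes the same coset and the union collapses;
  \<open>completion_scale\<close> follows the same pattern.\<close>

lemma completion_star:
  assumes "s \<in> carrier C" shows "star CP (cls s) = cls (\<lambda>n. star A (s n))"
proof -
  have "cls (\<lambda>n. star A (t n)) = cls (\<lambda>n. star A (s n))" if "t \<in> cls s" for t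
    using that assms
    by (subst cls_eq_iff) (auto simp: mem_cls_iff cauchy_star cauchy_in_carrier star_diff[symmetric] null_seqs_iff)
  then have "(\<Union>t\<in>cls s. cls (\<lambda>n. star A (t n))) = cls (\<lambda>n. star A (s n))"
    by (intro UN_constant_eq[OF cls_self[OF assms]]) simp
  then show ?thesis
    by (simp add: completion_def quotient_algebra_def cls_def[symmetric] cauchy_algebra_simps)
qed

lemma completion_scale:
  assumes "s \<in> carrier C" shows "scale CP c (cls s) = cls (\<lambda>n. scale A c (s n))"
proof -
  have "cls (\<lambda>n. scale A c (t n)) = cls (\<lambda>n. scale A c (s n))" if "t \<in> cls s" for t
    using that assms
    by (subst cls_eq_iff) (auto simp: mem_cls_iff cauchy_scale cauchy_in_carrier scale_diff[symmetric]
        null_seqs_iff p_scale intro: tendsto_mult_right_zero)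
  then have "(\<Union>t\<in>cls s. cls (\<lambda>n. scale A c (t n))) = cls (\<lambda>n. scale A c (s n))"
    by (intro UN_constant_eq[OF cls_self[OF assms]]) simp
  then show ?thesis
    by (simp add: completion_def quotient_algebra_def cls_def[symmetric] cauchy_algebra_simps)
qed

lemma completion_nrm:
  assumes "s \<in> carrier C" shows "nrm CP (cls s) = lim (\<lambda>n. p (s n))"
proof -
  have "lim (\<lambda>n. p (t n)) = lim (\<lambda>n. p (s n))" if "t \<in> cls s" for t
  proof -
    have t: "t \<in> carrier C" "(\<lambda>n. p (t n \<ominus> s n)) \<longlonglongrightarrow> 0"
      using that assms by (auto simp: mem_cls_iff null_seqs_iff)
    have "(\<lambda>n. p (t n) - p (s n)) \<longlonglongrightarrow> 0"
      by (rule Lim_null_comparison[OF _ t(2)])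
         (use t(1) assms in \<open>auto intro!: p_abs_diff always_eventually cauchy_in_carrier\<close>)
    moreover have "(\<lambda>n. p (s n)) \<longlonglongrightarrow> lim (\<lambda>n. p (s n))"
      using cauchy_convergent[OF assms] by (simp add: convergent_LIMSEQ_iff)
    ultimately have "(\<lambda>n. (p (t n) - p (s n)) + p (s n)) \<longlonglongrightarrow> 0 + lim (\<lambda>n. p (s n))"
      by (rule tendsto_add)
    then have "(\<lambda>n. p (t n)) \<longlonglongrightarrow> lim (\<lambda>n. p (s n))" by simp
    then show ?thesis by (rule limI)
  qed
  then have "(INF t\<in>cls s. lim (\<lambda>n. p (t n))) = (INF t\<in>cls s. lim (\<lambda>n. p (s n)))"
    by (intro INF_cong) auto
  also have "\<dots> = lim (\<lambda>n. p (s n))" using cls_self[OF assms] by (intro cINF_const) auto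
  finally show ?thesis
    by (simp add: completion_def quotient_algebra_def cls_def[symmetric] cauchy_algebra_simps)
qed

lemma abelian_group_completion: "abelian_group CP"
proof (rule abelian_groupI)
  fix x assume "x \<in> carrier CP"
  then obtain s where s: "s \<in> carrier C" "x = cls s" by (rule completion_carrierE)
  show "\<exists>y\<in>carrier CP. add CP y x = ring.zero CP"
    using s by (intro bexI[where x = "cls (\<lambda>n. \<ominus> s n)"])
       (auto simp: completion_add cauchy_minus completion_zero l_neg cauchy_in_carrier carrier_completion)
qed (auto simp: carrier_completion completion_add completion_zero cauchy_add cauchy_const
      cauchy_in_carrier a_ac)

lemma completion_minus:
  assumes s: "s \<in> carrier C" and t: "t \<in> carrier C"
  shows "a_minus CP (cls s) (cls t) = cls (\<lambda>n. s n \<ominus> t n)"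
proof -
  have "a_inv CP (cls t) = cls (\<lambda>n. \<ominus> t n)"
    using t by (intro abelian_group.minus_equality[OF abelian_group_completion])
       (auto simp: completion_add cauchy_minus completion_zero l_neg cauchy_in_carrier carrier_completion)
  then show ?thesis
    unfolding a_minus_def using s t by (simp add: completion_add cauchy_minus)
qed

lemma cauchy_diff: "s \<in> carrier C \<Longrightarrow> t \<in> carrier C \<Longrightarrow> (\<lambda>n. s n \<ominus> t n) \<in> carrier C"
  unfolding a_minus_def by (intro cauchy_add cauchy_minus)

lemma completion_dist_tendsto:
  assumes s: "s \<in> carrier C" and t: "t \<in> carrier C"
  shows "(\<lambda>n. p (s n \<ominus> t n)) \<longlonglongrightarrow> nrm CP (a_minus CP (cls s) (cls t))"
  using cauchy_convergent[OF cauchy_diff[OF s t]]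
  by (simp add: completion_minus s t completion_nrm cauchy_diff convergent_LIMSEQ_iff)

lemma completion_dist_triangle:
  assumes "x \<in> carrier CP" "y \<in> carrier CP" "z \<in> carrier CP"
  shows "nrm CP (a_minus CP y z) \<le> nrm CP (a_minus CP x y) + nrm CP (a_minus CP x z)"
proof -
  obtain r s t where rst: "r \<in> carrier C" "x = cls r" "s \<in> carrier C" "y = cls s"
    "t \<in> carrier C" "z = cls t"
    using assms by (meson completion_carrierE)
  have "p (s n \<ominus> t n) \<le> p (r n \<ominus> s n) + p (r n \<ominus> t n)" for n
    using p_diff_triangle[of "s n" "r n" "t n"] p_diff_commute[of "s n" "r n"] rst
    by (simp add: cauchy_in_carrier)
  then show ?thesis
    unfolding rst(2,4,6)
    by (intro LIMSEQ_le[OF completion_dist_tendsto tendsto_add[OF completion_dist_tendsto completion_dist_tendsto]])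
       (use rst in auto)
qed

lemma completion_separating:
  assumes "y \<in> carrier CP" "z \<in> carrier CP" "nrm CP (a_minus CP y z) \<le> 0"
  shows "y = z"
proof -
  obtain s t where st: "s \<in> carrier C" "y = cls s" "t \<in> carrier C" "z = cls t"
    using assms by (meson completion_carrierE)
  have "0 \<le> nrm CP (a_minus CP y z)"
    using st completion_dist_tendsto[of s t]
    by (intro LIMSEQ_le_const[of _ _ 0]) (auto simp: cauchy_in_carrier)
  then have "nrm CP (a_minus CP y z) = 0" using assms(3) by simp
  then show ?thesis using completion_dist_tendsto[of s t] st by (simp add: cls_eq_iff)
qed

lemma to_completion_eq: "to_completion A p a = cls (\<lambda>n. a)"
  by (simp add: to_completion_def cls_def)

text \<open>Density of the original algebra: the distance from the constant class of
  \<open>s n\<close> to \<open>cls s\<close> is the limit of \<open>p (s n \<ominus> s m)\<close> in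
  \<open>m\<close>, which the Cauchy condition makes small.\<close>

lemma to_completion_tendsto:
  assumes s: "s \<in> carrier C"
  shows "(\<lambda>n. nrm CP (a_minus CP (to_completion A p (s n)) (cls s))) \<longlonglongrightarrow> 0" (is "?D \<longlonglongrightarrow> 0")
proof (rule LIMSEQ_I)
  fix e :: real assume "e > 0"
  then have "e / 2 > 0" by simp
  then obtain M where M: "\<And>m n. m \<ge> M \<Longrightarrow> n \<ge> M \<Longrightarrow> p (s m \<ominus> s n) < e / 2"
    using s unfolding cauchy_carrier_iff by blast
  have "norm (?D n - 0) < e" if "n \<ge> M" for n
  proof -
    have lim: "(\<lambda>m. p (s n \<ominus> s m)) \<longlonglongrightarrow> ?D n"
      unfolding to_completion_eq
      by (rule completion_dist_tendsto[OF cauchy_const[OF cauchy_in_carrier[OF s]] s])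
    have "?D n \<le> e / 2"
      using M[OF that] by (intro LIMSEQ_le_const2[OF lim] exI[of _ M]) (auto intro: less_imp_le)
    moreover have "0 \<le> ?D n"
      using cauchy_in_carrier[OF s] by (intro LIMSEQ_le_const[OF lim]) auto
    ultimately show ?thesis using \<open>e > 0\<close> by simp
  qed
  then show "\<exists>M. \<forall>n\<ge>M. norm (?D n - 0) < e" by blast
qed

text \<open>Approximates the square root of \<open>1 - z\<close>: writing it as \<open>1 - y\<close>, the element \<open>y\<close> solves
  \<open>y = (z + y\<^sup>2) / 2\<close>, whose right-hand side contracts the ball of radius
  \<open>1 - sqrt (1 - p z)\<close>.\<close>

lemma sqrt_sequence:
  assumes z: "z \<in> carrier A" "star A z = z" "p z < 1"
  obtains w where "w \<in> carrier C" "\<And>n. star A (w n) = w n"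
    "(\<lambda>n. p (w n \<otimes> w n \<ominus> (\<one> \<ominus> z))) \<longlonglongrightarrow> 0"
proof -
  \<comment> \<open>\<open>Y\<close> is the smaller root of \<open>Y = (p z + Y^2) / 2\<close>, the
    scalar majorant of the fixed-point equation; \<open>p z < 1\<close> makes it less than
    1.\<close>
  define Y where "Y = 1 - sqrt (1 - p z)"
  have Y: "0 \<le> Y" "Y < 1" using z by (auto simp: Y_def)
  have Y2: "(p z + Y * Y) / 2 = Y"
    using z(3) by (simp add: Y_def algebra_simps) (simp add: field_simps)
  define F where "F = (\<lambda>y. scale A (1/2) (z \<oplus> y \<otimes> y))"
  define y where "y = (\<lambda>n. (F ^^ n) \<zero>)"
  have y_Suc: "y (Suc n) = scale A (1/2) (z \<oplus> y n \<otimes> y n)" for n by (simp add: y_def F_def)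
  have y_0: "y 0 = \<zero>" by (simp add: y_def)
  have yc [simp]: "y n \<in> carrier A" for n by (induction n) (auto simp: y_0 y_Suc z)
  have ys: "star A (y n) = y n" for n
  proof (induction n)
    case 0
    then show ?case unfolding y_0 by (metis scale_zero_left star_scale complex_cnj_zero zero_closed star_closed)
  next
    case (Suc n)
    then show ?case using z by (simp add: y_Suc star_scale star_add star_mult)
  qed
  have py: "p (y n) \<le> Y" for n
  proof (induction n)
    case (Suc n)
    have "p (y (Suc n)) = p (z \<oplus> y n \<otimes> y n) / 2" using z by (simp add: y_Suc p_scale)
    also have "\<dots> \<le> (p z + p (y n) * p (y n)) / 2"
      using p_add[of z "y n \<otimes> y n"] p_mult[of "y n" "y n"] z by simp
    also have "\<dots> \<le> (p z + Y * Y) / 2" using Suc by (simp add: mult_mono Y)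
    finally show ?case using Y2 by simp
  qed (simp add: y_0 Y)
  \<comment> \<open>The factor 1/2 averages the bounds \<open>p (y n) \<le> Y\<close> and
    \<open>p (y (Suc n)) \<le> Y\<close>, so the radius \<open>Y\<close> is itself the contraction
    factor.\<close>
  have step: "p (y (Suc (Suc n)) \<ominus> y (Suc n)) \<le> Y * p (y (Suc n) \<ominus> y n)" for n
  proof -
    let ?a = "y (Suc n)" and ?b = "y n"
    have "y (Suc (Suc n)) \<ominus> y (Suc n) = scale A (1/2) (?a \<otimes> ?a \<ominus> ?b \<otimes> ?b)"
      unfolding y_Suc[of "Suc n"] by (subst (3) y_Suc)
        (use z in \<open>simp add: scale_diff[symmetric] add_diff_add, simp add: a_minus_def r_neg\<close>)
    then have "p (y (Suc (Suc n)) \<ominus> y (Suc n)) = p (?a \<otimes> ?a \<ominus> ?b \<otimes> ?b) / 2"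
      by (simp add: p_scale)
    also have "\<dots> \<le> (p ?a * p (?a \<ominus> ?b) + p (?a \<ominus> ?b) * p ?b) / 2"
      using p_mult_diff_le[of ?a ?a ?b ?b] by simp
    also have "\<dots> \<le> (Y * p (?a \<ominus> ?b) + p (?a \<ominus> ?b) * Y) / 2"
      using py by (intro divide_right_mono add_mono mult_mono) (auto simp: Y)
    finally show ?thesis by simp
  qed
  define D where "D = p (y 1 \<ominus> y 0)"
  have D: "p (y (Suc n) \<ominus> y n) \<le> D * Y ^ n" for n
  proof (induction n)
    case (Suc n)
    have "p (y (Suc (Suc n)) \<ominus> y (Suc n)) \<le> Y * (D * Y ^ n)"
      using step[of n] mult_left_mono[OF Suc Y(1)] by linarith
    then show ?case by (simp add: mult_ac)
  qed (simp add: D_def)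
  have D0: "D \<ge> 0" by (simp add: D_def)
  have far: "p (y (n + k) \<ominus> y n) \<le> D * Y ^ n * (\<Sum>i<k. Y ^ i)" for n k
  proof (induction k)
    case 0
    then show ?case by (simp add: a_minus_def r_neg)
  next
    case (Suc k)
    have "p (y (n + Suc k) \<ominus> y n) \<le> p (y (Suc (n + k)) \<ominus> y (n + k)) + p (y (n + k) \<ominus> y n)"
      using p_diff_triangle[of "y (Suc (n + k))" "y (n + k)" "y n"] by simp
    also have "\<dots> \<le> D * Y ^ (n + k) + D * Y ^ n * (\<Sum>i<k. Y ^ i)" using D Suc by (intro add_mono) auto
    finally show ?case by (simp add: power_add algebra_simps)
  qed
  have far': "p (y m \<ominus> y n) \<le> D * Y ^ n / (1 - Y)" if nm: "n \<le> m" for m n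
  proof -
    obtain k where k: "m = n + k" using le_Suc_ex[OF nm] by blast
    have "(\<Sum>i<k. Y ^ i) \<le> 1 / (1 - Y)"
      using Y by (simp add: sum_gp_strict divide_right_mono)
    then have "D * Y ^ n * (\<Sum>i<k. Y ^ i) \<le> D * Y ^ n * (1 / (1 - Y))"
      using D0 Y by (intro mult_left_mono) auto
    then show ?thesis using far[of n k] k by simp
  qed
  have geo: "(\<lambda>n. D * Y ^ n / (1 - Y)) \<longlonglongrightarrow> 0"
    by (rule tendsto_divide_zero[OF tendsto_mult_right_zero[OF LIMSEQ_power_zero]]) (use Y in auto)
  have ycauchy: "y \<in> carrier C"
    unfolding cauchy_carrier_iff
  proof (intro conjI allI impI)
    fix e :: real assume "e > 0"
    then obtain M where M: "\<forall>n\<ge>M. D * Y ^ n / (1 - Y) < e"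
      using order_tendstoD(2)[OF geo] by (auto simp: eventually_sequentially)
    have "p (y m \<ominus> y n) < e" if "m \<ge> M" "n \<ge> M" for m n
      using far'[of m n] far'[of n m] M that p_diff_commute[of "y m" "y n"]
      by (cases "m \<le> n") (auto intro: le_less_trans)
    then show "\<exists>M. \<forall>m\<ge>M. \<forall>n\<ge>M. p (y m \<ominus> y n) < e" by blast
  qed simp
  \<comment> \<open>No limit in \<open>A\<close> is taken: the Cauchy sequence \<open>w\<close>
    already represents the square root in the completion.\<close>
  define w where "w = (\<lambda>n. \<one> \<ominus> y n)"
  \<comment> \<open>Expanding the square and inserting
    \<open>z \<oplus> y n \<otimes> y n = 2 y (Suc n)\<close> turns the defect into twice one step
    of the iteration, which decays geometrically.\<close>
  have "w n \<otimes> w n \<ominus> (\<one> \<ominus> z) = scale A 2 (y (Suc n) \<ominus> y n)" for n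
  proof -
    have "z \<oplus> y n \<otimes> y n = scale A 2 (y (Suc n))"
      using z by (simp add: y_Suc scale_scale scale_one)
    moreover have "scale A 2 x = x \<oplus> x" if "x \<in> carrier A" for x
      using add_scale[of x 1 1] that by (simp add: scale_one)
    ultimately have 1: "scale A 2 (y (Suc n) \<ominus> y n) = (z \<oplus> y n \<otimes> y n) \<ominus> (y n \<oplus> y n)"
      by (simp add: scale_diff)
    have w: "w n \<otimes> w n = \<one> \<oplus> (\<ominus> y n \<oplus> (\<ominus> y n \<oplus> y n \<otimes> y n))"
      by (simp add: w_def a_minus_def l_distr r_distr l_minus r_minus minus_add a_assoc)
    have "w n \<otimes> w n \<ominus> (\<one> \<ominus> z)
        = (\<one> \<ominus> \<one>) \<oplus> ((\<ominus> y n \<oplus> (\<ominus> y n \<oplus> y n \<otimes> y n)) \<ominus> \<ominus> z)"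
      unfolding w a_minus_def[of A \<one> z] using z by (intro add_diff_add) auto
    also have "\<dots> = (\<ominus> y n \<oplus> (\<ominus> y n \<oplus> y n \<otimes> y n)) \<oplus> z"
      using z by (simp add: a_minus_def r_neg)
    also have "\<dots> = (z \<oplus> y n \<otimes> y n) \<ominus> (y n \<oplus> y n)"
      using z by (simp add: a_minus_def minus_add a_ac)
    finally show ?thesis unfolding 1 .
  qed
  then have "p (w n \<otimes> w n \<ominus> (\<one> \<ominus> z)) = 2 * p (y (Suc n) \<ominus> y n)" for n
    by (simp add: p_scale)
  moreover have "(\<lambda>n. 2 * p (y (Suc n) \<ominus> y n)) \<longlonglongrightarrow> 0"
  proof (rule Lim_null_comparison[OF always_eventually tendsto_mult_right_zero[OF geo, of 2]], rule allI)
    fix n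
    have "p (y (Suc n) \<ominus> y n) \<le> D * Y ^ n / (1 - Y)" by (rule far') simp
    moreover have "norm (2 * p (y (Suc n) \<ominus> y n)) = 2 * p (y (Suc n) \<ominus> y n)" by simp
    ultimately show "norm (2 * p (y (Suc n) \<ominus> y n)) \<le> 2 * (D * Y ^ n / (1 - Y))" by linarith
  qed
  ultimately have "(\<lambda>n. p (w n \<otimes> w n \<ominus> (\<one> \<ominus> z))) \<longlonglongrightarrow> 0" by simp
  moreover have "w \<in> carrier C"
    unfolding w_def by (intro cauchy_diff cauchy_const ycauchy) simp
  moreover have "star A (w n) = w n" for n by (simp add: w_def star_diff ys)
  ultimately show ?thesis using that by blast
qed

end

section \<open>Group algebras and the universal norm\<close>

lemma group_algebra_carrier_iff:
  "a \<in> carrier (group_algebra G) \<longleftrightarrow> finite {g. a g \<noteq> 0} \<and> {g. a g \<noteq> 0} \<subseteq> carrier G"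
  by (simp add: group_algebra_def)

lemma group_algebra_simps:
  "one (group_algebra G) = (\<lambda>g. if g = \<one>\<^bsub>G\<^esub> then 1 else 0)"
  "ring.zero (group_algebra G) = (\<lambda>g. 0)"
  "add (group_algebra G) a b = (\<lambda>g. a g + b g)"
  "scale (group_algebra G) c a = (\<lambda>g. c * a g)"
  "star (group_algebra G) a = (\<lambda>g. if g \<in> carrier G then cnj (a (inv\<^bsub>G\<^esub> g)) else 0)"
  by (simp_all add: group_algebra_def)

text \<open>Gives several elements a common finite index set, so that their convolution sums can be
  combined termwise; the additional terms vanish.\<close>

lemma group_algebra_mult_eq:
  assumes "finite S" "S \<subseteq> carrier G" "{h. a h \<noteq> 0} \<subseteq> S"
  shows "mult (group_algebra G) a b =
    (\<lambda>g. if g \<in> carrier G then \<Sum>h\<in>S. a h * b (inv\<^bsub>G\<^esub> h \<otimes>\<^bsub>G\<^esub> g) else 0)"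
proof -
  have "(\<Sum>h\<in>{h \<in> carrier G. a h \<noteq> 0}. a h * b (inv\<^bsub>G\<^esub> h \<otimes>\<^bsub>G\<^esub> g))
      = (\<Sum>h\<in>S. a h * b (inv\<^bsub>G\<^esub> h \<otimes>\<^bsub>G\<^esub> g))" for g
    using assms by (intro sum.mono_neutral_left) auto
  then show ?thesis by (simp add: group_algebra_def fun_eq_iff)
qed

text \<open>Mentions neither a group nor a set, so that it can serve both as a group element in
  \<open>group_algebra\<close> and as a basis vector of \<open>ell2 X\<close>.\<close>

definition delta :: "'g \<Rightarrow> 'g \<Rightarrow> complex" where
  "delta g = (\<lambda>h. if h = g then 1 else 0)"

text \<open>A locale separate from \<^locale>\<open>group\<close>: interpreting the group algebra for every group would
  apply again to the additive group of that algebra, without end.\<close>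

locale discrete_group = group
begin

abbreviation "GA \<equiv> group_algebra G"

lemma delta_carrier [simp]: "g \<in> carrier G \<Longrightarrow> delta g \<in> carrier GA"
  by (auto simp: group_algebra_carrier_iff delta_def)

lemma group_algebra_one_eq: "one GA = delta \<one>"
  by (auto simp: group_algebra_simps delta_def)

lemma group_algebra_closedI:
  assumes "finite S" "S \<subseteq> carrier G" "\<And>g. g \<notin> S \<Longrightarrow> a g = 0" shows "a \<in> carrier GA"
proof -
  have "{g. a g \<noteq> 0} \<subseteq> S" using assms(3) by blast
  then show ?thesis using assms(1,2) finite_subset by (auto simp: group_algebra_carrier_iff)
qed

lemma group_algebra_add_closed:
  "a \<in> carrier GA \<Longrightarrow> b \<in> carrier GA \<Longrightarrow> add GA a b \<in> carrier GA"
  by (rule group_algebra_closedI[where S = "{g. a g \<noteq> 0} \<union> {g. b g \<noteq> 0}"])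
     (auto simp: group_algebra_carrier_iff group_algebra_simps)

lemma group_algebra_scale_closed: "a \<in> carrier GA \<Longrightarrow> scale GA c a \<in> carrier GA"
  by (rule group_algebra_closedI[where S = "{g. a g \<noteq> 0}"])
     (auto simp: group_algebra_carrier_iff group_algebra_simps)

lemma group_algebra_star_closed:
  assumes "a \<in> carrier GA" shows "star GA a \<in> carrier GA"
proof -
  have "g \<in> m_inv G ` {g. a g \<noteq> 0}" if "star GA a g \<noteq> 0" for g
    using that by (intro image_eqI[where x = "inv g"]) (auto simp: group_algebra_simps split: if_splits)
  then show ?thesis
    using assms by (intro group_algebra_closedI[where S = "m_inv G ` {g. a g \<noteq> 0}"])
      (auto simp: group_algebra_carrier_iff)
qed

lemma group_algebra_mult_closed:
  assumes "a \<in> carrier GA" "b \<in> carrier GA" shows "mult GA a b \<in> carrier GA"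
proof -
  have "{g. mult GA a b g \<noteq> 0} \<subseteq> (\<lambda>(h, k). h \<otimes> k) ` ({g. a g \<noteq> 0} \<times> {g. b g \<noteq> 0})"
  proof
    fix g assume "g \<in> {g. mult GA a b g \<noteq> 0}"
    then have g: "g \<in> carrier G"
      and "(\<Sum>h\<in>{h \<in> carrier G. a h \<noteq> 0}. a h * b (inv h \<otimes> g)) \<noteq> 0"
      by (auto simp: group_algebra_def split: if_splits)
    then obtain h where h: "h \<in> carrier G" "a h \<noteq> 0" "b (inv h \<otimes> g) \<noteq> 0"
      by (auto elim!: sum.not_neutral_contains_not_neutral)
    moreover have "g = h \<otimes> (inv h \<otimes> g)" using g h by (simp add: m_assoc[symmetric])
    ultimately show "g \<in> (\<lambda>(h, k). h \<otimes> k) ` ({g. a g \<noteq> 0} \<times> {g. b g \<noteq> 0})" by force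
  qed
  moreover have "finite ((\<lambda>(h, k). h \<otimes> k) ` ({g. a g \<noteq> 0} \<times> {g. b g \<noteq> 0}))"
    using assms by (auto simp: group_algebra_carrier_iff)
  moreover have "{g. mult GA a b g \<noteq> 0} \<subseteq> carrier G"
    by (auto simp: group_algebra_def split: if_splits)
  ultimately show ?thesis unfolding group_algebra_carrier_iff using finite_subset by blast
qed

lemma group_algebra_l_distr:
  assumes "a \<in> carrier GA" "b \<in> carrier GA"
  shows "mult GA (add GA a b) c = add GA (mult GA a c) (mult GA b c)"
proof -
  let ?S = "{g. a g \<noteq> 0} \<union> {g. b g \<noteq> 0}"
  have S: "finite ?S" "?S \<subseteq> carrier G" using assms by (auto simp: group_algebra_carrier_iff)
  show ?thesis
    by (subst (1 2 3) group_algebra_mult_eq[OF S])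
       (auto simp: group_algebra_simps sum.distrib algebra_simps)
qed

lemma group_algebra_r_distr:
  "mult GA a (add GA b c) = add GA (mult GA a b) (mult GA a c)"
  by (auto simp: group_algebra_def sum.distrib algebra_simps)

lemma group_algebra_scale_mult:
  assumes "a \<in> carrier GA"
  shows "mult GA (scale GA c a) b = scale GA c (mult GA a b)"
proof -
  let ?S = "{g. a g \<noteq> 0}"
  have S: "finite ?S" "?S \<subseteq> carrier G" using assms by (auto simp: group_algebra_carrier_iff)
  show ?thesis
    by (subst (1 2) group_algebra_mult_eq[OF S])
       (auto simp: group_algebra_simps sum_distrib_left algebra_simps)
qed

lemma group_algebra_mult_scale: "mult GA a (scale GA c b) = scale GA c (mult GA a b)"
  by (auto simp: group_algebra_def sum_distrib_left algebra_simps)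

lemma delta_mult:
  assumes "g \<in> carrier G"
  shows "mult GA (delta g) b = (\<lambda>x. if x \<in> carrier G then b (inv g \<otimes> x) else 0)"
  by (subst group_algebra_mult_eq[of "{g}"]) (use assms in \<open>auto simp: delta_def\<close>)

lemma mult_delta:
  assumes "k \<in> carrier G" "a \<in> carrier GA"
  shows "mult GA a (delta k) = (\<lambda>x. if x \<in> carrier G then a (x \<otimes> inv k) else 0)"
proof
  fix x
  let ?S = "{h \<in> carrier G. a h \<noteq> 0}"
  have fin: "finite ?S" using assms by (auto simp: group_algebra_carrier_iff)
  show "mult GA a (delta k) x = (if x \<in> carrier G then a (x \<otimes> inv k) else 0)"
  proof (cases "x \<in> carrier G")
    case True
    have "(\<Sum>h\<in>?S. a h * delta k (inv h \<otimes> x)) = (\<Sum>h\<in>?S. if h = x \<otimes> inv k then a h else 0)"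
    proof (rule sum.cong)
      fix h assume h: "h \<in> ?S"
      have "inv h \<otimes> x = k \<longleftrightarrow> h = x \<otimes> inv k"
        using h True assms(1) by (metis (no_types, lifting) inv_closed inv_solve_left inv_solve_right mem_Collect_eq)
      then show "a h * delta k (inv h \<otimes> x) = (if h = x \<otimes> inv k then a h else 0)"
        by (simp add: delta_def)
    qed simp
    also have "\<dots> = a (x \<otimes> inv k)"
      using True assms(1) by (simp add: sum.delta[OF fin])
    finally show ?thesis using True by (simp add: group_algebra_def)
  qed (simp add: group_algebra_def)
qed

lemma delta_mult_delta:
  "g \<in> carrier G \<Longrightarrow> k \<in> carrier G \<Longrightarrow> mult GA (delta g) (delta k) = delta (g \<otimes> k)"
  unfolding delta_mult by (auto simp: delta_def fun_eq_iff inv_solve_left')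

lemma star_delta: "g \<in> carrier G \<Longrightarrow> star GA (delta g) = delta (inv g)"
  by (auto simp: group_algebra_simps delta_def fun_eq_iff)

text \<open>Replaces the manipulation of nested convolution sums: identities that are additive in
  one argument reduce to multiples of \<open>delta g\<close>. The support is peeled off point by
  point.\<close>

lemma group_algebra_induct [consumes 1, case_names zero add]:
  assumes "a \<in> carrier GA" and zero: "P (ring.zero GA)"
    and add: "\<And>a c g. a \<in> carrier GA \<Longrightarrow> P a \<Longrightarrow> g \<in> carrier G \<Longrightarrow>
      P (add GA (scale GA c (delta g)) a)"
  shows "P a"
proof -
  have "P a" if "finite F" "{g. a g \<noteq> 0} \<subseteq> F" "F \<subseteq> carrier G" for F a
    using that
  proof (induction F arbitrary: a)
    case empty
    then have "a = ring.zero GA" by (auto simp: group_algebra_simps)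
    then show ?case using zero by simp
  next
    case (insert g F)
    let ?a = "a(g := 0)"
    have "?a \<in> carrier GA"
      using insert.prems insert.hyps
      by (auto simp: group_algebra_carrier_iff intro: finite_subset[of _ F])
    moreover have "P ?a" using insert.prems by (intro insert.IH) auto
    ultimately have "P (add GA (scale GA (a g) (delta g)) ?a)" using insert.prems by (intro add) auto
    also have "add GA (scale GA (a g) (delta g)) ?a = a"
      by (auto simp: group_algebra_simps delta_def)
    finally show ?case .
  qed
  then show ?thesis using assms(1) by (auto simp: group_algebra_carrier_iff)
qed

text \<open>Left multiplication by \<open>delta g\<close> is translation, so the support of the
  product lies in the translate of the support of \<open>b\<close> and one reindexing suffices. Full
  associativity then follows by \<open>group_algebra_induct\<close> in the left factor.\<close>

lemma delta_mult_assoc: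
  assumes g: "g \<in> carrier G" and b: "b \<in> carrier GA"
  shows "mult GA (mult GA (delta g) b) c = mult GA (delta g) (mult GA b c)"
proof
  fix x
  let ?T = "{h. b h \<noteq> 0}"
  have T: "finite ?T" "?T \<subseteq> carrier G" using b by (auto simp: group_algebra_carrier_iff)
  let ?S = "(\<lambda>k. g \<otimes> k) ` ?T"
  have S: "finite ?S" "?S \<subseteq> carrier G" using T g by auto
  have sub: "{h. mult GA (delta g) b h \<noteq> 0} \<subseteq> ?S"
  proof
    fix h assume "h \<in> {h. mult GA (delta g) b h \<noteq> 0}"
    then have "h \<in> carrier G" "b (inv g \<otimes> h) \<noteq> 0"
      using g by (auto simp: delta_mult split: if_splits)
    then show "h \<in> ?S" using g by (intro image_eqI[where x = "inv g \<otimes> h"]) (auto simp: m_assoc[symmetric])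
  qed
  have inj: "inj_on (\<lambda>k. g \<otimes> k) ?T" using inj_on_cmult[OF g] T(2) by (rule inj_on_subset)
  show "mult GA (mult GA (delta g) b) c x = mult GA (delta g) (mult GA b c) x"
  proof (cases "x \<in> carrier G")
    case True
    have "mult GA (mult GA (delta g) b) c x
        = (\<Sum>h\<in>?S. mult GA (delta g) b h * c (inv h \<otimes> x))"
      using True by (subst group_algebra_mult_eq[OF S sub]) simp
    also have "\<dots> = (\<Sum>k\<in>?T. mult GA (delta g) b (g \<otimes> k) * c (inv (g \<otimes> k) \<otimes> x))"
      by (simp add: sum.reindex[OF inj])
    also have "\<dots> = (\<Sum>k\<in>?T. b k * c (inv k \<otimes> (inv g \<otimes> x)))"
    proof (rule sum.cong)
      fix k assume "k \<in> ?T"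
      then have k: "k \<in> carrier G" using T by auto
      have "inv g \<otimes> (g \<otimes> k) = k" using g k by (simp add: m_assoc[symmetric])
      then show "mult GA (delta g) b (g \<otimes> k) * c (inv (g \<otimes> k) \<otimes> x)
          = b k * c (inv k \<otimes> (inv g \<otimes> x))"
        using g k True by (simp add: delta_mult inv_mult_group m_assoc)
    qed simp
    also have "\<dots> = mult GA (delta g) (mult GA b c) x"
      using True g by (simp add: delta_mult) (subst group_algebra_mult_eq[OF T], auto)
    finally show ?thesis .
  next
    case False
    then show ?thesis by (simp add: group_algebra_def)
  qed
qed

lemma group_algebra_assoc:
  assumes "a \<in> carrier GA" and b: "b \<in> carrier GA"
  shows "mult GA (mult GA a b) c = mult GA a (mult GA b c)"
  using assms(1)
proof (induction a rule: group_algebra_induct)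
  case zero
  show ?case by (auto simp: group_algebra_def)
next
  case (add a d g)
  then show ?case
    using b by (simp add: group_algebra_l_distr group_algebra_scale_closed group_algebra_scale_mult
        group_algebra_mult_closed delta_mult_assoc)
qed

lemma group_algebra_star_mult:
  assumes "a \<in> carrier GA" and b: "b \<in> carrier GA"
  shows "star GA (mult GA a b) = mult GA (star GA b) (star GA a)"
  using assms(1)
proof (induction a rule: group_algebra_induct)
  case zero
  show ?case by (auto simp: group_algebra_def)
next
  case (add a d g)
  have "star GA (mult GA (delta g) b) = mult GA (star GA b) (star GA (delta g))"
    using add.hyps b unfolding star_delta[OF add.hyps(2)] delta_mult[OF add.hyps(2)]
    by (subst mult_delta) (auto simp: group_algebra_star_closed, auto simp: group_algebra_simps
        inv_mult_group fun_eq_iff)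
  moreover have "star GA (add GA (scale GA d x) y) = add GA (scale GA (cnj d) (star GA x)) (star GA y)"
    for x y by (auto simp: group_algebra_simps)
  ultimately show ?case
    using add b by (simp add: group_algebra_l_distr group_algebra_r_distr group_algebra_scale_closed
        group_algebra_scale_mult group_algebra_mult_scale)
qed

lemma star_algebra_group_algebra: "complex_star_algebra GA"
proof (intro complex_star_algebra.intro complex_star_algebra_axioms.intro ringI)
  show "abelian_group GA"
  proof (rule abelian_groupI)
    fix a assume "a \<in> carrier GA"
    then show "\<exists>b\<in>carrier GA. add GA b a = ring.zero GA"
      by (intro bexI[where x = "scale GA (-1) a"] group_algebra_scale_closed)
         (auto simp: group_algebra_simps)
  qed (auto simp: group_algebra_add_closed, auto simp: group_algebra_simps group_algebra_carrier_iff)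
  show "Group.monoid GA"
  proof (rule monoidI)
    show "mult GA (one GA) a = a" "mult GA a (one GA) = a" if "a \<in> carrier GA" for a
      using that by (auto simp: group_algebra_one_eq delta_mult mult_delta group_algebra_carrier_iff fun_eq_iff)
  qed (auto simp: group_algebra_mult_closed group_algebra_assoc group_algebra_one_eq)
qed (auto simp: group_algebra_l_distr group_algebra_r_distr group_algebra_scale_closed
      group_algebra_star_closed group_algebra_star_mult group_algebra_scale_mult group_algebra_mult_scale,
     auto simp: group_algebra_simps group_algebra_carrier_iff algebra_simps fun_eq_iff)

end

sublocale discrete_group \<subseteq> GA: complex_star_algebra "group_algebra G"
  by (rule star_algebra_group_algebra)

section \<open>The universal C*-seminorm\<close>

context discrete_group
begin

text \<open>\<open>delta g\<close> is unitary, so by the C*-identity the square of its seminorm is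
  the seminorm of the unit, which is at most 1.\<close>

lemma cstar_seminorm_delta:
  assumes "cstar_seminorm GA p" "g \<in> carrier G" shows "p (delta g) \<le> 1"
proof -
  interpret P: cstar_seminormed_algebra GA p
    by (simp add: GA.complex_star_algebra_axioms assms cstar_seminormed_algebra.intro
        cstar_seminormed_algebra_axioms.intro)
  have "(p (delta g))\<^sup>2 = p (one GA)"
    using assms P.p_star_mult[of "delta g"]
    by (simp add: star_delta delta_mult_delta group_algebra_one_eq)
  then have "(p (delta g))\<^sup>2 \<le> 1" using P.p_one_le by simp
  then show ?thesis by (simp add: abs_square_le_1)
qed

text \<open>The induction accumulates the l1-norm, a bound independent of \<open>p\<close>; this
  makes the supremum in \<open>full_norm\<close> finite.\<close>

lemma cstar_seminorm_bounded:
  assumes "a \<in> carrier GA" shows "\<exists>K. \<forall>p. cstar_seminorm GA p \<longrightarrow> p a \<le> K"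
  using assms
proof (induction a rule: group_algebra_induct)
  case zero
  have "p (ring.zero GA) \<le> 0" if "cstar_seminorm GA p" for p
  proof -
    have "p (scale GA 0 (ring.zero GA)) = cmod 0 * p (ring.zero GA)"
      using that GA.zero_closed unfolding cstar_seminorm_def by blast
    then show ?thesis by simp
  qed
  then show ?case by blast
next
  case (add a c g)
  then obtain K where K: "\<And>p. cstar_seminorm GA p \<Longrightarrow> p a \<le> K" by blast
  have "p (add GA (scale GA c (delta g)) a) \<le> cmod c + K" if p: "cstar_seminorm GA p" for p
  proof -
    have "p (add GA (scale GA c (delta g)) a) \<le> cmod c * p (delta g) + p a"
      using p add.hyps unfolding cstar_seminorm_def
      by (metis GA.scale_closed delta_carrier)
    also have "\<dots> \<le> cmod c * 1 + K"
      using cstar_seminorm_delta[OF p] add.hyps K[OF p] by (intro add_mono mult_left_mono) auto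
    finally show ?thesis by simp
  qed
  then show ?case by blast
qed

lemma cstar_seminorm_le_full_norm:
  assumes "a \<in> carrier GA" "cstar_seminorm GA p" shows "p a \<le> full_norm G a"
proof -
  obtain K where K: "\<And>p. cstar_seminorm GA p \<Longrightarrow> p a \<le> K"
    using cstar_seminorm_bounded[OF assms(1)] by blast
  then have "bdd_above ((\<lambda>p. p a) ` {p. cstar_seminorm GA p})" by (intro bdd_aboveI2) auto
  then show ?thesis unfolding full_norm_def using assms by (intro cSUP_upper) auto
qed

lemma full_norm_le:
  assumes "\<And>p. cstar_seminorm GA p \<Longrightarrow> p a \<le> K" shows "full_norm G a \<le> K"
proof -
  \<comment> \<open>The zero seminorm makes the index set of the supremum nonempty.\<close>
  have "cstar_seminorm GA (\<lambda>a. 0)" by (simp add: cstar_seminorm_def)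
  then have "{p. cstar_seminorm GA p} \<noteq> {}" by blast
  then show ?thesis unfolding full_norm_def using assms by (intro cSUP_least) auto
qed

text \<open>Inequalities pass to a pointwise supremum directly. The two equalities need reverse
  bounds: homogeneity by dividing by \<open>cmod c\<close>, the C*-identity by bounding each
  \<open>p a\<close> by a square root.\<close>

lemma cstar_seminorm_full_norm: "cstar_seminorm GA (full_norm G)"
  unfolding cstar_seminorm_def
proof (intro conjI ballI allI)
  have "cstar_seminorm GA (\<lambda>a. 0)" by (simp add: cstar_seminorm_def)
  then show nonneg: "0 \<le> full_norm G a" if "a \<in> carrier GA" for a
    using cstar_seminorm_le_full_norm[OF that] by fastforce
  note le = cstar_seminorm_le_full_norm
  fix a assume a: "a \<in> carrier GA"
  show "full_norm G (scale GA c a) = cmod c * full_norm G a" for c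
  proof (rule antisym)
    show "full_norm G (scale GA c a) \<le> cmod c * full_norm G a"
    proof (rule full_norm_le)
      fix p assume p: "cstar_seminorm GA p"
      then show "p (scale GA c a) \<le> cmod c * full_norm G a"
        using le[OF a p] a by (simp add: cstar_seminorm_def mult_left_mono)
    qed
    show "cmod c * full_norm G a \<le> full_norm G (scale GA c a)"
    proof (cases "c = 0")
      case True
      then show ?thesis using nonneg a by (simp add: GA.scale_closed del: GA.scale_zero_left)
    next
      case False
      have "full_norm G a \<le> full_norm G (scale GA c a) / cmod c"
      proof (rule full_norm_le)
        fix p assume p: "cstar_seminorm GA p"
        then have "cmod c * p a \<le> full_norm G (scale GA c a)"
          using le[OF GA.scale_closed[OF a] p, of c] a by (simp add: cstar_seminorm_def)
        then show "p a \<le> full_norm G (scale GA c a) / cmod c"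
          using False by (simp add: field_simps)
      qed
      then show ?thesis using False by (simp add: field_simps)
    qed
  qed
  show "full_norm G (mult GA (star GA a) a) = (full_norm G a)\<^sup>2"
  proof (rule antisym)
    show "full_norm G (mult GA (star GA a) a) \<le> (full_norm G a)\<^sup>2"
    proof (rule full_norm_le)
      fix p assume p: "cstar_seminorm GA p"
      then show "p (mult GA (star GA a) a) \<le> (full_norm G a)\<^sup>2"
        using le[OF a p] a by (simp add: cstar_seminorm_def power_mono)
    qed
    have "full_norm G a \<le> sqrt (full_norm G (mult GA (star GA a) a))"
    proof (rule full_norm_le)
      fix p assume p: "cstar_seminorm GA p"
      then have "(p a)\<^sup>2 \<le> full_norm G (mult GA (star GA a) a)"
        using le[OF _ p, of "mult GA (star GA a) a"] a by (simp add: cstar_seminorm_def)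
      then show "p a \<le> sqrt (full_norm G (mult GA (star GA a) a))" by (rule real_le_rsqrt)
    qed
    then have "(full_norm G a)\<^sup>2 \<le> (sqrt (full_norm G (mult GA (star GA a) a)))\<^sup>2"
      using nonneg[OF a] by (intro power_mono)
    then show "(full_norm G a)\<^sup>2 \<le> full_norm G (mult GA (star GA a) a)"
      using nonneg a by simp
  qed
  fix b assume b: "b \<in> carrier GA"
  show "full_norm G (add GA a b) \<le> full_norm G a + full_norm G b"
  proof (rule full_norm_le)
    fix p assume p: "cstar_seminorm GA p"
    then have "p (add GA a b) \<le> p a + p b" using a b by (simp add: cstar_seminorm_def)
    then show "p (add GA a b) \<le> full_norm G a + full_norm G b"
      using le[OF a p] le[OF b p] by linarith
  qed
  show "full_norm G (mult GA a b) \<le> full_norm G a * full_norm G b"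
  proof (rule full_norm_le)
    fix p assume p: "cstar_seminorm GA p"
    then have "p (mult GA a b) \<le> p a * p b" "0 \<le> p b" using a b by (auto simp: cstar_seminorm_def)
    then show "p (mult GA a b) \<le> full_norm G a * full_norm G b"
      using mult_mono[OF le[OF a p] le[OF b p] nonneg[OF a]] by linarith
  qed
qed

end

sublocale discrete_group \<subseteq> F: cstar_seminormed_algebra "group_algebra G" "full_norm G"
  by unfold_locales (rule cstar_seminorm_full_norm)

text \<open>Because \<open>\<tau>\<close> is dominated by \<open>full_norm\<close>, a Cauchy
  sequence for the latter is one for the former: the surjection keeps the sequence and only enlarges
  its class.\<close>

lemma (in discrete_group) canonical_surjection_cls:
  assumes "cstar_seminorm GA \<tau>" and s: "s \<in> carrier F.C"
  shows "s \<in> carrier (cauchy_algebra GA \<tau>)"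
    "canonical_surjection G \<tau> (F.cls s) = cstar_seminormed_algebra.cls GA \<tau> s"
proof -
  interpret T: cstar_seminormed_algebra GA \<tau>
    by unfold_locales (rule assms(1))
  note le = cstar_seminorm_le_full_norm[OF _ assms(1)]
  have cauchy: "t \<in> carrier T.C" if t: "t \<in> carrier F.C" for t
    unfolding T.cauchy_carrier_iff
    using t le[of "a_minus GA (t _) (t _)"] unfolding F.cauchy_carrier_iff
    by (meson GA.minus_closed le_less_trans)
  show sT: "s \<in> carrier T.C" by (rule cauchy[OF s])
  show "canonical_surjection G \<tau> (F.cls s) = T.cls s"
    unfolding canonical_surjection_def group_cstar_completion_def
  proof (rule continuous_extension_eqI[OF T.completion_dist_triangle T.completion_separating F.cls_self[OF s]])
    have closed: "to_completion GA \<tau> a \<in> carrier T.CP" if "a \<in> carrier GA" for a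
      using that by (simp add: T.to_completion_eq T.carrier_completion T.cauchy_const)
    show "T.cls s \<in> carrier T.CP" using sT by (simp add: T.carrier_completion)
    have dist: "nrm T.CP (a_minus T.CP (to_completion GA \<tau> a) (to_completion GA \<tau> b)) = \<tau> (a_minus GA a b)"
      if "a \<in> carrier GA" "b \<in> carrier GA" for a b
      using that by (simp add: T.to_completion_eq T.completion_minus T.cauchy_const T.completion_nrm)
    show "(\<lambda>n. nrm T.CP (a_minus T.CP (to_completion GA \<tau> (s n)) (T.cls s))) \<longlonglongrightarrow> 0"
      by (rule T.to_completion_tendsto[OF sT])
    fix t assume t: "t \<in> F.cls s"
    then have tc: "t \<in> carrier F.C" and null: "(\<lambda>n. full_norm G (a_minus GA (t n) (s n))) \<longlonglongrightarrow> 0"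
      using s by (auto simp: F.mem_cls_iff F.null_seqs_iff)
    show "to_completion GA \<tau> (t n) \<in> carrier T.CP" for n
      using closed F.cauchy_in_carrier[OF tc] by blast
    show "(\<lambda>n. nrm T.CP (a_minus T.CP (to_completion GA \<tau> (t n)) (to_completion GA \<tau> (s n)))) \<longlonglongrightarrow> 0"
      by (rule Lim_null_comparison[OF always_eventually null])
         (use F.cauchy_in_carrier[OF tc] F.cauchy_in_carrier[OF s] le in \<open>auto simp: dist\<close>)
  qed
qed

section \<open>Extensions of unitary representations\<close>

text \<open>Used along \<open>linear_extension\<close>, to compare a representation with the
  universal norm, and along the inclusion of a subgroup algebra, to restrict
  \<open>\<tau>\<close>.\<close>

lemma cstar_seminorm_pullback:
  assumes h: "h \<in> star_hom A B" and q: "cstar_seminorm B q" and A: "complex_star_algebra A"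
  shows "cstar_seminorm A (\<lambda>a. q (h a))"
proof -
  interpret A: complex_star_algebra A by (rule A)
  have "h a \<in> carrier B" if "a \<in> carrier A" for a
    using h that by (auto simp: star_hom_def ring_hom_def)
  then show ?thesis
    using h q unfolding cstar_seminorm_def star_hom_def ring_hom_def
    by (simp add: A.scale_closed)
qed

text \<open>Unitarity is encoded by \<open>rep_star\<close> together with \<open>rep_mult\<close>
  and \<open>rep_one\<close>. The instances are the permutation operators on \<open>ell2 X\<close>
  and the constant 1 in \<open>complex_algebra\<close>.\<close>

locale unitary_rep = discrete_group G + B: complex_star_algebra B
  for G :: "('g, 'm) monoid_scheme" (structure)
    and B :: "('b, 'n) normed_star_algebra_scheme" +
  fixes u :: "'g \<Rightarrow> 'b"
  assumes rep_closed: "g \<in> carrier G \<Longrightarrow> u g \<in> carrier B"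
    and rep_mult: "g \<in> carrier G \<Longrightarrow> h \<in> carrier G \<Longrightarrow> u (g \<otimes> h) = u g \<otimes>\<^bsub>B\<^esub> u h"
    and rep_one: "u \<one> = \<one>\<^bsub>B\<^esub>"
    and rep_star: "g \<in> carrier G \<Longrightarrow> star B (u g) = u (inv g)"
    and cstar: "cstar_norm B (nrm B)"
begin

abbreviation "L \<equiv> linear_extension B u"

lemma linear_extension_eq:
  assumes S: "finite S" "S \<subseteq> carrier G" "{g. a g \<noteq> 0} \<subseteq> S"
  shows "L a = (\<Oplus>\<^bsub>B\<^esub>g\<in>S. scale B (a g) (u g))"
  unfolding linear_extension_def
  by (rule B.add.finprod_mono_neutral_cong_left)
     (use S rep_closed in \<open>auto simp: subset_iff\<close>)

lemma linear_extension_closed: "a \<in> carrier GA \<Longrightarrow> L a \<in> carrier B"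
  unfolding linear_extension_def group_algebra_carrier_iff
  by (rule B.finsum_closed) (auto simp: rep_closed)

lemma linear_extension_add:
  assumes "a \<in> carrier GA" "b \<in> carrier GA"
  shows "L (add GA a b) = L a \<oplus>\<^bsub>B\<^esub> L b"
proof -
  let ?S = "{g. a g \<noteq> 0} \<union> {g. b g \<noteq> 0}"
  have S: "finite ?S" "?S \<subseteq> carrier G" using assms by (auto simp: group_algebra_carrier_iff)
  have "L (add GA a b) = (\<Oplus>\<^bsub>B\<^esub>g\<in>?S. scale B (a g) (u g) \<oplus>\<^bsub>B\<^esub> scale B (b g) (u g))"
    using S by (subst linear_extension_eq[OF S])
      (auto simp: group_algebra_simps subset_iff intro!: B.finsum_cong' B.add_scale rep_closed)
  also have "\<dots> = L a \<oplus>\<^bsub>B\<^esub> L b"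
    using S by (subst (1 2) linear_extension_eq[OF S])
      (auto simp: subset_iff intro!: B.finsum_addf rep_closed)
  finally show ?thesis .
qed

lemma linear_extension_single:
  "g \<in> carrier G \<Longrightarrow> L (scale GA c (delta g)) = scale B c (u g)"
  by (subst linear_extension_eq[of "{g}"])
     (auto simp: group_algebra_simps delta_def rep_closed)

lemma linear_extension_zero: "L (ring.zero GA) = \<zero>\<^bsub>B\<^esub>"
  by (simp add: linear_extension_def group_algebra_simps)

lemma linear_extension_delta: "g \<in> carrier G \<Longrightarrow> L (delta g) = u g"
  using linear_extension_single[of g 1] by (simp add: GA.scale_one B.scale_one rep_closed)

lemma linear_extension_scale: "a \<in> carrier GA \<Longrightarrow> L (scale GA c a) = scale B c (L a)"
proof (induction a rule: group_algebra_induct)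
  case zero
  then show ?case by (simp add: linear_extension_zero)
next
  case (add a d g)
  then show ?case
    by (simp add: GA.scale_add GA.scale_scale linear_extension_add linear_extension_single
        B.scale_add B.scale_scale rep_closed linear_extension_closed)
qed

lemma linear_extension_delta_mult:
  assumes g: "g \<in> carrier G"
  shows "b \<in> carrier GA \<Longrightarrow> L (mult GA (delta g) b) = u g \<otimes>\<^bsub>B\<^esub> L b"
proof (induction b rule: group_algebra_induct)
  case zero
  then show ?case using g by (simp add: linear_extension_zero rep_closed)
next
  case (add a d k)
  then show ?case using g
    by (simp add: GA.r_distr GA.scale_mult_right delta_mult_delta linear_extension_add
        linear_extension_single B.r_distr B.scale_mult_right rep_closed linear_extension_closed rep_mult)
qed

lemma linear_extension_mult:
  assumes b: "b \<in> carrier GA"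
  shows "a \<in> carrier GA \<Longrightarrow> L (mult GA a b) = L a \<otimes>\<^bsub>B\<^esub> L b"
proof (induction a rule: group_algebra_induct)
  case zero
  then show ?case using b by (simp add: linear_extension_zero linear_extension_closed)
next
  case (add a d k)
  then show ?case using b
    by (simp add: GA.l_distr GA.scale_mult_left linear_extension_delta_mult linear_extension_add
        linear_extension_scale linear_extension_delta B.l_distr B.scale_mult_left
        rep_closed linear_extension_closed)
qed

lemma linear_extension_star: "a \<in> carrier GA \<Longrightarrow> L (star GA a) = star B (L a)"
proof (induction a rule: group_algebra_induct)
  case zero
  have "star GA (ring.zero GA) = ring.zero GA" by (auto simp: group_algebra_simps)
  moreover have "star B \<zero>\<^bsub>B\<^esub> = \<zero>\<^bsub>B\<^esub>"
    using B.star_scale[of "\<zero>\<^bsub>B\<^esub>" 0] by simp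
  ultimately show ?case by (simp add: linear_extension_zero)
next
  case (add a d k)
  then show ?case
    by (simp add: GA.star_add GA.star_scale star_delta linear_extension_add linear_extension_single
        B.star_add B.star_scale rep_closed rep_star linear_extension_closed)
qed

lemma linear_extension_star_hom: "L \<in> star_hom GA B"
  unfolding star_hom_def ring_hom_def
  by (auto simp: linear_extension_closed linear_extension_mult linear_extension_add
      group_algebra_one_eq linear_extension_delta rep_one linear_extension_scale linear_extension_star)

sublocale B: cstar_seminormed_algebra B "nrm B"
  by unfold_locales (use cstar in \<open>simp add: cstar_norm_def\<close>)

text \<open>The norm pulled back along the representation is one of the C*-seminorms over which
  \<open>full_norm\<close> is the supremum.\<close>

lemma linear_extension_le_full_norm: "a \<in> carrier GA \<Longrightarrow> nrm B (L a) \<le> full_norm G a"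
  by (rule cstar_seminorm_le_full_norm)
     (auto intro: cstar_seminorm_pullback[OF linear_extension_star_hom B.seminorm star_algebra_group_algebra])

lemma linear_extension_diff:
  assumes "a \<in> carrier GA" "b \<in> carrier GA"
  shows "L (a_minus GA a b) = L a \<ominus>\<^bsub>B\<^esub> L b"
  unfolding a_minus_def using assms
  by (simp add: linear_extension_add GA.minus_eq_scale B.minus_eq_scale linear_extension_scale
      linear_extension_closed)

text \<open>The limit \<open>y\<close> is supplied by the caller: it is immediate for constant
  sequences, and for the trivial representation it comes from completeness of the complex
  numbers.\<close>

lemma associated_hom_cls:
  assumes s: "s \<in> carrier F.C" and y: "y \<in> carrier B"
    and lim: "(\<lambda>n. nrm B (L (s n) \<ominus>\<^bsub>B\<^esub> y)) \<longlonglongrightarrow> 0"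
  shows "associated_hom B u (F.cls s) = y"
  unfolding associated_hom_def
proof (rule continuous_extension_eqI[where s = s])
  show "s \<in> F.cls s" by (rule F.cls_self[OF s])
  show "(\<lambda>n. nrm B (L (s n) \<ominus>\<^bsub>B\<^esub> y)) \<longlonglongrightarrow> 0" "y \<in> carrier B" by (rule lim, rule y)
  show "nrm B (y \<ominus>\<^bsub>B\<^esub> z) \<le> nrm B (x \<ominus>\<^bsub>B\<^esub> y) + nrm B (x \<ominus>\<^bsub>B\<^esub> z)"
    if "x \<in> carrier B" "y \<in> carrier B" "z \<in> carrier B" for x y z
    using B.p_diff_triangle[of y x z] B.p_diff_commute[of y x] that by simp
  show "y = z" if "y \<in> carrier B" "z \<in> carrier B" "nrm B (y \<ominus>\<^bsub>B\<^esub> z) \<le> 0" for y z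
    using B.separating_if_cstar_norm[OF cstar] that by blast
  fix t assume "t \<in> F.cls s"
  then have tc: "t \<in> carrier F.C" and null: "(\<lambda>n. full_norm G (a_minus GA (t n) (s n))) \<longlonglongrightarrow> 0"
    using s by (auto simp: F.mem_cls_iff F.null_seqs_iff)
  show "L (t n) \<in> carrier B" for n
    by (rule linear_extension_closed[OF F.cauchy_in_carrier[OF tc]])
  have "norm (nrm B (L (t n) \<ominus>\<^bsub>B\<^esub> L (s n))) \<le> full_norm G (a_minus GA (t n) (s n))" for n
    using linear_extension_le_full_norm[of "a_minus GA (t n) (s n)"]
      F.cauchy_in_carrier[OF tc, of n] F.cauchy_in_carrier[OF s, of n]
    by (simp add: linear_extension_diff linear_extension_closed)
  then show "(\<lambda>n. nrm B (L (t n) \<ominus>\<^bsub>B\<^esub> L (s n))) \<longlonglongrightarrow> 0"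
    by (intro Lim_null_comparison[OF always_eventually null]) blast
qed

lemma associated_hom_const:
  "a \<in> carrier GA \<Longrightarrow> associated_hom B u (F.cls (\<lambda>n. a)) = L a"
  by (rule associated_hom_cls)
     (auto simp: F.cauchy_const linear_extension_closed a_minus_def B.r_neg)

end

lemma complex_algebra_simps [simp]:
  "carrier complex_algebra = UNIV" "mult complex_algebra = (*)" "add complex_algebra = (+)"
  "one complex_algebra = 1" "ring.zero complex_algebra = 0" "scale complex_algebra = (*)"
  "star complex_algebra = cnj" "nrm complex_algebra = cmod"
  by (simp_all add: complex_algebra_def)

lemma star_algebra_complex: "complex_star_algebra complex_algebra"
proof (intro complex_star_algebra.intro complex_star_algebra_axioms.intro ringI)
  show "abelian_group complex_algebra"
    by (rule abelian_groupI) (auto intro: exI[of _ "- _"])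
  show "Group.monoid complex_algebra" by (rule monoidI) auto
qed (auto simp: algebra_simps)

lemma cstar_norm_complex: "cstar_norm complex_algebra cmod"
  by (simp add: cstar_norm_def cstar_seminorm_def norm_mult norm_triangle_ineq power2_eq_square)

lemma complex_algebra_minus: "a_minus complex_algebra x y = x - y"
proof -
  interpret complex_star_algebra complex_algebra by (rule star_algebra_complex)
  show ?thesis using minus_eq_scale[of y] by (simp add: a_minus_def)
qed

lemma linear_extension_complex:
  assumes "finite {g. a g \<noteq> 0}"
  shows "linear_extension complex_algebra (\<lambda>g. 1) a = (\<Sum>g | a g \<noteq> 0. a g)"
proof -
  interpret complex_star_algebra complex_algebra by (rule star_algebra_complex)
  have "(\<Oplus>\<^bsub>complex_algebra\<^esub>g\<in>S. f g) = sum f S" if "finite S" for S and f :: "'a \<Rightarrow> complex"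
    using that by (induction S) auto
  then show ?thesis using assms by (simp add: linear_extension_def)
qed

sublocale discrete_group \<subseteq> triv: unitary_rep G complex_algebra "\<lambda>g. 1"
  by (intro unitary_rep.intro unitary_rep_axioms.intro discrete_group.intro star_algebra_complex group_axioms)
     (auto simp: cstar_norm_complex)

section \<open>The Hilbert space of square-summable functions\<close>

lemma ell2I:
  assumes "\<And>x. x \<notin> X \<Longrightarrow> f x = 0" "\<And>F. finite F \<Longrightarrow> F \<subseteq> X \<Longrightarrow> (\<Sum>x\<in>F. (cmod (f x))\<^sup>2) \<le> K"
  shows "f \<in> ell2 X"
proof -
  have "(\<lambda>x. (cmod (f x))\<^sup>2) summable_on X"
    by (rule nonneg_bdd_above_summable_on) (use assms(2) in \<open>auto intro!: bdd_aboveI\<close>)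
  then show ?thesis using assms(1) by (auto simp: ell2_def)
qed

lemma ell2_zero_outside: "f \<in> ell2 X \<Longrightarrow> x \<notin> X \<Longrightarrow> f x = 0"
  by (simp add: ell2_def)

lemma ell2_summable: "f \<in> ell2 X \<Longrightarrow> (\<lambda>x. (cmod (f x))\<^sup>2) summable_on X"
  by (simp add: ell2_def)

lemma ell2_norm_nonneg [simp]: "0 \<le> ell2_norm X f"
  by (simp add: ell2_norm_def infsum_nonneg)

lemma ell2_norm_square: "(ell2_norm X f)\<^sup>2 = (\<Sum>\<^sub>\<infinity>x\<in>X. (cmod (f x))\<^sup>2)"
  by (simp add: ell2_norm_def infsum_nonneg)

lemma ell2_norm_square_le:
  assumes "f \<in> ell2 X" "\<And>F. finite F \<Longrightarrow> F \<subseteq> X \<Longrightarrow> (\<Sum>x\<in>F. (cmod (f x))\<^sup>2) \<le> K"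
  shows "(ell2_norm X f)\<^sup>2 \<le> K"
  unfolding ell2_norm_square by (rule infsum_le_finite_sums) (use assms ell2_summable in auto)

lemma ell2_norm_le:
  assumes "f \<in> ell2 X" "0 \<le> K" "\<And>F. finite F \<Longrightarrow> F \<subseteq> X \<Longrightarrow> L2_set (\<lambda>x. cmod (f x)) F \<le> K"
  shows "ell2_norm X f \<le> K"
proof -
  have "(\<Sum>x\<in>F. (cmod (f x))\<^sup>2) \<le> K\<^sup>2" if "finite F" "F \<subseteq> X" for F
    using assms(3)[OF that] by (simp add: L2_set_def sqrt_le_D)
  from ell2_norm_square_le[OF assms(1) this] show ?thesis
    by (rule power2_le_imp_le[OF _ assms(2)])
qed

lemma ell2_sum_le: "f \<in> ell2 X \<Longrightarrow> finite F \<Longrightarrow> F \<subseteq> X \<Longrightarrow>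
    (\<Sum>x\<in>F. (cmod (f x))\<^sup>2) \<le> (ell2_norm X f)\<^sup>2"
  unfolding ell2_norm_square by (rule finite_sum_le_infsum) (auto simp: ell2_summable)

lemma ell2_L2_set_le: "f \<in> ell2 X \<Longrightarrow> finite F \<Longrightarrow> F \<subseteq> X \<Longrightarrow>
    L2_set (\<lambda>x. cmod (f x)) F \<le> ell2_norm X f"
  unfolding L2_set_def using ell2_sum_le[of f X F] real_sqrt_le_mono by fastforce

lemma ell2_add_L2_set_le:
  assumes "f \<in> ell2 X" "g \<in> ell2 X" "finite F" "F \<subseteq> X"
  shows "L2_set (\<lambda>x. cmod (f x + g x)) F \<le> ell2_norm X f + ell2_norm X g"
proof -
  have "L2_set (\<lambda>x. cmod (f x + g x)) F \<le> L2_set (\<lambda>x. cmod (f x) + cmod (g x)) F"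
    by (intro L2_set_mono) (auto simp: norm_triangle_ineq)
  also have "\<dots> \<le> L2_set (\<lambda>x. cmod (f x)) F + L2_set (\<lambda>x. cmod (g x)) F"
    by (rule L2_set_triangle_ineq)
  also have "\<dots> \<le> ell2_norm X f + ell2_norm X g"
    using assms by (intro add_mono ell2_L2_set_le)
  finally show ?thesis .
qed

lemma ell2_add [simp]:
  assumes "f \<in> ell2 X" "g \<in> ell2 X" shows "(\<lambda>x. f x + g x) \<in> ell2 X"
proof (rule ell2I)
  fix F assume "finite F" "F \<subseteq> X"
  from ell2_add_L2_set_le[OF assms this]
  show "(\<Sum>x\<in>F. (cmod (f x + g x))\<^sup>2) \<le> (ell2_norm X f + ell2_norm X g)\<^sup>2"
    unfolding L2_set_def by (rule sqrt_le_D)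
qed (use assms in \<open>auto simp: ell2_zero_outside\<close>)

lemma ell2_norm_triangle:
  "f \<in> ell2 X \<Longrightarrow> g \<in> ell2 X \<Longrightarrow> ell2_norm X (\<lambda>x. f x + g x) \<le> ell2_norm X f + ell2_norm X g"
  by (intro ell2_norm_le ell2_add ell2_add_L2_set_le) auto

lemma ell2_scale [simp]: "f \<in> ell2 X \<Longrightarrow> (\<lambda>x. c * f x) \<in> ell2 X"
  unfolding ell2_def by (auto simp: norm_mult power_mult_distrib intro: summable_on_cmult_right)

lemma ell2_norm_scale: "ell2_norm X (\<lambda>x. c * f x) = cmod c * ell2_norm X f"
  by (simp add: ell2_norm_def norm_mult power_mult_distrib infsum_cmult_right' real_sqrt_mult)

lemma ell2_zero [simp]: "(\<lambda>x. 0) \<in> ell2 X"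
  by (simp add: ell2_def)

lemma ell2_norm_zero [simp]: "ell2_norm X (\<lambda>x. 0) = 0"
  by (simp add: ell2_norm_def)

lemma ell2_uminus [simp]: "f \<in> ell2 X \<Longrightarrow> (\<lambda>x. - f x) \<in> ell2 X"
  using ell2_scale[of f X "-1"] by simp

lemma ell2_diff [simp]: "f \<in> ell2 X \<Longrightarrow> g \<in> ell2 X \<Longrightarrow> (\<lambda>x. f x - g x) \<in> ell2 X"
  using ell2_add[of f X "\<lambda>x. - g x"] by simp

lemma ell2_sum [simp]: "(\<And>i. i \<in> I \<Longrightarrow> f i \<in> ell2 X) \<Longrightarrow> (\<lambda>x. \<Sum>i\<in>I. f i x) \<in> ell2 X"
  by (induction I rule: infinite_finite_induct) auto

lemma ell2_norm_diff_commute: "ell2_norm X (\<lambda>x. f x - g x) = ell2_norm X (\<lambda>x. g x - f x)"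
  by (simp add: ell2_norm_def norm_minus_commute)

lemma ell2_norm_eq_0:
  assumes "f \<in> ell2 X" "ell2_norm X f \<le> 0" shows "f = (\<lambda>x. 0)"
proof
  fix x show "f x = 0"
  proof (cases "x \<in> X")
    case True
    then have "(\<Sum>x\<in>{x}. (cmod (f x))\<^sup>2) \<le> (ell2_norm X f)\<^sup>2"
      using assms by (intro ell2_sum_le) auto
    then show ?thesis using assms(2) ell2_norm_nonneg[of X f] by simp
  qed (use assms(1) in \<open>simp add: ell2_zero_outside\<close>)
qed

section \<open>The inner product and the Cauchy-Schwarz inequality\<close>

lemma ell2_mult_abs_summable:
  assumes "f \<in> ell2 X" "g \<in> ell2 X"
  shows "(\<lambda>x. cmod (f x * cnj (g x))) summable_on X" (is ?A)
    and "(\<Sum>\<^sub>\<infinity>x\<in>X. cmod (f x * cnj (g x))) \<le> ell2_norm X f * ell2_norm X g"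
proof -
  have le: "(\<Sum>x\<in>F. cmod (f x * cnj (g x))) \<le> ell2_norm X f * ell2_norm X g"
    if "finite F" "F \<subseteq> X" for F
  proof -
    have "(\<Sum>x\<in>F. cmod (f x * cnj (g x))) = (\<Sum>x\<in>F. \<bar>cmod (f x)\<bar> * \<bar>cmod (g x)\<bar>)"
      by (simp add: norm_mult)
    also have "\<dots> \<le> L2_set (\<lambda>x. cmod (f x)) F * L2_set (\<lambda>x. cmod (g x)) F"
      by (rule L2_set_mult_ineq)
    also have "\<dots> \<le> ell2_norm X f * ell2_norm X g"
      using assms that by (intro mult_mono ell2_L2_set_le) auto
    finally show ?thesis .
  qed
  show ?A by (rule nonneg_bdd_above_summable_on) (use le in \<open>auto intro!: bdd_aboveI\<close>)
  then show "(\<Sum>\<^sub>\<infinity>x\<in>X. cmod (f x * cnj (g x))) \<le> ell2_norm X f * ell2_norm X g"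
    by (rule infsum_le_finite_sums) (rule le)
qed

lemma ell2_mult_summable: "f \<in> ell2 X \<Longrightarrow> g \<in> ell2 X \<Longrightarrow> (\<lambda>x. f x * cnj (g x)) summable_on X"
  by (rule abs_summable_summable[OF ell2_mult_abs_summable(1)])

lemma ell2_Cauchy_Schwarz:
  "f \<in> ell2 X \<Longrightarrow> g \<in> ell2 X \<Longrightarrow> cmod (ell2_inner X f g) \<le> ell2_norm X f * ell2_norm X g"
  unfolding ell2_inner_def
  using norm_infsum_bound[OF ell2_mult_abs_summable(1)[of f X g]] ell2_mult_abs_summable(2)[of f X g]
  by linarith

lemma ell2_inner_add_left: "f \<in> ell2 X \<Longrightarrow> f' \<in> ell2 X \<Longrightarrow> g \<in> ell2 X \<Longrightarrow>
    ell2_inner X (\<lambda>x. f x + f' x) g = ell2_inner X f g + ell2_inner X f' g"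
  unfolding ell2_inner_def by (simp add: distrib_right infsum_add ell2_mult_summable)

lemma ell2_inner_scale_left: "ell2_inner X (\<lambda>x. c * f x) g = c * ell2_inner X f g"
  unfolding ell2_inner_def by (simp add: mult.assoc infsum_cmult_right')

lemma ell2_inner_commute: "ell2_inner X f g = cnj (ell2_inner X g f)"
  unfolding ell2_inner_def by (simp add: mult.commute flip: infsum_cnj)

lemma ell2_inner_add_right: "f \<in> ell2 X \<Longrightarrow> f' \<in> ell2 X \<Longrightarrow> g \<in> ell2 X \<Longrightarrow>
    ell2_inner X g (\<lambda>x. f x + f' x) = ell2_inner X g f + ell2_inner X g f'"
  by (subst (1 2 3) ell2_inner_commute) (simp add: ell2_inner_add_left)

lemma ell2_inner_scale_right: "ell2_inner X g (\<lambda>x. c * f x) = cnj c * ell2_inner X g f"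
  by (subst (1 2) ell2_inner_commute) (simp add: ell2_inner_scale_left)

lemma ell2_inner_diff_left: "f \<in> ell2 X \<Longrightarrow> f' \<in> ell2 X \<Longrightarrow> g \<in> ell2 X \<Longrightarrow>
    ell2_inner X (\<lambda>x. f x - f' x) g = ell2_inner X f g - ell2_inner X f' g"
  using ell2_inner_add_left[of f X "\<lambda>x. (-1) * f' x" g] by (simp add: ell2_inner_scale_left del: mult_minus1)
    (simp add: ell2_inner_scale_left[of X "-1", simplified])

lemma ell2_inner_diff_right: "f \<in> ell2 X \<Longrightarrow> f' \<in> ell2 X \<Longrightarrow> g \<in> ell2 X \<Longrightarrow>
    ell2_inner X g (\<lambda>x. f x - f' x) = ell2_inner X g f - ell2_inner X g f'"
  by (subst (1 2 3) ell2_inner_commute) (simp add: ell2_inner_diff_left)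

lemma ell2_inner_sum_left: "(\<And>i. i \<in> I \<Longrightarrow> f i \<in> ell2 X) \<Longrightarrow> g \<in> ell2 X \<Longrightarrow>
    ell2_inner X (\<lambda>x. \<Sum>i\<in>I. f i x) g = (\<Sum>i\<in>I. ell2_inner X (f i) g)"
proof (induction I rule: infinite_finite_induct)
  case (insert i I)
  then show ?case by (simp add: ell2_inner_add_left)
qed (simp_all add: ell2_inner_def)

lemma ell2_inner_self: "f \<in> ell2 X \<Longrightarrow> ell2_inner X f f = of_real ((ell2_norm X f)\<^sup>2)"
proof -
  assume "f \<in> ell2 X"
  from ell2_summable[OF this] have "((\<lambda>x. of_real ((cmod (f x))\<^sup>2) :: complex) has_sum of_real ((ell2_norm X f)\<^sup>2)) X"
    unfolding ell2_norm_square by (intro has_sum_of_real has_sum_infsum)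
  then show ?thesis unfolding ell2_inner_def using infsumI by (simp only: complex_norm_square) blast
qed

lemma ell2_ext_inner:
  assumes "f \<in> ell2 X" "g \<in> ell2 X" "\<And>h. h \<in> ell2 X \<Longrightarrow> ell2_inner X h f = ell2_inner X h g"
  shows "f = g"
proof -
  let ?d = "\<lambda>x. f x - g x"
  have "ell2_inner X ?d ?d = 0"
    using assms by (subst ell2_inner_diff_right) auto
  then have "ell2_norm X ?d \<le> 0" using assms by (simp add: ell2_inner_self)
  then have "?d = (\<lambda>x. 0)" using assms by (intro ell2_norm_eq_0) auto
  then show ?thesis by (auto simp: fun_eq_iff)
qed

lemma ell2_finite_support:
  assumes "finite F" "F \<subseteq> X" "\<And>x. x \<notin> F \<Longrightarrow> f x = 0"
  shows "f \<in> ell2 X" and "(ell2_norm X f)\<^sup>2 = (\<Sum>x\<in>F. (cmod (f x))\<^sup>2)"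
proof -
  have "((\<lambda>x. (cmod (f x))\<^sup>2) has_sum (\<Sum>x\<in>F. (cmod (f x))\<^sup>2)) X"
    using assms by (intro has_sum_finite_neutralI[where B = F]) auto
  then show "f \<in> ell2 X" "(ell2_norm X f)\<^sup>2 = (\<Sum>x\<in>F. (cmod (f x))\<^sup>2)"
    using assms(2,3) by (auto simp: ell2_def ell2_norm_square summable_on_def infsumI)
qed

lemma delta_ell2 [simp]: "x \<in> X \<Longrightarrow> delta x \<in> ell2 X"
  by (rule ell2_finite_support[of "{x}"]) (auto simp: delta_def)

lemma ell2_restrict:
  assumes "f \<in> ell2 X"
  shows "(\<lambda>x. if x \<in> Y then f x else 0) \<in> ell2 X"
    and "ell2_norm X (\<lambda>x. if x \<in> Y then f x else 0) \<le> ell2_norm X f"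
proof -
  let ?g = "\<lambda>x. if x \<in> Y then f x else 0"
  have le: "(\<Sum>x\<in>F. (cmod (?g x))\<^sup>2) \<le> (ell2_norm X f)\<^sup>2" if "finite F" "F \<subseteq> X" for F
    by (rule order.trans[OF sum_mono ell2_sum_le[OF assms that]]) auto
  show "?g \<in> ell2 X" by (rule ell2I[OF _ le]) (use assms ell2_zero_outside in auto)
  then show "ell2_norm X ?g \<le> ell2_norm X f"
    using ell2_norm_square_le[OF _ le] power2_le_imp_le ell2_norm_nonneg by blast
qed

text \<open>One \<open>F\<close> works for every larger \<open>Y\<close>, so the tails of finitely
  many vectors can be cut off simultaneously by a union.\<close>

lemma ell2_tail:
  assumes f: "f \<in> ell2 X" and e: "e > 0"
  obtains F where "finite F" "F \<subseteq> X"
    "\<And>Y. F \<subseteq> Y \<Longrightarrow> ell2_norm X (\<lambda>x. if x \<in> Y then 0 else f x) \<le> e"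
proof -
  obtain F where F: "finite F" "F \<subseteq> X"
    "dist (\<Sum>x\<in>F. (cmod (f x))\<^sup>2) (\<Sum>\<^sub>\<infinity>x\<in>X. (cmod (f x))\<^sup>2) \<le> e\<^sup>2"
    using infsum_finite_approximation[OF ell2_summable[OF f], of "e\<^sup>2"] e by auto
  have "ell2_norm X (\<lambda>x. if x \<in> Y then 0 else f x) \<le> e" if "F \<subseteq> Y" for Y
  proof -
    let ?g = "\<lambda>x. if x \<in> Y then 0 else f x"
    have g: "?g \<in> ell2 X"
    proof -
      have "?g = (\<lambda>x. if x \<in> - Y then f x else 0)" by auto
      then show ?thesis using ell2_restrict(1)[OF f, of "- Y"] by simp
    qed
    have "(\<Sum>x\<in>D. (cmod (?g x))\<^sup>2) \<le> e\<^sup>2" if D: "finite D" "D \<subseteq> X" for D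
    proof -
      have "(\<Sum>x\<in>D. (cmod (?g x))\<^sup>2) \<le> (\<Sum>x\<in>D - F. (cmod (f x))\<^sup>2)"
      proof -
        have "(\<Sum>x\<in>D. (cmod (?g x))\<^sup>2) = (\<Sum>x\<in>D - F. (cmod (?g x))\<^sup>2)"
          using D \<open>F \<subseteq> Y\<close> by (intro sum.mono_neutral_right) auto
        also have "\<dots> \<le> (\<Sum>x\<in>D - F. (cmod (f x))\<^sup>2)" by (rule sum_mono) auto
        finally show ?thesis .
      qed
      moreover have "(\<Sum>x\<in>D - F. (cmod (f x))\<^sup>2) + (\<Sum>x\<in>F. (cmod (f x))\<^sup>2)
          = (\<Sum>x\<in>D \<union> F. (cmod (f x))\<^sup>2)"
        using D F(1) by (subst sum.union_disjoint[symmetric]) (auto simp: Un_commute)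
      moreover have "(\<Sum>x\<in>D \<union> F. (cmod (f x))\<^sup>2) \<le> (\<Sum>\<^sub>\<infinity>x\<in>X. (cmod (f x))\<^sup>2)"
        using D F ell2_sum_le[OF f, of "D \<union> F"] by (simp add: ell2_norm_square)
      ultimately show ?thesis using F(3) by (simp add: dist_real_def)
    qed
    then show ?thesis by (intro power2_le_imp_le[OF ell2_norm_square_le[OF g] less_imp_le[OF e]])
  qed
  then show ?thesis using that F by blast
qed

section \<open>The algebra of bounded operators\<close>

lemma nonpos_if_le_mult_pos:
  fixes c M :: real
  assumes "\<And>e. e > 0 \<Longrightarrow> c \<le> M * e" shows "c \<le> 0"
proof (rule LIMSEQ_le_const)
  show "(\<lambda>n. M * inverse (real (Suc n))) \<longlonglongrightarrow> 0"
    using tendsto_mult_right_zero[OF LIMSEQ_inverse_real_of_nat] .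
qed (use assms in auto)

lemma le_if_square_le_mult:
  fixes x K :: real
  assumes "0 \<le> x" "0 \<le> K" "x * x \<le> K * x" shows "x \<le> K"
  using assms by (cases "x = 0") (auto simp: order_less_le)

abbreviation "OA \<equiv> operator_algebra"

text \<open>Operators are extensional functions, \<open>undefined\<close> off \<open>ell2 X\<close>,
  so agreement on \<open>ell2 X\<close> is equality.\<close>

lemma bounded_operators_ext:
  assumes "S \<in> bounded_operators X" "T \<in> bounded_operators X" "\<And>f. f \<in> ell2 X \<Longrightarrow> S f = T f"
  shows "S = T"
proof (rule PiE_ext)
  show "S \<in> ell2 X \<rightarrow>\<^sub>E ell2 X" "T \<in> ell2 X \<rightarrow>\<^sub>E ell2 X"
    using assms(1,2) unfolding bounded_operators_def by blast+
qed (rule assms(3))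

lemma bounded_operator_closed: "T \<in> bounded_operators X \<Longrightarrow> f \<in> ell2 X \<Longrightarrow> T f \<in> ell2 X"
  by (auto simp: bounded_operators_def)

lemma bounded_operator_add: "T \<in> bounded_operators X \<Longrightarrow> f \<in> ell2 X \<Longrightarrow> g \<in> ell2 X \<Longrightarrow>
    T (\<lambda>x. f x + g x) = (\<lambda>x. T f x + T g x)"
  by (auto simp: bounded_operators_def)

lemma bounded_operator_scale: "T \<in> bounded_operators X \<Longrightarrow> f \<in> ell2 X \<Longrightarrow>
    T (\<lambda>x. c * f x) = (\<lambda>x. c * T f x)"
  by (auto simp: bounded_operators_def)

lemma bounded_operator_zero: "T \<in> bounded_operators X \<Longrightarrow> T (\<lambda>x. 0) = (\<lambda>x. 0)"
  using bounded_operator_scale[of T X "\<lambda>x. 0" 0] by simp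

lemma bounded_operator_diff: "T \<in> bounded_operators X \<Longrightarrow> f \<in> ell2 X \<Longrightarrow> g \<in> ell2 X \<Longrightarrow>
    T (\<lambda>x. f x - g x) = (\<lambda>x. T f x - T g x)"
  using bounded_operator_add[of T X f "\<lambda>x. (-1) * g x"] bounded_operator_scale[of T X g "-1"]
  by simp

lemma bounded_operator_sum:
  assumes T: "T \<in> bounded_operators X"
  shows "(\<And>i. i \<in> I \<Longrightarrow> f i \<in> ell2 X) \<Longrightarrow> T (\<lambda>x. \<Sum>i\<in>I. f i x) = (\<lambda>x. \<Sum>i\<in>I. T (f i) x)"
proof (induction I rule: infinite_finite_induct)
  case (insert i I)
  then show ?case by (simp add: bounded_operator_add[OF T])
qed (simp_all add: bounded_operator_zero[OF T])

lemma bounded_operator_bound: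
  assumes "T \<in> bounded_operators X"
  obtains K where "0 \<le> K" "\<And>f. f \<in> ell2 X \<Longrightarrow> ell2_norm X (T f) \<le> K * ell2_norm X f"
proof -
  obtain K where K: "\<And>f. f \<in> ell2 X \<Longrightarrow> ell2_norm X (T f) \<le> K * ell2_norm X f"
    using assms unfolding bounded_operators_def by blast
  have "ell2_norm X (T f) \<le> max 0 K * ell2_norm X f" if "f \<in> ell2 X" for f
    using K[OF that] mult_right_mono[of K "max 0 K" "ell2_norm X f"] by fastforce
  then show ?thesis by (intro that[of "max 0 K"]) auto
qed

lemma restrict_bounded_operator:
  assumes "\<And>f. f \<in> ell2 X \<Longrightarrow> T f \<in> ell2 X"
    and "\<And>f g. f \<in> ell2 X \<Longrightarrow> g \<in> ell2 X \<Longrightarrow> T (\<lambda>x. f x + g x) = (\<lambda>x. T f x + T g x)"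
    and "\<And>c f. f \<in> ell2 X \<Longrightarrow> T (\<lambda>x. c * f x) = (\<lambda>x. c * T f x)"
    and "\<And>f. f \<in> ell2 X \<Longrightarrow> ell2_norm X (T f) \<le> K * ell2_norm X f"
  shows "restrict T (ell2 X) \<in> bounded_operators X"
proof -
  have "\<exists>C. \<forall>f\<in>ell2 X. ell2_norm X (T f) \<le> C * ell2_norm X f" using assms(4) by blast
  then show ?thesis unfolding bounded_operators_def using assms(1-3) by auto
qed

lemma operator_algebra_simps:
  "carrier (OA X) = bounded_operators X"
  "f \<in> ell2 X \<Longrightarrow> mult (OA X) S T f = S (T f)"
  "f \<in> ell2 X \<Longrightarrow> one (OA X) f = f"
  "f \<in> ell2 X \<Longrightarrow> ring.zero (OA X) f = (\<lambda>x. 0)"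
  "f \<in> ell2 X \<Longrightarrow> add (OA X) S T f = (\<lambda>x. S f x + T f x)"
  "f \<in> ell2 X \<Longrightarrow> scale (OA X) c T f = (\<lambda>x. c * T f x)"
  "star (OA X) = adjoint_operator X"
  by (simp_all add: operator_algebra_def compose_def)

lemma operator_mult_closed:
  assumes S: "S \<in> bounded_operators X" and T: "T \<in> bounded_operators X"
  shows "mult (OA X) S T \<in> bounded_operators X"
proof -
  obtain K where K: "0 \<le> K" "\<And>f. f \<in> ell2 X \<Longrightarrow> ell2_norm X (S f) \<le> K * ell2_norm X f"
    using bounded_operator_bound[OF S] by blast
  obtain L where L: "0 \<le> L" "\<And>f. f \<in> ell2 X \<Longrightarrow> ell2_norm X (T f) \<le> L * ell2_norm X f"
    using bounded_operator_bound[OF T] by blast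
  have "ell2_norm X (S (T f)) \<le> (K * L) * ell2_norm X f" if "f \<in> ell2 X" for f
    using K(2)[OF bounded_operator_closed[OF T that]] mult_left_mono[OF L(2)[OF that] K(1)]
    by (simp add: mult.assoc)
  then have "restrict (\<lambda>f. S (T f)) (ell2 X) \<in> bounded_operators X"
    using S T by (intro restrict_bounded_operator)
      (auto simp: bounded_operator_closed bounded_operator_add bounded_operator_scale)
  then show ?thesis by (simp add: operator_algebra_def compose_def)
qed

lemma operator_add_closed:
  assumes S: "S \<in> bounded_operators X" and T: "T \<in> bounded_operators X"
  shows "add (OA X) S T \<in> bounded_operators X"
proof -
  obtain K where K: "0 \<le> K" "\<And>f. f \<in> ell2 X \<Longrightarrow> ell2_norm X (S f) \<le> K * ell2_norm X f"
    using bounded_operator_bound[OF S] by blast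
  obtain L where L: "0 \<le> L" "\<And>f. f \<in> ell2 X \<Longrightarrow> ell2_norm X (T f) \<le> L * ell2_norm X f"
    using bounded_operator_bound[OF T] by blast
  have "ell2_norm X (\<lambda>x. S f x + T f x) \<le> (K + L) * ell2_norm X f" if "f \<in> ell2 X" for f
    using ell2_norm_triangle[OF bounded_operator_closed[OF S that] bounded_operator_closed[OF T that]]
      K(2)[OF that] L(2)[OF that] by (simp add: distrib_right)
  then have "restrict (\<lambda>f x. S f x + T f x) (ell2 X) \<in> bounded_operators X"
    using S T by (intro restrict_bounded_operator)
      (auto simp: bounded_operator_closed bounded_operator_add bounded_operator_scale distrib_left add_ac)
  then show ?thesis by (simp add: operator_algebra_def)
qed

lemma operator_scale_closed:
  assumes T: "T \<in> bounded_operators X"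
  shows "scale (OA X) c T \<in> bounded_operators X"
proof -
  obtain L where L: "0 \<le> L" "\<And>f. f \<in> ell2 X \<Longrightarrow> ell2_norm X (T f) \<le> L * ell2_norm X f"
    using bounded_operator_bound[OF T] by blast
  have "ell2_norm X (\<lambda>x. c * T f x) \<le> (cmod c * L) * ell2_norm X f" if "f \<in> ell2 X" for f
    using mult_left_mono[OF L(2)[OF that], of "cmod c"] by (simp add: ell2_norm_scale mult.assoc)
  then have "restrict (\<lambda>f x. c * T f x) (ell2 X) \<in> bounded_operators X"
    using T by (intro restrict_bounded_operator)
      (auto simp: bounded_operator_closed bounded_operator_add bounded_operator_scale distrib_left mult.left_commute)
  then show ?thesis by (simp add: operator_algebra_def)
qed

lemma operator_one_closed: "one (OA X) \<in> bounded_operators X"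
  unfolding operator_algebra_def ring_record_simps
  by (rule restrict_bounded_operator[where K = 1]) simp_all

lemma operator_zero_closed: "ring.zero (OA X) \<in> bounded_operators X"
  unfolding operator_algebra_def ring_record_simps
  by (rule restrict_bounded_operator[where K = 0]) simp_all

text \<open>The adjoint is given by its matrix coefficients, \<open>(T* g) x = \<langle>g, T \<delta>\<^sub>x\<rangle>\<close>.\<close>

lemma adjoint_exists:
  assumes T: "T \<in> bounded_operators X"
  obtains S where "S \<in> bounded_operators X"
    "\<And>f g. f \<in> ell2 X \<Longrightarrow> g \<in> ell2 X \<Longrightarrow> ell2_inner X (T f) g = ell2_inner X f (S g)"
proof -
  obtain K where K: "0 \<le> K" "\<And>f. f \<in> ell2 X \<Longrightarrow> ell2_norm X (T f) \<le> K * ell2_norm X f"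
    using bounded_operator_bound[OF T] by blast
  define S where "S = (\<lambda>g x. if x \<in> X then ell2_inner X g (T (delta x)) else 0)"
  note Tc = bounded_operator_closed[OF T]
  have fin: "T (\<lambda>x. if x \<in> F then h x else 0) = (\<lambda>y. \<Sum>x\<in>F. h x * T (delta x) y)"
    if "finite F" "F \<subseteq> X" for F h
  proof -
    have "(\<lambda>x. if x \<in> F then h x else 0) = (\<lambda>y. \<Sum>x\<in>F. h x * delta x y)"
      using that by (auto simp: delta_def fun_eq_iff if_distrib cong: if_cong)
    moreover have "T (\<lambda>y. \<Sum>x\<in>F. h x * delta x y) = (\<lambda>y. \<Sum>x\<in>F. T (\<lambda>y. h x * delta x y) y)"
      using that by (intro bounded_operator_sum[OF T]) auto
    moreover have "(\<Sum>x\<in>F. T (\<lambda>y. h x * delta x y) y) = (\<Sum>x\<in>F. h x * T (delta x) y)" for y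
      using that by (intro sum.cong) (auto simp: bounded_operator_scale[OF T] subset_iff)
    ultimately show ?thesis by simp
  qed
  have inner_fin: "ell2_inner X (T (\<lambda>x. if x \<in> F then h x else 0)) g = (\<Sum>x\<in>F. h x * cnj (S g x))"
    if "finite F" "F \<subseteq> X" "g \<in> ell2 X" for F h g
  proof -
    have "ell2_inner X (T (\<lambda>x. if x \<in> F then h x else 0)) g
        = (\<Sum>x\<in>F. ell2_inner X (\<lambda>y. h x * T (delta x) y) g)"
      unfolding fin[OF that(1,2)] using that by (intro ell2_inner_sum_left) (auto simp: Tc subset_iff)
    also have "\<dots> = (\<Sum>x\<in>F. h x * cnj (S g x))"
      using that ell2_inner_commute[of X "T _" g]
      by (intro sum.cong) (auto simp: ell2_inner_scale_left S_def subset_iff)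
    finally show ?thesis .
  qed
  \<comment> \<open>Testing \<open>T\<close> on the truncation \<open>f\<close> of
    \<open>S g\<close> to \<open>F\<close> gives
    \<open>||f||^2 = <T f, g> \<le> K ||f|| ||g||\<close>; cancelling \<open>||f||\<close> bounds
    all finite sums uniformly.\<close>
  have S_bound: "(\<Sum>x\<in>F. (cmod (S g x))\<^sup>2) \<le> (K * ell2_norm X g)\<^sup>2"
    if g: "g \<in> ell2 X" and F: "finite F" "F \<subseteq> X" for g F
  proof -
    define f where "f = (\<lambda>x. if x \<in> F then S g x else 0)"
    have f: "f \<in> ell2 X" "(ell2_norm X f)\<^sup>2 = (\<Sum>x\<in>F. (cmod (S g x))\<^sup>2)"
      using ell2_finite_support[of F X f] F by (auto simp: f_def)
    have "ell2_inner X (T f) g = (\<Sum>x\<in>F. S g x * cnj (S g x))"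
      unfolding f_def by (rule inner_fin[OF F g])
    also have "\<dots> = of_real ((ell2_norm X f)\<^sup>2)"
      unfolding f(2) by (simp add: complex_norm_square del: of_real_power)
    finally have "ell2_inner X (T f) g = of_real ((ell2_norm X f)\<^sup>2)" .
    then have "(ell2_norm X f)\<^sup>2 \<le> ell2_norm X (T f) * ell2_norm X g"
      using ell2_Cauchy_Schwarz[OF Tc[OF f(1)] g] by (simp add: norm_of_real del: of_real_power)
    also have "\<dots> \<le> (K * ell2_norm X f) * ell2_norm X g"
      using K(2)[OF f(1)] by (intro mult_right_mono) auto
    finally have le: "ell2_norm X f * ell2_norm X f \<le> (K * ell2_norm X g) * ell2_norm X f"
      by (simp add: power2_eq_square mult_ac)
    have "ell2_norm X f \<le> K * ell2_norm X g"
      by (rule le_if_square_le_mult[OF _ _ le]) (simp_all add: K)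
    then have "(ell2_norm X f)\<^sup>2 \<le> (K * ell2_norm X g)\<^sup>2" by (intro power_mono) auto
    then show ?thesis by (simp add: f(2))
  qed
  have Sc: "S g \<in> ell2 X" if "g \<in> ell2 X" for g
    by (rule ell2I[OF _ S_bound[OF that]]) (auto simp: S_def)
  have "restrict S (ell2 X) \<in> bounded_operators X"
  proof (rule restrict_bounded_operator[where K = K])
    show "S (\<lambda>x. f x + g x) = (\<lambda>x. S f x + S g x)" if "f \<in> ell2 X" "g \<in> ell2 X" for f g
      using that by (auto simp: S_def ell2_inner_add_left Tc)
    show "ell2_norm X (S g) \<le> K * ell2_norm X g" if "g \<in> ell2 X" for g
      by (rule power2_le_imp_le[OF ell2_norm_square_le[OF Sc[OF that] S_bound[OF that]]])
         (simp_all add: K)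
  qed (auto simp: Sc, auto simp: S_def ell2_inner_scale_left)
  \<comment> \<open>For finitely supported functions the identity holds by construction. A general
    \<open>f\<close> is split into a truncation \<open>a\<close> and a tail \<open>r\<close> of norm
    at most \<open>e\<close>, and Cauchy-Schwarz bounds the defect of \<open>r\<close> by
    \<open>?M * e\<close>.\<close>
  moreover have "ell2_inner X (T f) g = ell2_inner X f (restrict S (ell2 X) g)"
    if f: "f \<in> ell2 X" and g: "g \<in> ell2 X" for f g
  proof -
    let ?d = "\<lambda>f. ell2_inner X (T f) g - ell2_inner X f (S g)"
    let ?M = "K * ell2_norm X g + ell2_norm X (S g)"
    have "cmod (?d f) \<le> ?M * e" if e: "e > 0" for e
    proof -
      obtain F where F: "finite F" "F \<subseteq> X"
        "\<And>Y. F \<subseteq> Y \<Longrightarrow> ell2_norm X (\<lambda>x. if x \<in> Y then 0 else f x) \<le> e"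
        using ell2_tail[OF f e] by blast
      define a where "a = (\<lambda>x. if x \<in> F then f x else 0)"
      define r where "r = (\<lambda>x. f x - a x)"
      have a: "a \<in> ell2 X" unfolding a_def by (rule ell2_restrict(1)[OF f])
      have r: "r \<in> ell2 X" unfolding r_def using f a by simp
      have "r = (\<lambda>x. if x \<in> F then 0 else f x)" by (auto simp: r_def a_def)
      then have nr: "ell2_norm X r \<le> e" using F(3)[of F] by simp
      have "ell2_inner X a (S g) = (\<Sum>x\<in>F. f x * cnj (S g x))"
        unfolding ell2_inner_def a_def using F
        by (subst infsum_cong_neutral[where T = F and g = "\<lambda>x. f x * cnj (S g x)"]) auto
      then have "?d a = 0" unfolding a_def using inner_fin[OF F(1,2) g] by simp
      moreover have "?d r = ?d f - ?d a"
        unfolding r_def using f a g Tc Sc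
        by (simp add: bounded_operator_diff[OF T] ell2_inner_diff_left)
      ultimately have "?d f = ?d r" by simp
      also have "cmod \<dots> \<le> cmod (ell2_inner X (T r) g) + cmod (ell2_inner X r (S g))"
        by (rule norm_triangle_ineq4)
      also have "\<dots> \<le> ell2_norm X (T r) * ell2_norm X g + ell2_norm X r * ell2_norm X (S g)"
        using r g Tc Sc by (intro add_mono ell2_Cauchy_Schwarz)
      also have "\<dots> \<le> (K * e) * ell2_norm X g + e * ell2_norm X (S g)"
        using K(2)[OF r] mult_left_mono[OF nr K(1)] nr
        by (intro add_mono mult_right_mono) auto
      finally show ?thesis by (simp add: algebra_simps)
    qed
    then have "cmod (?d f) \<le> 0" by (rule nonpos_if_le_mult_pos)
    then show ?thesis using g by simp
  qed
  ultimately show ?thesis using that by blast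
qed

lemma adjoint_operator_eqI:
  assumes S: "S \<in> bounded_operators X"
    and adj: "\<And>f g. f \<in> ell2 X \<Longrightarrow> g \<in> ell2 X \<Longrightarrow> ell2_inner X (T f) g = ell2_inner X f (S g)"
  shows "adjoint_operator X T = S"
  unfolding adjoint_operator_def
proof (rule the_equality)
  fix S' assume S': "S' \<in> bounded_operators X \<and>
    (\<forall>f\<in>ell2 X. \<forall>g\<in>ell2 X. ell2_inner X (T f) g = ell2_inner X f (S' g))"
  show "S' = S"
  proof (rule bounded_operators_ext[of _ X])
    fix g assume g: "g \<in> ell2 X"
    show "S' g = S g"
      by (rule ell2_ext_inner[of _ X])
         (use g S S' adj in \<open>auto simp: bounded_operator_closed[of _ X]\<close>)
  qed (use S S' in auto)
qed (use S adj in auto)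

lemma adjoint_operator:
  assumes T: "T \<in> bounded_operators X"
  shows "adjoint_operator X T \<in> bounded_operators X"
    and "\<And>f g. f \<in> ell2 X \<Longrightarrow> g \<in> ell2 X \<Longrightarrow>
      ell2_inner X (T f) g = ell2_inner X f (adjoint_operator X T g)"
  using adjoint_exists[OF T] adjoint_operator_eqI by metis+

lemma adjoint_operator_left:
  assumes "T \<in> bounded_operators X" "f \<in> ell2 X" "g \<in> ell2 X"
  shows "ell2_inner X (adjoint_operator X T f) g = ell2_inner X f (T g)"
  using adjoint_operator(2)[OF assms(1,3,2)] by (metis ell2_inner_commute)

lemma star_algebra_operator: "complex_star_algebra (OA X)"
proof -
  note [simp] = operator_algebra_simps operator_mult_closed operator_add_closed
    operator_scale_closed operator_one_closed operator_zero_closed bounded_operator_closed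
  show ?thesis
  proof (intro complex_star_algebra.intro complex_star_algebra_axioms.intro ringI)
    show "abelian_group (OA X)"
    proof (rule abelian_groupI)
      fix T assume T: "T \<in> carrier (OA X)"
      show "\<exists>S\<in>carrier (OA X). add (OA X) S T = ring.zero (OA X)"
        using T by (intro bexI[where x = "scale (OA X) (-1) T"]) (auto intro!: bounded_operators_ext[of _ X])
    qed (auto intro!: bounded_operators_ext[of _ X])
    show "Group.monoid (OA X)"
      by (rule monoidI) (auto intro!: bounded_operators_ext[of _ X])
    fix S T c
    assume S: "S \<in> carrier (OA X)"
    then show "star (OA X) S \<in> carrier (OA X)"
      by (simp add: adjoint_operator)
    show "star (OA X) (star (OA X) S) = S"
      using S by (simp add: adjoint_operator_eqI adjoint_operator_left)
    show "star (OA X) (scale (OA X) c S)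
        = scale (OA X) (cnj c) (star (OA X) S)"
      using S by (simp, intro adjoint_operator_eqI)
        (auto simp: adjoint_operator ell2_inner_scale_left ell2_inner_scale_right)
    assume T: "T \<in> carrier (OA X)"
    show "star (OA X) (add (OA X) S T)
        = add (OA X) (star (OA X) S) (star (OA X) T)"
      using S T by (simp, intro adjoint_operator_eqI)
        (auto simp: adjoint_operator ell2_inner_add_left ell2_inner_add_right)
    show "star (OA X) (mult (OA X) S T)
        = mult (OA X) (star (OA X) T) (star (OA X) S)"
      using S T by (simp, intro adjoint_operator_eqI) (auto simp: adjoint_operator)
  qed (auto intro!: bounded_operators_ext[of _ X] simp: algebra_simps bounded_operator_add bounded_operator_scale)
qed

section \<open>The operator norm\<close>

lemma bounded_operator_bdd_above:
  assumes "T \<in> bounded_operators X"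
  shows "bdd_above ((\<lambda>f. ell2_norm X (T f)) ` {f \<in> ell2 X. ell2_norm X f \<le> 1})"
proof -
  obtain K where K: "0 \<le> K" "\<And>f. f \<in> ell2 X \<Longrightarrow> ell2_norm X (T f) \<le> K * ell2_norm X f"
    using bounded_operator_bound[OF assms] by blast
  show ?thesis
  proof (rule bdd_aboveI2)
    fix h assume "h \<in> {f \<in> ell2 X. ell2_norm X f \<le> 1}"
    then show "ell2_norm X (T h) \<le> K"
      using K(2)[of h] mult_left_mono[of "ell2_norm X h" 1 K] K(1) by auto
  qed
qed

lemma operator_nrm_upper:
  assumes T: "T \<in> bounded_operators X" and f: "f \<in> ell2 X"
  shows "ell2_norm X (T f) \<le> nrm (OA X) T * ell2_norm X f"
proof (cases "ell2_norm X f = 0")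
  case True
  then have "f = (\<lambda>x. 0)" using ell2_norm_eq_0[OF f] by simp
  then show ?thesis using bounded_operator_zero[OF T] by simp
next
  case False
  let ?c = "ell2_norm X f" and ?g = "\<lambda>x. of_real (inverse (ell2_norm X f)) * f x"
  have c: "?c > 0" using False by (simp add: order_less_le)
  note bdd = bounded_operator_bdd_above[OF T]
  have ng: "ell2_norm X ?g = 1" using c by (simp add: ell2_norm_scale norm_inverse del: of_real_inverse)
  have "ell2_norm X (T ?g) \<le> nrm (OA X) T"
    unfolding operator_algebra_def using f ng cSUP_upper[OF _ bdd, of ?g] by simp
  moreover have "ell2_norm X (T ?g) = inverse ?c * ell2_norm X (T f)"
    unfolding bounded_operator_scale[OF T f] ell2_norm_scale using c by (simp add: norm_inverse del: of_real_inverse)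
  ultimately have "inverse ?c * ell2_norm X (T f) \<le> nrm (OA X) T" by linarith
  then show ?thesis using c by (simp add: field_simps)
qed

lemma operator_nrm_le:
  assumes K: "0 \<le> K" "\<And>f. f \<in> ell2 X \<Longrightarrow> ell2_norm X (T f) \<le> K * ell2_norm X f"
  shows "nrm (OA X) T \<le> K"
proof -
  have "(\<lambda>x. 0) \<in> {f \<in> ell2 X. ell2_norm X f \<le> 1}" by simp
  then have "{f \<in> ell2 X. ell2_norm X f \<le> 1} \<noteq> {}" by blast
  moreover have "ell2_norm X (T h) \<le> K" if "h \<in> ell2 X" "ell2_norm X h \<le> 1" for h
    using K(2)[of h] mult_left_mono[of "ell2_norm X h" 1 K] K(1) that by auto
  ultimately show ?thesis by (simp add: operator_algebra_def) (rule cSUP_least, auto)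
qed

lemma operator_nrm_nonneg:
  assumes "T \<in> bounded_operators X" shows "0 \<le> nrm (OA X) T"
proof -
  note bdd = bounded_operator_bdd_above[OF assms]
  have "ell2_norm X (T (\<lambda>x. 0)) \<le> nrm (OA X) T"
    unfolding operator_algebra_def using cSUP_upper[OF _ bdd, of "\<lambda>x. 0"] by simp
  then show ?thesis using ell2_norm_nonneg order.trans by blast
qed

text \<open>The C*-identity is squeezed: \<open>||S f||^2 = <f, S* S f>\<close> gives one
  inequality, submultiplicativity together with \<open>||S*|| \<le> ||S||\<close> the other. The
  bound on the adjoint comes from \<open>||S* f||^2 = <S S* f, f>\<close>.\<close>

lemma cstar_norm_operator: "cstar_norm (OA X) (nrm (OA X))"
  unfolding cstar_norm_def cstar_seminorm_def
proof (intro conjI ballI allI impI)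
  let ?n = "nrm (OA X)"
  note up = operator_nrm_upper and nn = operator_nrm_nonneg
  note [simp] = operator_algebra_simps operator_mult_closed operator_add_closed
    operator_scale_closed operator_one_closed operator_zero_closed bounded_operator_closed
  fix S assume "S \<in> carrier (OA X)"
  then have S: "S \<in> bounded_operators X" by simp
  show "0 \<le> ?n S" by (rule nn[OF S])
  have scale_le: "?n (scale (OA X) c T) \<le> cmod c * ?n T" if "T \<in> bounded_operators X" for c T
    using up[OF that] nn[OF that] by (intro operator_nrm_le)
      (auto simp: ell2_norm_scale mult.assoc intro!: mult_left_mono)
  show "?n (scale (OA X) c S) = cmod c * ?n S" for c
  proof (cases "c = 0")
    case True
    then show ?thesis using scale_le[OF S, of c] nn[OF operator_scale_closed[OF S, of c]] by simp
  next
    case False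
    have "scale (OA X) (inverse c) (scale (OA X) c S) = S"
      using False S by (intro bounded_operators_ext[of _ X]) auto
    then have "?n S \<le> inverse (cmod c) * ?n (scale (OA X) c S)"
      using scale_le[OF operator_scale_closed[OF S, of c], of "inverse c"] by (simp add: norm_inverse)
    then have "cmod c * ?n S \<le> ?n (scale (OA X) c S)"
      using False by (simp add: field_simps)
    then show ?thesis using scale_le[OF S, of c] by simp
  qed
  have mult_le: "?n (mult (OA X) S T) \<le> ?n S * ?n T"
    if S: "S \<in> bounded_operators X" and T: "T \<in> bounded_operators X" for S T
  proof (rule operator_nrm_le)
    fix f assume f: "f \<in> ell2 X"
    have "ell2_norm X (S (T f)) \<le> ?n S * (?n T * ell2_norm X f)"
      using order.trans[OF up[OF S bounded_operator_closed[OF T f]] mult_left_mono[OF up[OF T f] nn[OF S]]] .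
    then show "ell2_norm X (mult (OA X) S T f) \<le> ?n S * ?n T * ell2_norm X f"
      using f by (simp add: mult.assoc)
  qed (simp add: nn S T)
  have le_if_square_le: "?n T \<le> K"
    if T: "T \<in> bounded_operators X" and "0 \<le> K"
      and "\<And>f. f \<in> ell2 X \<Longrightarrow> (ell2_norm X (T f))\<^sup>2 \<le> (K * ell2_norm X f)\<^sup>2" for T K
    using that by (intro operator_nrm_le) (auto intro!: power2_le_imp_le)
  have star_le: "?n (adjoint_operator X S) \<le> ?n S"
  proof (rule operator_nrm_le[OF nn[OF S]])
    fix f assume f: "f \<in> ell2 X"
    let ?g = "adjoint_operator X S f"
    have g: "?g \<in> ell2 X" using bounded_operator_closed[OF adjoint_operator(1)[OF S] f] .
    have "of_real ((ell2_norm X ?g)\<^sup>2) = ell2_inner X (S ?g) f"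
      using adjoint_operator(2)[OF S g f] ell2_inner_self[OF g] by simp
    then have "(ell2_norm X ?g)\<^sup>2 = cmod (ell2_inner X (S ?g) f)"
      by (metis norm_of_real abs_power2)
    also have "\<dots> \<le> ell2_norm X (S ?g) * ell2_norm X f"
      using S g f by (intro ell2_Cauchy_Schwarz) auto
    also have "\<dots> \<le> (?n S * ell2_norm X ?g) * ell2_norm X f"
      using up[OF S g] by (intro mult_right_mono) auto
    finally have le: "ell2_norm X ?g * ell2_norm X ?g \<le> (?n S * ell2_norm X f) * ell2_norm X ?g"
      by (simp add: power2_eq_square mult_ac)
    show "ell2_norm X ?g \<le> ?n S * ell2_norm X f"
      by (rule le_if_square_le_mult[OF _ _ le]) (simp_all add: nn[OF S])
  qed
  let ?Q = "mult (OA X) (adjoint_operator X S) S"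
  have Q: "?Q \<in> bounded_operators X" by (rule operator_mult_closed[OF adjoint_operator(1)[OF S] S])
  have "?n S \<le> sqrt (?n ?Q)"
  proof (rule le_if_square_le[OF S])
    fix f assume f: "f \<in> ell2 X"
    then have Sf: "S f \<in> ell2 X" using S by simp
    have "of_real ((ell2_norm X (S f))\<^sup>2) = ell2_inner X f (?Q f)"
      using adjoint_operator(2)[OF S f Sf] ell2_inner_self[OF Sf] f by simp
    then have "(ell2_norm X (S f))\<^sup>2 = cmod (ell2_inner X f (?Q f))"
      by (metis norm_of_real abs_power2)
    also have "\<dots> \<le> ell2_norm X f * ell2_norm X (?Q f)"
      using f bounded_operator_closed[OF Q f] by (rule ell2_Cauchy_Schwarz)
    also have "\<dots> \<le> ell2_norm X f * (?n ?Q * ell2_norm X f)"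
      using up[OF Q f] by (intro mult_left_mono) auto
    finally show "(ell2_norm X (S f))\<^sup>2 \<le> (sqrt (?n ?Q) * ell2_norm X f)\<^sup>2"
      using nn[OF Q] by (simp add: power_mult_distrib) (simp add: power2_eq_square mult_ac)
  qed (simp add: nn[OF Q])
  then have "(?n S)\<^sup>2 \<le> (sqrt (?n ?Q))\<^sup>2" using nn[OF S] by (intro power_mono) auto
  then have "(?n S)\<^sup>2 \<le> ?n ?Q" using nn[OF Q] by simp
  moreover have "?n ?Q \<le> ?n S * ?n S"
    using order.trans[OF mult_le[OF adjoint_operator(1)[OF S] S] mult_right_mono[OF star_le nn[OF S]]] .
  ultimately show "?n (mult (OA X) (star (OA X) S) S) = (?n S)\<^sup>2"
    by (simp add: power2_eq_square)
  show "S = ring.zero (OA X)" if "?n S = 0"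
  proof (rule bounded_operators_ext[OF S operator_zero_closed])
    fix f assume f: "f \<in> ell2 X"
    then have "S f = (\<lambda>x. 0)"
      using up[OF S f] that S by (intro ell2_norm_eq_0[of _ X]) auto
    then show "S f = ring.zero (OA X) f" using f by simp
  qed
  fix T assume "T \<in> carrier (OA X)"
  then have T: "T \<in> bounded_operators X" by simp
  show "?n (mult (OA X) S T) \<le> ?n S * ?n T" by (rule mult_le[OF S T])
  show "?n (add (OA X) S T) \<le> ?n S + ?n T"
  proof (rule operator_nrm_le)
    fix f assume f: "f \<in> ell2 X"
    have "ell2_norm X (\<lambda>x. S f x + T f x) \<le> ell2_norm X (S f) + ell2_norm X (T f)"
      using S T f by (intro ell2_norm_triangle) auto
    then show "ell2_norm X (add (OA X) S T f) \<le> (?n S + ?n T) * ell2_norm X f"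
      using up[OF S f] up[OF T f] f by (simp add: distrib_right)
  qed (simp add: nn S T)
qed

section \<open>The Calkin representation\<close>

lemma metric_space_ell2:
  fixes X :: "'x set" shows "Metric_space (ell2 X) (\<lambda>f g. ell2_norm X (\<lambda>x. f x - g x))"
proof
  fix f g h :: "'x \<Rightarrow> complex"
  show "ell2_norm X (\<lambda>x. f x - g x) = ell2_norm X (\<lambda>x. g x - f x)"
    by (rule ell2_norm_diff_commute)
  show "(ell2_norm X (\<lambda>x. f x - g x) = 0) = (f = g)" if "f \<in> ell2 X" "g \<in> ell2 X"
    using ell2_norm_eq_0[of "\<lambda>x. f x - g x" X] that by (auto simp: fun_eq_iff)
  show "ell2_norm X (\<lambda>x. f x - h x) \<le> ell2_norm X (\<lambda>x. f x - g x) + ell2_norm X (\<lambda>x. g x - h x)"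
    if "f \<in> ell2 X" "g \<in> ell2 X" "h \<in> ell2 X"
    using ell2_norm_triangle[of "\<lambda>x. f x - g x" X "\<lambda>x. g x - h x"] that by simp
qed simp

text \<open>Guarantees that every operator lies in its own coset modulo the compact operators. The
  image of the unit ball is a single point, closed because the metric topology is Hausdorff.\<close>

lemma zero_compact_operator: "ring.zero (OA X) \<in> compact_operators X"
proof -
  interpret Metric_space "ell2 X" "\<lambda>f g. ell2_norm X (\<lambda>x. f x - g x)" by (rule metric_space_ell2)
  have "ring.zero (OA X) ` {f \<in> ell2 X. ell2_norm X f \<le> 1} = {\<lambda>x. 0}"
  proof -
    have "(\<lambda>x. 0) \<in> {f \<in> ell2 X. ell2_norm X f \<le> 1}" by simp
    then have "{f \<in> ell2 X. ell2_norm X f \<le> 1} \<noteq> {}" by blast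
    then show ?thesis by (auto simp: operator_algebra_simps image_iff)
  qed
  moreover have "mtopology closure_of {\<lambda>x. 0} = {\<lambda>x. 0}"
    using closedin_Hausdorff_singleton[OF Hausdorff_space_mtopology, of "\<lambda>x. 0"]
    by (simp add: closure_of_eq)
  ultimately show ?thesis
    by (simp add: compact_operators_def operator_zero_closed ell2_topology_def)
qed

text \<open>A compact operator maps the unit ball near finitely many vectors, and these are
  almost orthogonal to every vector supported off a large finite set.\<close>

lemma compact_operator_form_small:
  assumes k: "k \<in> compact_operators X" and e: "e > 0"
  obtains F where "finite F" "F \<subseteq> X"
    "\<And>f. f \<in> ell2 X \<Longrightarrow> (\<And>x. x \<in> F \<Longrightarrow> f x = 0) \<Longrightarrow>
      cmod (ell2_inner X (k f) f) \<le> e * (ell2_norm X f)\<^sup>2"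
proof -
  interpret Metric_space "ell2 X" "\<lambda>f g. ell2_norm X (\<lambda>x. f x - g x)" by (rule metric_space_ell2)
  have kb: "k \<in> bounded_operators X" using k by (simp add: compact_operators_def)
  note kc = bounded_operator_closed[OF kb]
  let ?B = "{f \<in> ell2 X. ell2_norm X f \<le> 1}"
  have "mtotally_bounded (mtopology closure_of (k ` ?B))"
    using k by (intro compactin_imp_mtotally_bounded) (simp add: compact_operators_def ell2_topology_def)
  \<comment> \<open>Half of \<open>e\<close> is spent on the distance to a net point, the other half
    on the tail of that point.\<close>
  then obtain D where D: "finite D" "D \<subseteq> mtopology closure_of (k ` ?B)"
    "mtopology closure_of (k ` ?B) \<subseteq> (\<Union>c\<in>D. mball c (e / 2))"
    unfolding mtotally_bounded_def using e by (meson half_gt_zero)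
  have Dc: "c \<in> ell2 X" if "c \<in> D" for c
    using D(2) that closure_of_subset_topspace[of mtopology] by auto
  have sub: "k ` ?B \<subseteq> mtopology closure_of (k ` ?B)"
    by (rule closure_of_subset) (auto simp: kc)
  have "\<forall>c\<in>D. \<exists>F. finite F \<and> F \<subseteq> X \<and>
      (\<forall>Y. F \<subseteq> Y \<longrightarrow> ell2_norm X (\<lambda>x. if x \<in> Y then 0 else c x) \<le> e / 2)"
    using ell2_tail[OF Dc, of _ "e / 2"] e by (metis half_gt_zero)
  then obtain F where F: "\<And>c. c \<in> D \<Longrightarrow> finite (F c) \<and> F c \<subseteq> X \<and>
      (\<forall>Y. F c \<subseteq> Y \<longrightarrow> ell2_norm X (\<lambda>x. if x \<in> Y then 0 else c x) \<le> e / 2)"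
    by metis
  let ?F = "\<Union>c\<in>D. F c"
  have unit: "cmod (ell2_inner X (k f) f) \<le> e"
    if f: "f \<in> ell2 X" "ell2_norm X f \<le> 1" and zero: "\<And>x. x \<in> ?F \<Longrightarrow> f x = 0" for f
  proof -
    have "k f \<in> mtopology closure_of (k ` ?B)" using sub f by auto
    then obtain c where c: "c \<in> D" "k f \<in> mball c (e / 2)" using D(3) by blast
    then have kfc: "ell2_norm X (\<lambda>x. k f x - c x) \<le> e / 2"
      by (simp add: ell2_norm_diff_commute[of X c])
    let ?c = "\<lambda>x. if x \<in> ?F then 0 else c x"
    have c': "?c \<in> ell2 X"
    proof -
      have "?c = (\<lambda>x. if x \<in> - ?F then c x else 0)" by auto
      then show ?thesis using ell2_restrict(1)[OF Dc[OF c(1)], of "- ?F"] by simp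
    qed
    have nc: "ell2_norm X ?c \<le> e / 2" using F[OF c(1)] c(1) by blast
    \<comment> \<open>\<open>f\<close> vanishes on \<open>?F\<close>, so pairing with
      \<open>c\<close> sees only the tail of \<open>c\<close>.\<close>
    have "ell2_inner X c f = ell2_inner X ?c f"
      unfolding ell2_inner_def using zero by (intro infsum_cong) auto
    then have "ell2_inner X (k f) f = ell2_inner X (\<lambda>x. k f x - c x) f + ell2_inner X ?c f"
      using f Dc[OF c(1)] kc by (simp add: ell2_inner_diff_left)
    also have "cmod \<dots> \<le> cmod (ell2_inner X (\<lambda>x. k f x - c x) f) + cmod (ell2_inner X ?c f)"
      by (rule norm_triangle_ineq)
    also have "\<dots> \<le> ell2_norm X (\<lambda>x. k f x - c x) * ell2_norm X f + ell2_norm X ?c * ell2_norm X f"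
      using f Dc[OF c(1)] kc c' by (intro add_mono ell2_Cauchy_Schwarz) auto
    also have "\<dots> \<le> (e / 2) * 1 + (e / 2) * 1"
      using kfc nc f e by (intro add_mono mult_mono) auto
    finally show ?thesis by simp
  qed
  have "cmod (ell2_inner X (k f) f) \<le> e * (ell2_norm X f)\<^sup>2"
    if f: "f \<in> ell2 X" and zero: "\<And>x. x \<in> ?F \<Longrightarrow> f x = 0" for f
  proof (cases "ell2_norm X f = 0")
    case True
    then show ?thesis using ell2_Cauchy_Schwarz[OF kc[OF f] f] by simp
  next
    case False
    then have n: "ell2_norm X f > 0" by (simp add: order_less_le)
    let ?c = "complex_of_real (inverse (ell2_norm X f))"
    let ?g = "\<lambda>x. ?c * f x"
    have g: "?g \<in> ell2 X" using f by (rule ell2_scale)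
    have cc: "cmod ?c = inverse (ell2_norm X f)" using n by (simp only: norm_of_real) simp
    have "ell2_norm X ?g \<le> 1" unfolding ell2_norm_scale cc using n by simp
    then have "cmod (ell2_inner X (k ?g) ?g) \<le> e" using zero g by (intro unit) auto
    moreover have "ell2_inner X (k ?g) ?g = ?c * (cnj ?c * ell2_inner X (k f) f)"
      unfolding bounded_operator_scale[OF kb f] ell2_inner_scale_left ell2_inner_scale_right by simp
    ultimately have "inverse (ell2_norm X f) * (inverse (ell2_norm X f) * cmod (ell2_inner X (k f) f)) \<le> e"
      by (simp only: norm_mult cc complex_mod_cnj)
    then show ?thesis using n by (simp add: field_simps power2_eq_square)
  qed
  then show ?thesis using that[of ?F] D(1) F by blast
qed

section \<open>Permutations acting on square-summable functions\<close>

lemma ell2_reindex: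
  assumes s: "bij_betw s X X" and f: "f \<in> ell2 X"
  shows "(\<lambda>x. if x \<in> X then f (s x) else 0) \<in> ell2 X"
    and "ell2_norm X (\<lambda>x. if x \<in> X then f (s x) else 0) = ell2_norm X f"
proof -
  let ?f = "\<lambda>x. if x \<in> X then f (s x) else 0"
  have "(\<lambda>x. (cmod (f (s x)))\<^sup>2) summable_on X"
    using ell2_summable[OF f] summable_on_reindex_bij_betw[OF s, of "\<lambda>x. (cmod (f x))\<^sup>2"]
    by simp
  then have "(\<lambda>x. (cmod (?f x))\<^sup>2) summable_on X"
    by (rule summable_on_cong[THEN iffD1, rotated]) simp
  then show "?f \<in> ell2 X" by (simp add: ell2_def)
  have "(\<Sum>\<^sub>\<infinity>x\<in>X. (cmod (?f x))\<^sup>2) = (\<Sum>\<^sub>\<infinity>x\<in>X. (cmod (f (s x)))\<^sup>2)"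
    by (rule infsum_cong) simp
  also have "\<dots> = (\<Sum>\<^sub>\<infinity>x\<in>X. (cmod (f x))\<^sup>2)"
    by (rule infsum_reindex_bij_betw[OF s, of "\<lambda>x. (cmod (f x))\<^sup>2"])
  finally show "ell2_norm X ?f = ell2_norm X f" by (simp add: ell2_norm_def)
qed

locale discrete_group_action = discrete_group G + group_action G X \<alpha>
  for G :: "('g, 'm) monoid_scheme" (structure) and X :: "'x set" and \<alpha> :: "'g \<Rightarrow> 'x \<Rightarrow> 'x"
begin

lemma action_bij: "g \<in> carrier G \<Longrightarrow> bij_betw (\<alpha> g) X X"
  using bij_prop0 by (simp add: Bij_def)

lemma action_closed: "g \<in> carrier G \<Longrightarrow> x \<in> X \<Longrightarrow> \<alpha> g x \<in> X"
  using element_image by blast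

lemma action_mult: "g \<in> carrier G \<Longrightarrow> h \<in> carrier G \<Longrightarrow> x \<in> X \<Longrightarrow> \<alpha> (g \<otimes> h) x = \<alpha> g (\<alpha> h x)"
  by (rule composition_rule)

lemma action_one: "x \<in> X \<Longrightarrow> \<alpha> \<one> x = x"
  using id_eq_one by (metis restrict_apply')

lemma action_inv_left: "g \<in> carrier G \<Longrightarrow> x \<in> X \<Longrightarrow> \<alpha> (inv g) (\<alpha> g x) = x"
  using action_mult[of "inv g" g x] action_one by simp

lemma action_inv_right: "g \<in> carrier G \<Longrightarrow> x \<in> X \<Longrightarrow> \<alpha> g (\<alpha> (inv g) x) = x"
  using action_mult[of g "inv g" x] action_one by simp

abbreviation "\<pi> \<equiv> permutation_rep G X \<alpha>"

lemma permutation_rep_apply: "f \<in> ell2 X \<Longrightarrow> \<pi> g f = (\<lambda>x. if x \<in> X then f (\<alpha> (inv g) x) else 0)"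
  by (simp add: permutation_rep_def)

lemma action_infsum: "g \<in> carrier G \<Longrightarrow> (\<Sum>\<^sub>\<infinity>x\<in>X. f (\<alpha> g x)) = (\<Sum>\<^sub>\<infinity>x\<in>X. f x)"
  by (rule infsum_reindex_bij_betw[OF action_bij])

lemmas ell2_action = ell2_reindex[OF action_bij]

lemma permutation_rep_bounded:
  assumes g: "g \<in> carrier G" shows "\<pi> g \<in> bounded_operators X"
  unfolding permutation_rep_def using ell2_action[OF inv_closed[OF g]]
  by (intro restrict_bounded_operator[where K = 1]) auto

text \<open>Substituting \<open>\<alpha> g x\<close> for \<open>x\<close> in the sum moves the
  operator to the other side with \<open>inv g\<close>; this is unitarity of the
  representation.\<close>

lemma permutation_rep_inner:
  assumes g: "g \<in> carrier G" and f: "f \<in> ell2 X" and h: "h \<in> ell2 X"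
  shows "ell2_inner X (\<pi> g f) h = ell2_inner X f (\<pi> (inv g) h)"
proof -
  have "ell2_inner X (\<pi> g f) h = (\<Sum>\<^sub>\<infinity>x\<in>X. f (\<alpha> (inv g) x) * cnj (h x))"
    unfolding permutation_rep_apply[OF f] ell2_inner_def by (rule infsum_cong) simp
  also have "\<dots> = (\<Sum>\<^sub>\<infinity>x\<in>X. f (\<alpha> (inv g) (\<alpha> g x)) * cnj (h (\<alpha> g x)))"
    by (rule action_infsum[OF g, symmetric, of "\<lambda>x. f (\<alpha> (inv g) x) * cnj (h x)"])
  also have "\<dots> = ell2_inner X f (\<pi> (inv g) h)"
    unfolding permutation_rep_apply[OF h] ell2_inner_def using g
    by (intro infsum_cong) (simp add: action_inv_left)
  finally show ?thesis .
qed

lemma unitary_rep_permutation: "unitary_rep G (OA X) \<pi>"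
proof (intro unitary_rep.intro unitary_rep_axioms.intro star_algebra_operator cstar_norm_operator
    discrete_group_axioms)
  show "\<pi> g \<in> carrier (OA X)" if "g \<in> carrier G" for g
    using that by (simp add: operator_algebra_simps permutation_rep_bounded)
  show "\<pi> (g \<otimes> h) = mult (OA X) (\<pi> g) (\<pi> h)"
    if "g \<in> carrier G" "h \<in> carrier G" for g h
  proof (rule bounded_operators_ext)
    fix f assume f: "f \<in> ell2 X"
    have "\<pi> g (\<pi> h f) = (\<lambda>x. if x \<in> X then \<pi> h f (\<alpha> (inv g) x) else 0)"
      using bounded_operator_closed[OF permutation_rep_bounded[OF that(2)] f]
      by (rule permutation_rep_apply)
    also have "\<dots> = \<pi> (g \<otimes> h) f"
      using that f by (auto simp: permutation_rep_apply inv_mult_group action_mult action_closed)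
    finally show "\<pi> (g \<otimes> h) f = mult (OA X) (\<pi> g) (\<pi> h) f"
      using f by (simp add: operator_algebra_simps)
  qed (use that in \<open>auto simp: permutation_rep_bounded intro!: operator_mult_closed\<close>)
  show "\<pi> \<one> = one (OA X)"
  proof (rule bounded_operators_ext[OF permutation_rep_bounded operator_one_closed])
    fix f assume f: "f \<in> ell2 X"
    then show "\<pi> \<one> f = one (OA X) f"
      by (auto simp: permutation_rep_apply operator_algebra_simps action_one ell2_zero_outside)
  qed simp
  show "star (OA X) (\<pi> g) = \<pi> (inv g)" if "g \<in> carrier G" for g
    unfolding operator_algebra_simps using that
    by (intro adjoint_operator_eqI permutation_rep_inner permutation_rep_bounded) auto
qed

end

sublocale discrete_group_action \<subseteq> P: unitary_rep G "OA X" "permutation_rep G X \<alpha>"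
  by (rule unitary_rep_permutation)

lemma operator_finsum:
  assumes "finite I" "\<And>i. i \<in> I \<Longrightarrow> T i \<in> bounded_operators X" "f \<in> ell2 X"
  shows "(\<Oplus>\<^bsub>OA X\<^esub>i\<in>I. T i) f = (\<lambda>x. \<Sum>i\<in>I. T i f x)"
proof -
  interpret complex_star_algebra "OA X" by (rule star_algebra_operator)
  show ?thesis using assms(1,2)
  proof (induction I)
    case (insert i I)
    then show ?case using assms(3)
      by (subst finsum_insert) (auto simp: operator_algebra_simps)
  qed (simp add: operator_algebra_simps assms(3))
qed

context discrete_group_action
begin

lemma permutation_linear_extension_inner:
  assumes a: "a \<in> carrier GA" and f: "f \<in> ell2 X"
  shows "ell2_inner X (P.L a f) f = (\<Sum>g | a g \<noteq> 0. a g * ell2_inner X (\<pi> g f) f)"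
proof -
  have fin: "finite {g. a g \<noteq> 0}" and sub: "{g. a g \<noteq> 0} \<subseteq> carrier G"
    using a by (auto simp: group_algebra_carrier_iff)
  then have c: "\<pi> g f \<in> ell2 X" if "a g \<noteq> 0" for g
    using that f by (intro bounded_operator_closed[OF permutation_rep_bounded]) auto
  have "P.L a f = (\<lambda>x. \<Sum>g | a g \<noteq> 0. scale (OA X) (a g) (\<pi> g) f x)"
    unfolding linear_extension_def using fin sub f
    by (intro operator_finsum) (auto intro!: operator_scale_closed permutation_rep_bounded)
  then have "ell2_inner X (P.L a f) f = ell2_inner X (\<lambda>x. \<Sum>g | a g \<noteq> 0. a g * \<pi> g f x) f"
    using f by (simp add: operator_algebra_simps)
  also have "\<dots> = (\<Sum>g | a g \<noteq> 0. ell2_inner X (\<lambda>x. a g * \<pi> g f x) f)"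
    using c f by (intro ell2_inner_sum_left) auto
  finally show ?thesis by (simp add: ell2_inner_scale_left)
qed

lemma calkin_rep_const:
  "a \<in> carrier GA \<Longrightarrow> calkin_rep G X \<alpha> (F.cls (\<lambda>n. a)) =
    compact_operators X +>\<^bsub>OA X\<^esub> P.L a"
  by (simp add: calkin_rep_def P.associated_hom_const)

text \<open>The completion contains a square root \<open>y\<close> of \<open>1 - z\<close>, so modulo compact operators the
  image of \<open>1 - z\<close> is \<open>T* T\<close> for a bounded operator \<open>T\<close> representing the image of \<open>y\<close>.\<close>

lemma calkin_square_root:
  assumes norm: "cstar_norm GA \<tau>"
    and cont: "tau_continuous G \<tau> (calkin_algebra X) (calkin_rep G X \<alpha>)"
    and z: "z \<in> carrier GA" "star GA z = z" "\<tau> z < 1"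
  obtains T k where "T \<in> bounded_operators X" "k \<in> compact_operators X"
    "mult (OA X) (adjoint_operator X T) T
      = add (OA X) k (P.L (a_minus GA (one GA) z))"
proof -
  have semi: "cstar_seminorm GA \<tau>" using norm by (simp add: cstar_norm_def)
  interpret T: cstar_seminormed_algebra GA \<tau> by unfold_locales (rule semi)
  obtain \<Psi> where \<Psi>: "\<Psi> \<in> star_hom T.CP (calkin_algebra X)"
    and fact: "\<And>c. c \<in> carrier F.CP \<Longrightarrow> calkin_rep G X \<alpha> c = \<Psi> (canonical_surjection G \<tau> c)"
    using cont unfolding tau_continuous_def full_group_cstar_def group_cstar_completion_def by blast
  let ?z = "a_minus GA (one GA) z" and ?K = "compact_operators X" and ?O = "OA X"
  have zc: "?z \<in> carrier GA" using z by simp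
  have \<Psi>z: "\<Psi> (T.cls (\<lambda>n. ?z)) = ?K +>\<^bsub>?O\<^esub> P.L ?z"
    using fact[of "F.cls (\<lambda>n. ?z)"] canonical_surjection_cls[OF semi F.cauchy_const[OF zc]]
      calkin_rep_const[OF zc] F.cauchy_const[OF zc]
    by (simp add: F.carrier_completion)
  obtain w where w: "w \<in> carrier T.C" "\<And>n. star GA (w n) = w n"
    and lim: "(\<lambda>n. \<tau> (a_minus GA (mult GA (w n) (w n)) ?z)) \<longlonglongrightarrow> 0"
    using T.sqrt_sequence[OF z] by blast
  have y: "T.cls w \<in> carrier T.CP" using w by (simp add: T.carrier_completion)
  have "mult T.CP (star T.CP (T.cls w)) (T.cls w) = T.cls (\<lambda>n. mult GA (w n) (w n))"
    using w by (simp add: T.completion_star T.completion_mult)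
  also have "\<dots> = T.cls (\<lambda>n. ?z)"
    using T.cls_eq_iff[OF T.cauchy_mult[OF w(1) w(1)] T.cauchy_const[OF zc]] lim by simp
  finally have "\<Psi> (mult T.CP (star T.CP (T.cls w)) (T.cls w)) = ?K +>\<^bsub>?O\<^esub> P.L ?z"
    using \<Psi>z by simp
  moreover have "star T.CP (T.cls w) \<in> carrier T.CP"
    using w by (simp add: T.completion_star T.carrier_completion T.cauchy_star)
  \<comment> \<open>Only multiplicativity and compatibility with the star enter, since
    \<open>star_hom\<close> says nothing about continuity of \<open>\<Psi>\<close>.\<close>
  ultimately have eq: "mult (calkin_algebra X) (star (calkin_algebra X) (\<Psi> (T.cls w))) (\<Psi> (T.cls w))
      = ?K +>\<^bsub>?O\<^esub> P.L ?z"
    using \<Psi> y by (simp add: star_hom_def ring_hom_def)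
  have "\<Psi> (T.cls w) \<in> carrier (calkin_algebra X)"
    using \<Psi> y by (auto simp: star_hom_def ring_hom_def)
  then obtain T where T: "T \<in> bounded_operators X" "\<Psi> (T.cls w) = ?K +>\<^bsub>?O\<^esub> T"
    by (auto simp: calkin_algebra_def quotient_algebra_def FactRing_def A_RCOSETS_def'
        a_r_coset_def' operator_algebra_simps)
  have self: "S \<in> ?K +>\<^bsub>?O\<^esub> S" if "S \<in> bounded_operators X" for S
  proof -
    have "S = add ?O (ring.zero ?O) S"
      using that by (intro bounded_operators_ext[of _ X])
        (auto simp: operator_algebra_simps operator_add_closed operator_zero_closed)
    then show ?thesis using zero_compact_operator by (auto simp: a_r_coset_def')
  qed
  have TS: "T \<in> \<Psi> (T.cls w)" using self[OF T(1)] T(2) by simp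
  \<comment> \<open>In the quotient, star and product are unions over representatives, so
    \<open>T* T\<close> is a member of the product set. By \<open>eq\<close> that set is the coset
    of the image of \<open>1 - z\<close>, and membership in it yields \<open>k\<close>.\<close>
  have "adjoint_operator X T \<in> star (calkin_algebra X) (\<Psi> (T.cls w))"
    unfolding calkin_algebra_def quotient_algebra_def
    using TS self[OF adjoint_operator(1)[OF T(1)]] by (auto simp: operator_algebra_simps)
  then have "mult ?O (adjoint_operator X T) T \<in>
      mult (calkin_algebra X) (star (calkin_algebra X) (\<Psi> (T.cls w))) (\<Psi> (T.cls w))"
    using TS self[OF operator_mult_closed[OF adjoint_operator(1)[OF T(1)] T(1)]]
    by (auto simp: calkin_algebra_def quotient_algebra_def FactRing_def rcoset_mult_def)
  then obtain k where "k \<in> ?K" "mult ?O (adjoint_operator X T) T = add ?O k (P.L ?z)"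
    unfolding eq by (auto simp: a_r_coset_def')
  then show ?thesis using that T(1) by blast
qed

text \<open>Since \<open>T* T = k + 1 - P.L z\<close>, the inequality
  \<open>||T f||^2 \<ge> 0\<close> bounds the form of \<open>z\<close> by \<open>||f||^2\<close>
  plus the form of \<open>k\<close>, and vanishing of \<open>f\<close> on \<open>F\<close> makes the
  latter at most \<open>e ||f||^2\<close>.\<close>

lemma calkin_form_bound:
  assumes norm: "cstar_norm GA \<tau>"
    and cont: "tau_continuous G \<tau> (calkin_algebra X) (calkin_rep G X \<alpha>)"
    and z: "z \<in> carrier GA" "star GA z = z" "\<tau> z < 1" and e: "e > 0"
  obtains F where "finite F" "F \<subseteq> X"
    "\<And>f. f \<in> ell2 X \<Longrightarrow> (\<And>x. x \<in> F \<Longrightarrow> f x = 0) \<Longrightarrow>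
      Re (\<Sum>g | z g \<noteq> 0. z g * ell2_inner X (\<pi> g f) f) \<le> (1 + e) * (ell2_norm X f)\<^sup>2"
proof -
  obtain T k where T: "T \<in> bounded_operators X" and k: "k \<in> compact_operators X"
    and eq: "mult (OA X) (adjoint_operator X T) T
      = add (OA X) k (P.L (a_minus GA (one GA) z))"
    using calkin_square_root[OF norm cont z] by blast
  have kb: "k \<in> bounded_operators X" using k by (simp add: compact_operators_def)
  obtain F where F: "finite F" "F \<subseteq> X" and small: "\<And>f. f \<in> ell2 X \<Longrightarrow> (\<And>x. x \<in> F \<Longrightarrow> f x = 0) \<Longrightarrow>
      cmod (ell2_inner X (k f) f) \<le> e * (ell2_norm X f)\<^sup>2"
    using compact_operator_form_small[OF k e] by blast
  have "Re (\<Sum>g | z g \<noteq> 0. z g * ell2_inner X (\<pi> g f) f) \<le> (1 + e) * (ell2_norm X f)\<^sup>2"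
    if f: "f \<in> ell2 X" and zero: "\<And>x. x \<in> F \<Longrightarrow> f x = 0" for f
  proof -
    have Lz: "P.L z \<in> bounded_operators X"
      using P.linear_extension_closed[OF z(1)] by (simp add: operator_algebra_simps)
    have "P.L (a_minus GA (one GA) z)
        = add (OA X) (one (OA X)) (scale (OA X) (-1) (P.L z))"
      using z(1) P.linear_extension_diff[of "one GA" z] P.linear_extension_star_hom
      by (simp add: a_minus_def P.B.minus_eq_scale P.linear_extension_closed star_hom_def ring_hom_def)
    then have "P.L (a_minus GA (one GA) z) f = (\<lambda>x. f x - P.L z f x)"
      using f by (simp add: operator_algebra_simps)
    then have "adjoint_operator X T (T f) = (\<lambda>x. k f x + (f x - P.L z f x))"
      using fun_cong[OF eq, of f] f by (simp add: operator_algebra_simps)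
    then have "ell2_inner X (adjoint_operator X T (T f)) f
        = ell2_inner X (k f) f + (ell2_inner X f f - ell2_inner X (P.L z f) f)"
      using f kb Lz by (simp add: bounded_operator_closed[of _ X] ell2_inner_add_left ell2_inner_diff_left)
    moreover have "ell2_inner X (adjoint_operator X T (T f)) f = of_real ((ell2_norm X (T f))\<^sup>2)"
      using T f by (simp add: adjoint_operator_left bounded_operator_closed ell2_inner_self)
    ultimately have "of_real ((ell2_norm X (T f))\<^sup>2)
        = ell2_inner X (k f) f + (of_real ((ell2_norm X f)\<^sup>2) - ell2_inner X (P.L z f) f)"
      using ell2_inner_self[OF f] by simp
    then have "(ell2_norm X (T f))\<^sup>2
        = Re (ell2_inner X (k f) f) + ((ell2_norm X f)\<^sup>2 - Re (ell2_inner X (P.L z f) f))"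
      by (metis Re_complex_of_real minus_complex.sel(1) plus_complex.sel(1))
    moreover have "Re (ell2_inner X (k f) f) \<le> e * (ell2_norm X f)\<^sup>2"
      using small[OF f zero] complex_Re_le_cmod order.trans by blast
    ultimately have "Re (ell2_inner X (P.L z f) f) \<le> (ell2_norm X f)\<^sup>2 + e * (ell2_norm X f)\<^sup>2"
      using zero_le_power2[of "ell2_norm X (T f)"] by linarith
    then show ?thesis
      unfolding permutation_linear_extension_inner[OF z(1) f] by (simp add: algebra_simps)
  qed
  then show ?thesis using that F by blast
qed

end

section \<open>Positive supersolutions\<close>

lemma ell2_of_real_mult:
  fixes f g :: "'x \<Rightarrow> real"
  assumes f: "(\<lambda>x. complex_of_real (f x)) \<in> ell2 X" and g: "(\<lambda>x. complex_of_real (g x)) \<in> ell2 X"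
    and nonneg: "\<And>x. 0 \<le> f x" "\<And>x. 0 \<le> g x"
  shows "(\<lambda>x. f x * g x) summable_on X"
    and "(\<Sum>\<^sub>\<infinity>x\<in>X. f x * g x)
      \<le> ell2_norm X (\<lambda>x. complex_of_real (f x)) * ell2_norm X (\<lambda>x. complex_of_real (g x))"
  using ell2_mult_abs_summable[OF f g] nonneg by (simp_all add: norm_mult)

lemma ell2_norm_of_real_square:
  "(ell2_norm X (\<lambda>x. complex_of_real (f x)))\<^sup>2 = (\<Sum>\<^sub>\<infinity>x\<in>X. (f x)\<^sup>2)"
  by (simp add: ell2_norm_square)

text \<open>Provides a source that is strictly positive at every point and yet square-summable, by
  geometric weights along an enumeration; this is where countability of \<open>X\<close>
  enters.\<close>

lemma countable_weight:
  assumes "countable X"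
  obtains w :: "'x \<Rightarrow> real" where "\<And>x. 0 < w x"
    "(\<lambda>x. complex_of_real (if x \<in> X then w x else 0)) \<in> ell2 X"
proof -
  define w :: "'x \<Rightarrow> real" where "w = (\<lambda>x. (1 / 2) ^ to_nat_on X x)"
  have "(\<Sum>x\<in>F. (cmod (complex_of_real (if x \<in> X then w x else 0)))\<^sup>2) \<le> (\<Sum>n. (1 / 2) ^ n)"
    if F: "finite F" "F \<subseteq> X" for F
  proof -
    have inj: "inj_on (to_nat_on X) F"
      by (rule inj_on_subset[OF inj_on_to_nat_on[OF assms] F(2)])
    have "(\<Sum>x\<in>F. (cmod (complex_of_real (if x \<in> X then w x else 0)))\<^sup>2)
        \<le> (\<Sum>x\<in>F. (1 / 2) ^ to_nat_on X x)"
    proof (rule sum_mono)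
      fix x
      have "w x * w x \<le> w x * 1"
        unfolding w_def by (intro mult_left_mono power_le_one) auto
      then show "(cmod (complex_of_real (if x \<in> X then w x else 0)))\<^sup>2 \<le> (1 / 2) ^ to_nat_on X x"
        by (simp add: power2_eq_square w_def)
    qed
    also have "\<dots> = (\<Sum>n\<in>to_nat_on X ` F. (1 / 2) ^ n)"
      by (simp add: sum.reindex[OF inj])
    also have "\<dots> \<le> (\<Sum>n. (1 / 2) ^ n)"
      using F by (intro sum_le_suminf) (auto simp: summable_geometric)
    finally show ?thesis .
  qed
  then have "(\<lambda>x. complex_of_real (if x \<in> X then w x else 0)) \<in> ell2 X"
    by (intro ell2I) auto
  moreover have "0 < w x" for x by (simp add: w_def)
  ultimately show ?thesis using that by blast
qed

lemma infsum_finite_sum: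
  fixes f :: "'i \<Rightarrow> 'x \<Rightarrow> real"
  assumes "finite I" "\<And>i. i \<in> I \<Longrightarrow> f i summable_on X"
  shows "(\<lambda>x. \<Sum>i\<in>I. f i x) summable_on X \<and>
    (\<Sum>\<^sub>\<infinity>x\<in>X. \<Sum>i\<in>I. f i x) = (\<Sum>i\<in>I. \<Sum>\<^sub>\<infinity>x\<in>X. f i x)"
  using assms
proof (induction I)
  case (insert i I)
  then show ?case by (simp add: summable_on_add infsum_add)
qed simp

text \<open>The supersolution is the increasing limit of the iteration \<open>v \<mapsto> w + A v / r\<close>. Since
  \<open>v k \<le> v (k + 1)\<close>, the form bound gives
  \<open>\<parallel>v k\<parallel>\<^sup>2 \<le> \<langle>v k, v (k + 1)\<rangle> \<le> \<parallel>v k\<parallel> \<parallel>w\<parallel> + (\<rho> / r) \<parallel>v k\<parallel>\<^sup>2\<close>, so the iteration stays bounded.\<close>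

lemma positive_supersolution:
  fixes X :: "'x set" and s :: "'i \<Rightarrow> 'x \<Rightarrow> 'x" and \<rho> r :: real
  assumes "countable X" and fin: "finite S" and bij: "\<And>i. i \<in> S \<Longrightarrow> bij_betw (s i) X X"
    and Y: "Y \<subseteq> X" and r: "0 < r" "\<rho> < r"
    and form: "\<And>f :: 'x \<Rightarrow> real. (\<And>x. 0 \<le> f x) \<Longrightarrow> (\<And>x. x \<notin> Y \<Longrightarrow> f x = 0) \<Longrightarrow>
      (\<lambda>x. complex_of_real (f x)) \<in> ell2 X \<Longrightarrow>
      (\<Sum>i\<in>S. \<Sum>\<^sub>\<infinity>x\<in>X. f (s i x) * f x) \<le> \<rho> * (\<Sum>\<^sub>\<infinity>x\<in>X. (f x)\<^sup>2)"
  shows "\<exists>u :: 'x \<Rightarrow> real. (\<forall>x\<in>Y. 0 < u x) \<and> (\<forall>x. x \<notin> Y \<longrightarrow> u x = 0) \<and>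
    (\<forall>x\<in>Y. (\<Sum>i\<in>S. u (s i x)) \<le> r * u x)"
proof -
  obtain w0 :: "'x \<Rightarrow> real" where w0: "\<And>x. 0 < w0 x"
    "(\<lambda>x. complex_of_real (if x \<in> X then w0 x else 0)) \<in> ell2 X"
    using countable_weight[OF \<open>countable X\<close>] by blast
  \<comment> \<open>Strict positivity of the source on \<open>Y\<close> is inherited by the limit
    \<open>u\<close>, which lies above \<open>w\<close> there.\<close>
  define w where "w = (\<lambda>x. if x \<in> Y then w0 x else 0)"
  have w_pos: "0 < w x" if "x \<in> Y" for x using that w0 by (simp add: w_def)
  have w_nonneg: "0 \<le> w x" for x using w0 by (simp add: w_def less_imp_le)
  have w_ell2: "(\<lambda>x. complex_of_real (w x)) \<in> ell2 X"
  proof -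
    have "(\<lambda>x. complex_of_real (w x))
        = (\<lambda>x. if x \<in> Y then complex_of_real (if x \<in> X then w0 x else 0) else 0)"
      using Y by (auto simp: w_def fun_eq_iff)
    then show ?thesis using ell2_restrict(1)[OF w0(2), of Y] by simp
  qed
  \<comment> \<open>The value 0 off \<open>Y\<close> is a Dirichlet condition: it keeps every
    iterate in the class of functions to which \<open>form\<close> applies.\<close>
  define \<Phi> where "\<Phi> = (\<lambda>f x. if x \<in> Y then w x + (\<Sum>i\<in>S. f (s i x)) / r else 0)"
  define v where "v = (\<lambda>k. (\<Phi> ^^ k) (\<lambda>x. 0))"
  have v_0: "v 0 x = 0" for x by (simp add: v_def)
  have v_Suc: "v (Suc k) x = (if x \<in> Y then w x + (\<Sum>i\<in>S. v k (s i x)) / r else 0)" for k x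
    by (simp add: v_def \<Phi>_def)
  have v_off: "v k x = 0" if "x \<notin> Y" for k x using that by (cases k) (auto simp: v_0 v_Suc)
  have v_nonneg: "0 \<le> v k x" for k x
  proof (induction k arbitrary: x)
    case (Suc k)
    then show ?case using r w_nonneg by (simp add: v_Suc sum_nonneg)
  qed (simp add: v_0)
  have v_mono: "v k x \<le> v (Suc k) x" for k x
  proof (induction k arbitrary: x)
    case 0
    then show ?case using v_nonneg[of "Suc 0" x] by (simp add: v_0)
  next
    case (Suc k)
    have "(\<Sum>i\<in>S. v k (s i x)) / r \<le> (\<Sum>i\<in>S. v (Suc k) (s i x)) / r"
      using r by (intro divide_right_mono sum_mono Suc) auto
    then show ?case unfolding v_Suc[of "Suc k" x] v_Suc[of k x] by simp
  qed
  let ?h = "\<lambda>f x. complex_of_real (f x)"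
  let ?c = "\<lambda>f i x. if x \<in> X then f (s i x) else (0::real)"
  have comp_ell2: "?h (?c f i) \<in> ell2 X" if "?h f \<in> ell2 X" "i \<in> S" for f i
  proof -
    have "?h (?c f i) = (\<lambda>x. if x \<in> X then ?h f (s i x) else 0)" by auto
    then show ?thesis using ell2_reindex(1)[OF bij[OF that(2)] that(1)] by simp
  qed
  have v_ell2: "?h (v k) \<in> ell2 X" for k
  proof (induction k)
    case (Suc k)
    let ?t = "\<lambda>x. ?h w x + complex_of_real (1 / r) * (\<Sum>i\<in>S. ?h (?c (v k) i) x)"
    have t: "?t \<in> ell2 X"
      by (intro ell2_add ell2_scale ell2_sum w_ell2 comp_ell2[OF Suc])
    have "?h (v (Suc k)) = (\<lambda>x. if x \<in> Y then ?t x else 0)"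
      using Y by (auto simp: v_Suc fun_eq_iff)
    then show ?case using ell2_restrict(1)[OF t, of Y] by simp
  qed (simp add: v_0)
  define W where "W = ell2_norm X (?h w)"
  \<comment> \<open>\<open>K\<close> is the bound that \<open>N \<le> W + (\<rho> / r) N\<close>
    gives for the norm \<open>N\<close> of an iterate; the denominator is positive because
    \<open>\<rho> < r\<close>.\<close>
  define K where "K = W / (1 - \<rho> / r)"
  have rr: "1 - \<rho> / r > 0" using r by simp
  have K0: "0 \<le> K" unfolding K_def W_def using rr by (intro divide_nonneg_pos) auto
  have bound: "ell2_norm X (?h (v k)) \<le> K" for k
  proof -
    let ?N = "ell2_norm X (?h (v k))"
    have sum1: "(\<lambda>x. v k x * w x) summable_on X" "(\<Sum>\<^sub>\<infinity>x\<in>X. v k x * w x) \<le> ?N * W"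
      using ell2_of_real_mult[OF v_ell2 w_ell2 v_nonneg w_nonneg] by (auto simp: W_def)
    have sum2: "(\<lambda>x. v k (s i x) * v k x) summable_on X" if "i \<in> S" for i
      using ell2_of_real_mult(1)[OF comp_ell2[OF v_ell2 that] v_ell2, of k k] v_nonneg
      by (subst summable_on_cong[where g = "\<lambda>x. ?c (v k) i x * v k x"]) auto
    have sum3: "(\<lambda>x. \<Sum>i\<in>S. v k (s i x) * v k x) summable_on X"
      and eq3: "(\<Sum>\<^sub>\<infinity>x\<in>X. \<Sum>i\<in>S. v k (s i x) * v k x) = (\<Sum>i\<in>S. \<Sum>\<^sub>\<infinity>x\<in>X. v k (s i x) * v k x)"
      using infsum_finite_sum[OF fin, of "\<lambda>i x. v k (s i x) * v k x" X] sum2 by auto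
    have "?N\<^sup>2 = (\<Sum>\<^sub>\<infinity>x\<in>X. v k x * v k x)"
      unfolding ell2_norm_of_real_square by (simp add: power2_eq_square)
    also have "\<dots> \<le> (\<Sum>\<^sub>\<infinity>x\<in>X. v k x * v (Suc k) x)"
      by (intro infsum_mono ell2_of_real_mult(1) v_ell2 mult_left_mono v_mono v_nonneg)
    also have "\<dots> = (\<Sum>\<^sub>\<infinity>x\<in>X. v k x * w x + (1 / r) * (\<Sum>i\<in>S. v k (s i x) * v k x))"
    proof (rule infsum_cong)
      fix x
      show "v k x * v (Suc k) x = v k x * w x + (1 / r) * (\<Sum>i\<in>S. v k (s i x) * v k x)"
        by (cases "x \<in> Y") (simp_all add: v_off v_Suc distrib_left sum_distrib_left sum_divide_distrib mult_ac)
    qed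
    also have "\<dots> = (\<Sum>\<^sub>\<infinity>x\<in>X. v k x * w x) + (1 / r) * (\<Sum>i\<in>S. \<Sum>\<^sub>\<infinity>x\<in>X. v k (s i x) * v k x)"
      using infsum_add[OF sum1(1) summable_on_cmult_right[OF sum3, of "1 / r"]]
      by (simp only: infsum_cmult_right' eq3)
    also have "\<dots> \<le> ?N * W + (1 / r) * (\<rho> * ?N\<^sup>2)"
      using form[of "v k", OF v_nonneg v_off v_ell2] r sum1(2)
      by (intro add_mono mult_left_mono) (auto simp: ell2_norm_of_real_square)
    finally have "?N * ((1 - \<rho> / r) * ?N) \<le> ?N * W"
      by (simp add: power2_eq_square algebra_simps)
    then have "?N = 0 \<or> (1 - \<rho> / r) * ?N \<le> W"
      using ell2_norm_nonneg[of X "?h (v k)"] by (metis mult_le_cancel_left_pos order_less_le)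
    then show "?N \<le> K"
    proof
      assume "(1 - \<rho> / r) * ?N \<le> W"
      then show ?thesis unfolding K_def using rr by (simp add: pos_le_divide_eq mult.commute)
    qed (use K0 in simp)
  qed
  \<comment> \<open>A single coordinate is at most the norm, so the increasing iterates converge at
    every point.\<close>
  have v_le: "v k x \<le> K" for k x
  proof (cases "x \<in> Y")
    case True
    then have "(\<Sum>x\<in>{x}. (cmod (?h (v k) x))\<^sup>2) \<le> (ell2_norm X (?h (v k)))\<^sup>2"
      using Y by (intro ell2_sum_le v_ell2) auto
    then have "(v k x)\<^sup>2 \<le> (ell2_norm X (?h (v k)))\<^sup>2" by simp
    then have "v k x \<le> ell2_norm X (?h (v k))" by (rule power2_le_imp_le[OF _ ell2_norm_nonneg])
    then show ?thesis using bound[of k] by linarith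
  qed (simp add: v_off K0)
  define u where "u = (\<lambda>x. lim (\<lambda>k. v k x))"
  have lim: "(\<lambda>k. v k x) \<longlonglongrightarrow> u x" and le_u: "v k x \<le> u x" for x k
  proof -
    have inc: "incseq (\<lambda>k. v k x)" by (rule incseq_SucI) (rule v_mono)
    obtain L where L: "(\<lambda>k. v k x) \<longlonglongrightarrow> L" "\<forall>k. v k x \<le> L"
      using incseq_convergent[OF inc, of K] v_le by blast
    then show "(\<lambda>k. v k x) \<longlonglongrightarrow> u x" "v k x \<le> u x" by (auto simp: u_def limI)
  qed
  show ?thesis
  proof (intro exI[of _ u] conjI ballI allI impI)
    fix x
    show "u x = 0" if "x \<notin> Y" using v_off[OF that] by (simp add: u_def)
    assume x: "x \<in> Y"
    show "0 < u x"
      using le_u[of "Suc 0" x] w_pos[OF x] x by (simp add: v_Suc v_0)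
    \<comment> \<open>On \<open>Y\<close> the limit satisfies \<open>u = w + A u / r\<close>
      exactly, with \<open>A\<close> the sum of the translates over \<open>S\<close>; the inequality
      results from dropping \<open>w \<ge> 0\<close>.\<close>
    have "(\<lambda>k. v (Suc k) x) \<longlonglongrightarrow> w x + (\<Sum>i\<in>S. u (s i x)) / r"
      unfolding v_Suc using x r by (auto intro!: tendsto_intros lim)
    then have "u x = w x + (\<Sum>i\<in>S. u (s i x)) / r"
      using LIMSEQ_Suc[OF lim[of x]] by (rule LIMSEQ_unique[symmetric])
    then show "(\<Sum>i\<in>S. u (s i x)) \<le> r * u x"
      using r w_nonneg[of x] by (simp add: field_simps)
  qed
qed

section \<open>Means on the Stone-Cech boundary\<close>

abbreviation "linf X \<equiv> carrier (ell_infty X)"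

lemma ell_infty_simps:
  "mult (ell_infty X) f g = (\<lambda>x. f x * g x)" "one (ell_infty X) = indicator X"
  "add (ell_infty X) f g = (\<lambda>x. f x + g x)" "scale (ell_infty X) c f = (\<lambda>x. c * f x)"
  by (simp_all add: ell_infty_def)

lemma ell_inftyI:
  assumes "\<And>x. x \<notin> X \<Longrightarrow> f x = 0" "\<And>x. x \<in> X \<Longrightarrow> cmod (f x) \<le> K"
  shows "f \<in> linf X"
  using assms by (auto simp: ell_infty_def bounded_iff)

lemma ell_infty_zero_outside: "f \<in> linf X \<Longrightarrow> x \<notin> X \<Longrightarrow> f x = 0"
  by (simp add: ell_infty_def)

lemma ell_inftyE:
  assumes "f \<in> linf X"
  obtains K where "0 \<le> K" "\<And>x. cmod (f x) \<le> K"
proof -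
  obtain K where K: "\<And>x. x \<in> X \<Longrightarrow> cmod (f x) \<le> K"
    using assms by (auto simp: ell_infty_def bounded_iff)
  have "cmod (f x) \<le> max 0 K" for x
    using K[of x] assms by (cases "x \<in> X") (auto simp: ell_infty_zero_outside)
  then show ?thesis using that[of "max 0 K"] by simp
qed

lemma ell_infty_add:
  assumes "f \<in> linf X" "g \<in> linf X"
  shows "(\<lambda>x. f x + g x) \<in> linf X"
proof -
  obtain K where K: "\<And>x. cmod (f x) \<le> K" using ell_inftyE[OF assms(1)] by blast
  obtain L where L: "\<And>x. cmod (g x) \<le> L" using ell_inftyE[OF assms(2)] by blast
  show ?thesis
    by (rule ell_inftyI[where K = "K + L"])
       (use assms K L in \<open>auto simp: ell_infty_zero_outside intro: norm_triangle_le add_mono\<close>)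
qed

lemma ell_infty_scale:
  assumes "f \<in> linf X" shows "(\<lambda>x. c * f x) \<in> linf X"
proof -
  obtain K where K: "\<And>x. cmod (f x) \<le> K" using ell_inftyE[OF assms(1)] by blast
  show ?thesis
    by (rule ell_inftyI[where K = "cmod c * K"])
       (use assms K in \<open>auto simp: ell_infty_zero_outside norm_mult mult_left_mono\<close>)
qed

lemma ell_infty_indicator: "A \<subseteq> X \<Longrightarrow> indicator A \<in> linf X"
  by (rule ell_inftyI[where K = 1]) (auto simp: indicator_def)

lemma ell_infty_sum:
  "(\<And>i. i \<in> I \<Longrightarrow> f i \<in> linf X) \<Longrightarrow> (\<lambda>x. \<Sum>i\<in>I. f i x) \<in> linf X"
proof (induction I rule: infinite_finite_induct)
  case (insert i I)
  then show ?case by (simp add: ell_infty_add)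
qed (auto intro: ell_inftyI[where K = 0])

lemma ell_infty_reindex:
  assumes "f \<in> linf X"
  shows "(\<lambda>x. if x \<in> X then f (s x) else 0) \<in> linf X"
proof -
  obtain K where K: "\<And>x. cmod (f x) \<le> K" using ell_inftyE[OF assms(1)] by blast
  then show ?thesis by (intro ell_inftyI[where K = K]) auto
qed

section \<open>Characters of the algebra of bounded functions\<close>

context
  fixes X :: "'x set" and \<omega> :: "'x sc_point"
  assumes char: "\<omega> \<in> characters (ell_infty X)"
begin

lemma character_add: "f \<in> linf X \<Longrightarrow> g \<in> linf X \<Longrightarrow>
    \<omega> (\<lambda>x. f x + g x) = \<omega> f + \<omega> g"
  and character_mult: "f \<in> linf X \<Longrightarrow> g \<in> linf X \<Longrightarrow>
    \<omega> (\<lambda>x. f x * g x) = \<omega> f * \<omega> g"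
  and character_scale: "f \<in> linf X \<Longrightarrow> \<omega> (\<lambda>x. c * f x) = c * \<omega> f"
  and character_one: "\<omega> (indicator X) = 1"
  using char by (auto simp: characters_def ring_hom_def ell_infty_simps)

lemma character_sum: "(\<And>i. i \<in> I \<Longrightarrow> f i \<in> linf X) \<Longrightarrow>
    \<omega> (\<lambda>x. \<Sum>i\<in>I. f i x) = (\<Sum>i\<in>I. \<omega> (f i))"
proof (induction I rule: infinite_finite_induct)
  case (insert i I)
  then show ?case by (simp add: character_add ell_infty_sum)
qed (use character_scale[of "indicator X" 0] ell_infty_indicator[of X X] in simp_all)

text \<open>If \<open>f - z\<close> is bounded away from 0 on \<open>X\<close>, it is invertible in
  \<open>ell_infty X\<close>, and a character cannot vanish on an invertible element. The norm and
  real-part bounds on characters are drawn from this.\<close>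

lemma character_neq:
  assumes f: "f \<in> linf X" and c: "c > 0" "\<And>x. x \<in> X \<Longrightarrow> c \<le> cmod (f x - z)"
  shows "\<omega> f \<noteq> z"
proof
  assume eq: "\<omega> f = z"
  let ?d = "\<lambda>x. f x + (- z) * indicator X x"
  let ?k = "\<lambda>x. if x \<in> X then inverse (f x - z) else 0"
  have d: "?d \<in> linf X"
    by (intro ell_infty_add f ell_infty_scale ell_infty_indicator) simp
  have k: "?k \<in> linf X"
  proof (rule ell_inftyI[where K = "inverse c"])
    fix x assume "x \<in> X"
    then show "cmod (?k x) \<le> inverse c" using c by (simp add: norm_inverse le_imp_inverse_le)
  qed auto
  have "f x - z \<noteq> 0" if "x \<in> X" for x using c(1) c(2)[OF that] by auto
  then have "(\<lambda>x. ?d x * ?k x) = indicator X" by (auto simp: indicator_def fun_eq_iff)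
  then have "\<omega> ?d * \<omega> ?k = 1" using character_mult[OF d k] character_one by simp
  moreover have "\<omega> ?d = \<omega> f + (- z) * \<omega> (indicator X)"
    using character_add[OF f ell_infty_scale[OF ell_infty_indicator[OF order_refl]]]
      character_scale[OF ell_infty_indicator[OF order_refl]] by metis
  ultimately show False using eq character_one by simp
qed

text \<open>Otherwise \<open>f\<close> would stay at distance at least
  \<open>cmod (\<omega> f) - K > 0\<close> from the value \<open>\<omega> f\<close>, which
  \<open>character_neq\<close> excludes. Neither continuity nor compatibility with conjugation is
  built into \<open>characters\<close>, so such bounds have to be derived.\<close>

lemma character_norm_le:
  assumes f: "f \<in> linf X" and "\<And>x. x \<in> X \<Longrightarrow> cmod (f x) \<le> K"
  shows "cmod (\<omega> f) \<le> K"
proof (rule ccontr)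
  assume "\<not> cmod (\<omega> f) \<le> K"
  then have "cmod (\<omega> f) - K > 0" by simp
  moreover have "cmod (\<omega> f) - K \<le> cmod (f x - \<omega> f)" if "x \<in> X" for x
    using assms(2)[OF that] norm_triangle_ineq2[of "\<omega> f" "f x"] norm_minus_commute[of "\<omega> f" "f x"]
    by linarith
  ultimately show False using character_neq[OF f] by blast
qed

lemma character_Re_le:
  assumes f: "f \<in> linf X" and "\<And>x. x \<in> X \<Longrightarrow> Re (f x) \<le> K"
  shows "Re (\<omega> f) \<le> K"
proof (rule ccontr)
  assume "\<not> Re (\<omega> f) \<le> K"
  then have "Re (\<omega> f) - K > 0" by simp
  moreover have "Re (\<omega> f) - K \<le> cmod (f x - \<omega> f)" if "x \<in> X" for x
    using assms(2)[OF that] abs_Re_le_cmod[of "f x - \<omega> f"] by simp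
  ultimately show False using character_neq[OF f] by blast
qed

end

text \<open>Multiplying by \<open>indicator {x}\<close> turns \<open>f\<close> into the constant
  \<open>f x\<close> times that indicator. Applying \<open>\<omega>\<close> to both forms, the
  factor \<open>\<omega> (indicator {x})\<close> cancels.\<close>

lemma point_evaluation_eq_if_indicator:
  assumes \<omega>: "\<omega> \<in> characters (ell_infty X)" and x: "x \<in> X" and "\<omega> (indicator {x}) \<noteq> 0"
  shows "\<omega> = point_evaluation X x"
proof (rule extensionalityI[of _ "linf X"])
  show "\<omega> \<in> extensional (linf X)" using \<omega> by (simp add: characters_def)
  show "point_evaluation X x \<in> extensional (linf X)" by (simp add: point_evaluation_def)
  fix f assume f: "f \<in> linf X"
  have i: "indicator {x} \<in> linf X" using x by (intro ell_infty_indicator) simp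
  have "(\<lambda>y. f y * indicator {x} y) = (\<lambda>y. f x * indicator {x} y)"
    by (auto simp: indicator_def)
  then have "\<omega> f * \<omega> (indicator {x}) = f x * \<omega> (indicator {x})"
    using character_mult[OF \<omega> f i] character_scale[OF \<omega> i, of "f x"] by (simp only:)
  then have "\<omega> f = f x" using assms(3) by (metis mult_right_cancel)
  then show "\<omega> f = point_evaluation X x f" using f by (simp add: point_evaluation_def)
qed

section \<open>Boundary characters and their transport by permutations\<close>

lemma topspace_gelfand_spectrum: "topspace (gelfand_spectrum A) = characters A"
  by (auto simp: gelfand_spectrum_def characters_def PiE_def)

text \<open>Turns the removal of point evaluations into an algebraic condition, the form in which
  membership in the boundary is used afterwards.\<close>

lemma boundary_iff:
  "\<omega> \<in> topspace (stone_cech_boundary X) \<longleftrightarrow>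
    \<omega> \<in> characters (ell_infty X) \<and> (\<forall>x\<in>X. \<omega> (indicator {x}) = 0)"
proof -
  have "point_evaluation X x (indicator {x}) = 1" if "x \<in> X" for x
    using that ell_infty_indicator[of "{x}" X] by (simp add: point_evaluation_def)
  then have "\<omega> \<in> point_evaluation X ` X \<longleftrightarrow> (\<exists>x\<in>X. \<omega> (indicator {x}) \<noteq> 0)"
    if "\<omega> \<in> characters (ell_infty X)"
    using point_evaluation_eq_if_indicator[OF that] by (metis image_iff zero_neq_one)
  then show ?thesis
    by (auto simp: stone_cech_boundary_def stone_cech_def topspace_gelfand_spectrum)
qed

lemma boundary_vanishes:
  assumes \<omega>: "\<omega> \<in> topspace (stone_cech_boundary X)" and E: "finite E" "E \<subseteq> X"
    and f: "f \<in> linf X" "\<And>x. x \<notin> E \<Longrightarrow> f x = 0"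
  shows "\<omega> f = 0"
proof -
  have char: "\<omega> \<in> characters (ell_infty X)" and zero: "\<And>x. x \<in> X \<Longrightarrow> \<omega> (indicator {x}) = 0"
    using \<omega> by (auto simp: boundary_iff)
  have i: "indicator {x} \<in> linf X" if "x \<in> E" for x
    using that E by (intro ell_infty_indicator) auto
  have "f = (\<lambda>y. \<Sum>x\<in>E. f x * indicator {x} y)"
  proof
    fix y
    have "(\<Sum>x\<in>E. f x * indicator {x} y) = (\<Sum>x\<in>E. if x = y then f x else 0)"
      by (intro sum.cong) (auto simp: indicator_def)
    then show "f y = (\<Sum>x\<in>E. f x * indicator {x} y)"
      using E(1) f(2)[of y] by (simp add: sum.delta)
  qed
  then have "\<omega> f = (\<Sum>x\<in>E. \<omega> (\<lambda>y. f x * indicator {x} y))"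
    using character_sum[OF char, of E "\<lambda>x y. f x * indicator {x} y"] i by (simp add: ell_infty_scale)
  also have "\<dots> = 0"
    using character_scale[OF char i] zero E by (intro sum.neutral) auto
  finally show ?thesis .
qed

text \<open>On \<open>E\<close> the function may be replaced by the constant \<open>K\<close>
  without altering \<open>\<omega> f\<close>, since boundary characters annihilate functions of
  finite support. Estimates are thus required only off a finite set.\<close>

lemma boundary_Re_le:
  assumes \<omega>: "\<omega> \<in> topspace (stone_cech_boundary X)" and E: "finite E" "E \<subseteq> X"
    and f: "f \<in> linf X" and le: "\<And>x. x \<in> X - E \<Longrightarrow> Re (f x) \<le> K"
  shows "Re (\<omega> f) \<le> K"
proof -
  have char: "\<omega> \<in> characters (ell_infty X)" using \<omega> by (simp add: boundary_iff)
  let ?d = "\<lambda>x. if x \<in> E then of_real K - f x else 0"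
  obtain L where L: "\<And>x. cmod (f x) \<le> L" using ell_inftyE[OF f] by blast
  have d: "?d \<in> linf X"
  proof (rule ell_inftyI[where K = "\<bar>K\<bar> + L"])
    fix x
    have "0 \<le> L" using L[of x] norm_ge_zero order.trans by blast
    then show "cmod (?d x) \<le> \<bar>K\<bar> + L"
      using norm_triangle_ineq4[of "complex_of_real K" "f x"] L[of x] by auto
  qed (use E in auto)
  have "Re (\<omega> (\<lambda>x. f x + ?d x)) \<le> K"
    using le by (intro character_Re_le[OF char] ell_infty_add f d) auto
  then show ?thesis
    using character_add[OF char f d] boundary_vanishes[OF \<omega> E d] by simp
qed

text \<open>Precomposition with \<open>s\<close> is a unital endomorphism of
  \<open>ell_infty X\<close> and sends \<open>indicator {x}\<close> to the indicator of the preimage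
  point, so point indicators are still annihilated.\<close>

lemma stone_cech_extension_boundary:
  assumes s: "bij_betw s X X" and \<omega>: "\<omega> \<in> topspace (stone_cech_boundary X)"
  shows "stone_cech_extension X s \<omega> \<in> topspace (stone_cech_boundary X)"
proof -
  have char: "\<omega> \<in> characters (ell_infty X)" and zero: "\<And>x. x \<in> X \<Longrightarrow> \<omega> (indicator {x}) = 0"
    using \<omega> by (auto simp: boundary_iff)
  let ?r = "\<lambda>f x. if x \<in> X then f (s x) else (0::complex)"
  note r = ell_infty_reindex[of _ X s]
  have closed: "mult (ell_infty X) f g \<in> linf X"
    if f: "f \<in> linf X" and g: "g \<in> linf X" for f g
  proof -
    obtain K where K: "0 \<le> K" "\<And>x. cmod (f x) \<le> K" using ell_inftyE[OF f] by blast
    obtain L where L: "0 \<le> L" "\<And>x. cmod (g x) \<le> L" using ell_inftyE[OF g] by blast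
    show ?thesis unfolding ell_infty_simps
      by (rule ell_inftyI[where K = "K * L"])
         (use f K L in \<open>auto simp: ell_infty_zero_outside norm_mult intro: mult_mono\<close>)
  qed
  have "?r (indicator X) = indicator X"
    using s by (auto simp: indicator_def bij_betw_def fun_eq_iff)
  moreover have "?r (\<lambda>x. f x + g x) = (\<lambda>x. ?r f x + ?r g x)" "?r (\<lambda>x. f x * g x) = (\<lambda>x. ?r f x * ?r g x)"
    "?r (\<lambda>x. c * f x) = (\<lambda>x. c * ?r f x)" for f g c by auto
  ultimately have "stone_cech_extension X s \<omega> \<in> characters (ell_infty X)"
    using closed ell_infty_add[of _ X] ell_infty_scale[of _ X] ell_infty_indicator[of X X]
    unfolding characters_def ring_hom_def stone_cech_extension_def
    by (simp add: ell_infty_simps character_add[OF char] character_mult[OF char]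
        character_scale[OF char] character_one[OF char] r)
  moreover have "stone_cech_extension X s \<omega> (indicator {x}) = 0" if x: "x \<in> X" for x
  proof -
    have "x \<in> s ` X" using s x by (simp add: bij_betw_def)
    then obtain y where y: "y \<in> X" "s y = x" by (elim imageE) simp
    have "s z = x \<longleftrightarrow> z = y" if "z \<in> X" for z
      using s y that by (auto simp: bij_betw_def inj_on_def)
    then have "?r (indicator {x}) = indicator {y}"
      using y by (auto simp: indicator_def fun_eq_iff)
    then show ?thesis
      using zero[OF y(1)] ell_infty_indicator[of "{x}" X] x by (simp add: stone_cech_extension_def)
  qed
  ultimately show ?thesis by (simp add: boundary_iff)
qed

text \<open>The composite evaluates \<open>\<omega>\<close> at \<open>f (t (s x))\<close> as a
  function of \<open>x\<close>, so the identity required is \<open>t (s x) = x\<close>; it follows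
  from the assumed \<open>s (t x) = x\<close> by injectivity of \<open>s\<close>.\<close>

lemma stone_cech_extension_inverse:
  assumes "bij_betw s X X" "\<And>x. x \<in> X \<Longrightarrow> t x \<in> X" "\<And>x. x \<in> X \<Longrightarrow> s (t x) = x"
    and \<omega>: "\<omega> \<in> topspace (stone_cech_boundary X)"
  shows "stone_cech_extension X t (stone_cech_extension X s \<omega>) = \<omega>"
proof -
  have char: "\<omega> \<in> characters (ell_infty X)" using \<omega> by (simp add: boundary_iff)
  have sX: "s x \<in> X" if "x \<in> X" for x using assms(1) that by (auto simp: bij_betw_def)
  have "inj_on s X" using assms(1) by (simp add: bij_betw_def)
  from inj_onD[OF this] have inv: "t (s x) = x" if "x \<in> X" for x
    using assms(2,3)[OF sX[OF that]] that by blast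
  have "(\<lambda>x. if x \<in> X then if s x \<in> X then f (t (s x)) else 0 else 0) = f"
    if "f \<in> linf X" for f :: "'a \<Rightarrow> complex"
    using that inv sX by (auto simp: fun_eq_iff ell_infty_zero_outside)
  then show ?thesis
    using char ell_infty_reindex[of _ X t] unfolding characters_def
    by (intro extensionalityI[of _ "linf X"]) (auto simp: stone_cech_extension_def)
qed

lemma boundary_evaluation_continuous:
  assumes "f \<in> linf X"
  shows "continuous_map (stone_cech_boundary X) euclidean (\<lambda>\<omega>. \<omega> f)"
  unfolding stone_cech_boundary_def stone_cech_def gelfand_spectrum_def
  by (intro continuous_map_from_subtopology continuous_map_product_projection assms)

lemma stone_cech_extension_continuous:
  assumes s: "bij_betw s X X"
  shows "continuous_map (stone_cech_boundary X) (stone_cech_boundary X) (stone_cech_extension X s)"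
proof -
  have "continuous_map (stone_cech_boundary X) (product_topology (\<lambda>a. euclidean) (linf X))
      (stone_cech_extension X s)"
    unfolding continuous_map_componentwise
  proof (intro conjI ballI)
    fix f assume f: "f \<in> linf X"
    show "continuous_map (stone_cech_boundary X) euclidean (\<lambda>\<omega>. stone_cech_extension X s \<omega> f)"
      using boundary_evaluation_continuous[OF ell_infty_reindex[OF f, of s]] f
      by (simp add: stone_cech_extension_def)
  qed (auto simp: stone_cech_extension_def)
  then show ?thesis
    unfolding stone_cech_boundary_def stone_cech_def gelfand_spectrum_def continuous_map_in_subtopology
    using stone_cech_extension_boundary[OF s]
    by (auto simp: stone_cech_boundary_def stone_cech_def gelfand_spectrum_def)
qed

section \<open>Integration against a boundary measure\<close>

context
  fixes X :: "'x set" and M :: "'x sc_point measure"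
  assumes M: "regular_borel_probability (stone_cech_boundary X) M"
begin

lemma boundary_open_sets_Pow:
  "{U. openin (stone_cech_boundary X) U} \<subseteq> Pow (topspace (stone_cech_boundary X))"
  using openin_subset by blast

lemma boundary_measure_sets:
  "sets M = sigma_sets (topspace (stone_cech_boundary X)) {U. openin (stone_cech_boundary X) U}"
  using M sets_measure_of[OF boundary_open_sets_Pow] unfolding regular_borel_probability_def by metis

lemma boundary_measure_space: "space M = topspace (stone_cech_boundary X)"
proof -
  have "sets M = sets (sigma (topspace (stone_cech_boundary X)) {U. openin (stone_cech_boundary X) U})"
    using M unfolding regular_borel_probability_def by blast
  from sets_eq_imp_space_eq[OF this] show ?thesis
    by (simp only: space_measure_of[OF boundary_open_sets_Pow])
qed

lemma boundary_open_measurable: "openin (stone_cech_boundary X) U \<Longrightarrow> U \<in> sets M"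
  unfolding boundary_measure_sets by (rule sigma_sets.Basic) simp

lemma boundary_evaluation_measurable:
  assumes f: "f \<in> linf X" shows "(\<lambda>\<omega>. Re (\<omega> f)) \<in> borel_measurable M"
proof (rule borel_measurableI)
  fix S :: "real set" assume "open S"
  have "continuous_map (stone_cech_boundary X) euclidean (Re \<circ> (\<lambda>\<omega>. \<omega> f))"
    by (rule continuous_map_compose[OF boundary_evaluation_continuous[OF f]])
       (simp add: continuous_on_Re)
  then have "openin (stone_cech_boundary X) {\<omega> \<in> topspace (stone_cech_boundary X). Re (\<omega> f) \<in> S}"
    using openin_continuous_map_preimage[of "stone_cech_boundary X" euclidean "Re \<circ> (\<lambda>\<omega>. \<omega> f)" S] \<open>open S\<close>
    by simp
  moreover have "(\<lambda>\<omega>. Re (\<omega> f)) -` S \<inter> space M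
      = {\<omega> \<in> topspace (stone_cech_boundary X). Re (\<omega> f) \<in> S}"
    by (auto simp: boundary_measure_space)
  ultimately show "(\<lambda>\<omega>. Re (\<omega> f)) -` S \<inter> space M \<in> sets M"
    by (simp add: boundary_open_measurable)
qed

lemma boundary_evaluation_integrable:
  assumes f: "f \<in> linf X" shows "integrable M (\<lambda>\<omega>. Re (\<omega> f))"
proof -
  interpret prob_space M using M by (simp add: regular_borel_probability_def)
  obtain K where K: "\<And>x. cmod (f x) \<le> K" using ell_inftyE[OF f] by blast
  show ?thesis
  proof (rule integrable_const_bound[where B = K])
    show "AE \<omega> in M. norm (Re (\<omega> f)) \<le> K"
    proof (rule AE_I2)
      fix \<omega> assume "\<omega> \<in> space M"
      then have "\<omega> \<in> characters (ell_infty X)" by (simp add: boundary_measure_space boundary_iff)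
      from character_norm_le[OF this f K] have "cmod (\<omega> f) \<le> K" .
      then show "norm (Re (\<omega> f)) \<le> K" using abs_Re_le_cmod[of "\<omega> f"] by simp
    qed
  qed (rule boundary_evaluation_measurable[OF f])
qed

lemma stone_cech_extension_measurable:
  assumes s: "bij_betw s X X" shows "stone_cech_extension X s \<in> measurable M M"
proof (rule measurable_sigma_sets[OF boundary_measure_sets boundary_open_sets_Pow])
  show "stone_cech_extension X s \<in> space M \<rightarrow> topspace (stone_cech_boundary X)"
    using stone_cech_extension_boundary[OF s] by (auto simp: boundary_measure_space)
  fix U assume "U \<in> {U. openin (stone_cech_boundary X) U}"
  then have "openin (stone_cech_boundary X)
      {\<omega> \<in> topspace (stone_cech_boundary X). stone_cech_extension X s \<omega> \<in> U}"
    using openin_continuous_map_preimage[OF stone_cech_extension_continuous[OF s]] by blast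
  moreover have "stone_cech_extension X s -` U \<inter> space M
      = {\<omega> \<in> topspace (stone_cech_boundary X). stone_cech_extension X s \<omega> \<in> U}"
    by (auto simp: boundary_measure_space)
  ultimately show "stone_cech_extension X s -` U \<inter> space M \<in> sets M"
    by (simp add: boundary_open_measurable)
qed

text \<open>Invariance is given for images of sets, while integration needs preimages: the preimage
  under the extension of \<open>s\<close> is the image under the extension of its inverse
  \<open>t\<close>. Hence \<open>M\<close> is its own push-forward, and a change of variables
  finishes.\<close>

lemma boundary_integral_invariant:
  assumes s: "bij_betw s X X" and t: "bij_betw t X X"
    and st: "\<And>x. x \<in> X \<Longrightarrow> s (t x) = x" "\<And>x. x \<in> X \<Longrightarrow> t (s x) = x"
    and inv: "\<And>A. A \<in> sets M \<Longrightarrow> emeasure M (stone_cech_extension X t ` A) = emeasure M A"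
    and f: "f \<in> linf X"
  shows "(\<integral>\<omega>. Re (\<omega> (\<lambda>x. if x \<in> X then f (s x) else 0)) \<partial>M) = (\<integral>\<omega>. Re (\<omega> f) \<partial>M)"
proof -
  let ?\<theta> = "stone_cech_extension X s" and ?\<theta>' = "stone_cech_extension X t"
  have sX: "s x \<in> X" and tX: "t x \<in> X" if "x \<in> X" for x
    using s t that by (auto simp: bij_betw_def)
  have "distr M M ?\<theta> = M"
  proof (rule measure_eqI)
    fix A assume "A \<in> sets (distr M M ?\<theta>)"
    then have A: "A \<in> sets M" by simp
    then have AX: "A \<subseteq> topspace (stone_cech_boundary X)"
      using sets.sets_into_space boundary_measure_space by blast
    have "?\<theta> -` A \<inter> space M = ?\<theta>' ` A"
    proof (intro equalityI subsetI)
      fix \<omega> assume "\<omega> \<in> ?\<theta> -` A \<inter> space M"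
      then show "\<omega> \<in> ?\<theta>' ` A"
        using stone_cech_extension_inverse[OF s tX st(1), of \<omega>]
        by (intro image_eqI[where x = "?\<theta> \<omega>"]) (auto simp: boundary_measure_space)
    next
      fix \<omega> assume "\<omega> \<in> ?\<theta>' ` A"
      then obtain \<nu> where \<nu>: "\<nu> \<in> A" "\<omega> = ?\<theta>' \<nu>" by blast
      then show "\<omega> \<in> ?\<theta> -` A \<inter> space M"
        using stone_cech_extension_inverse[OF t sX st(2), of \<nu>] AX
          stone_cech_extension_boundary[OF t, of \<nu>]
        by (auto simp: boundary_measure_space)
    qed
    then show "emeasure (distr M M ?\<theta>) A = emeasure M A"
      using A inv[OF A] by (simp add: emeasure_distr stone_cech_extension_measurable[OF s])
  qed simp
  then have "(\<integral>\<omega>. Re (\<omega> f) \<partial>M) = (\<integral>\<omega>. Re (\<omega> f) \<partial>distr M M ?\<theta>)" by simp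
  also have "\<dots> = (\<integral>\<omega>. Re (?\<theta> \<omega> f) \<partial>M)"
    by (rule integral_distr[OF stone_cech_extension_measurable[OF s] boundary_evaluation_measurable[OF f]])
  finally show ?thesis using f by (simp add: stone_cech_extension_def)
qed

end

section \<open>The trivial representation\<close>

context discrete_group
begin

text \<open>Elements of both algebras are functions on the ambient type, so the inclusion is the
  identity. What needs an argument is that products and stars formed in \<open>G\<close> vanish off
  \<open>\<Lambda>\<close>; this is closure of the subgroup under its operations.\<close>

lemma group_algebra_subgroup:
  assumes \<Lambda>: "subgroup \<Lambda> G"
  defines "H \<equiv> G\<lparr>carrier := \<Lambda>\<rparr>"
  shows "(\<lambda>a. a) \<in> star_hom (group_algebra H) GA"
proof -
  interpret \<Lambda>: subgroup \<Lambda> G by (rule \<Lambda>)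
  have carr: "a \<in> carrier (group_algebra H) \<longleftrightarrow> finite {g. a g \<noteq> 0} \<and> {g. a g \<noteq> 0} \<subseteq> \<Lambda>" for a
    by (simp add: group_algebra_carrier_iff H_def)
  have inv: "inv\<^bsub>H\<^esub> g = inv g" if "g \<in> \<Lambda>" for g
    unfolding H_def by (rule m_inv_consistent[OF \<Lambda> that])
  have mult: "mult (group_algebra H) a b = mult GA a b"
    if a: "a \<in> carrier (group_algebra H)" and b: "b \<in> carrier (group_algebra H)" for a b
  proof
    fix g
    have sub: "{h. a h \<noteq> 0} \<subseteq> \<Lambda>" "{h. b h \<noteq> 0} \<subseteq> \<Lambda>" using a b by (auto simp: carr)
    then have S: "{h \<in> \<Lambda>. a h \<noteq> 0} = {h \<in> carrier G. a h \<noteq> 0}"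
      using \<Lambda>.subset by auto
    show "mult (group_algebra H) a b g = mult GA a b g"
    proof (cases "g \<in> \<Lambda>")
      case True
      have "(\<Sum>h\<in>{h \<in> \<Lambda>. a h \<noteq> 0}. a h * b (inv\<^bsub>H\<^esub> h \<otimes> g))
          = (\<Sum>h\<in>{h \<in> \<Lambda>. a h \<noteq> 0}. a h * b (inv h \<otimes> g))"
        by (intro sum.cong) (auto simp: inv)
      then show ?thesis using True \<Lambda>.mem_carrier[OF True] S by (simp add: group_algebra_def H_def)
    next
      case False
      have "b (inv h \<otimes> g) = 0" if "h \<in> carrier G" "a h \<noteq> 0" "g \<in> carrier G" for h
      proof (rule ccontr)
        assume "b (inv h \<otimes> g) \<noteq> 0"
        then have "inv h \<otimes> g \<in> \<Lambda>" "h \<in> \<Lambda>" using sub that by auto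
        then have "h \<otimes> (inv h \<otimes> g) \<in> \<Lambda>" by simp
        then show False using that False by (simp add: m_assoc[symmetric])
      qed
      then have "(\<Sum>h\<in>{h \<in> carrier G. a h \<noteq> 0}. a h * b (inv h \<otimes> g)) = 0" if "g \<in> carrier G"
        using that by (intro sum.neutral) auto
      then show ?thesis using False by (simp add: group_algebra_def H_def)
    qed
  qed
  have star: "star (group_algebra H) a = star GA a" if a: "a \<in> carrier (group_algebra H)" for a
  proof
    fix g
    have sub: "{h. a h \<noteq> 0} \<subseteq> \<Lambda>" using a by (auto simp: carr)
    show "star (group_algebra H) a g = star GA a g"
    proof (cases "g \<in> \<Lambda>")
      case True
      then show ?thesis using \<Lambda>.mem_carrier[OF True] inv[OF True] by (simp add: group_algebra_simps H_def)
    next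
      case False
      have "a (inv g) = 0" if "g \<in> carrier G"
      proof (rule ccontr)
        assume "a (inv g) \<noteq> 0"
        then have "inv (inv g) \<in> \<Lambda>" using sub by auto
        then show False using that False by simp
      qed
      then show ?thesis using False by (simp add: group_algebra_simps H_def)
    qed
  qed
  show ?thesis
    unfolding star_hom_def ring_hom_def
    using mult star \<Lambda>.subset
    by (auto simp: carr group_algebra_carrier_iff) (auto simp: group_algebra_simps H_def)
qed

end

context discrete_group_action
begin

text \<open>The element is supported in \<open>\<Lambda>\<close> because only there is invariance of
  the measure available; the operator estimates are carried out over \<open>G\<close>.\<close>

lemma trivial_le_if_invariant_measure:
  assumes "countable X" and norm: "cstar_norm GA \<tau>"
    and cont: "tau_continuous G \<tau> (calkin_algebra X) (calkin_rep G X \<alpha>)"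
    and \<Lambda>: "subgroup \<Lambda> G" and fixes_measure: "fixes_boundary_probability \<Lambda> X \<alpha>"
    and a: "a \<in> carrier (group_algebra (G\<lparr>carrier := \<Lambda>\<rparr>))"
  shows "cmod (triv.L a) \<le> \<tau> a"
proof (rule ccontr)
  assume "\<not> cmod (triv.L a) \<le> \<tau> a"
  then have lt: "\<tau> a < cmod (triv.L a)" by simp
  define H where "H = G\<lparr>carrier := \<Lambda>\<rparr>"
  interpret \<Lambda>: subgroup \<Lambda> G by (rule \<Lambda>)
  interpret H: discrete_group H
    unfolding H_def by (intro discrete_group.intro \<Lambda>.subgroup_is_group group_axioms)
  have semi: "cstar_seminorm GA \<tau>" using norm by (simp add: cstar_norm_def)
  interpret T: cstar_seminormed_algebra GA \<tau> by unfold_locales (rule semi)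
  have incl: "(\<lambda>a. a) \<in> star_hom H.GA GA" unfolding H_def by (rule group_algebra_subgroup[OF \<Lambda>])
  have aH: "a \<in> carrier H.GA" using a by (simp add: H_def)
  then have aG: "a \<in> carrier GA" using incl by (auto simp: star_hom_def ring_hom_def)

  \<comment> \<open>Any \<open>t\<close> strictly between the two squares would do: dividing
    \<open>a* a\<close> by it puts \<open>\<tau> z\<close> below 1 and the trivial value of
    \<open>z\<close> above 1.\<close>
  define t where "t = ((\<tau> a)\<^sup>2 + (cmod (triv.L a))\<^sup>2) / 2"
  have sq: "(\<tau> a)\<^sup>2 < (cmod (triv.L a))\<^sup>2" using lt aG by (intro power_strict_mono) auto
  then have t: "(\<tau> a)\<^sup>2 < t" "t < (cmod (triv.L a))\<^sup>2" by (auto simp: t_def)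
  have t0: "0 < t" using t(1) zero_le_power2[of "\<tau> a"] by linarith
  define z where "z = scale GA (of_real (1 / t)) (mult GA (star GA a) a)"
  have zG: "z \<in> carrier GA" using aG by (simp add: z_def)
  \<comment> \<open>\<open>z\<close> is recomputed inside the algebra of \<open>\<Lambda>\<close> to
    see that its support lies in \<open>\<Lambda>\<close>.\<close>
  have "star H.GA a = star GA a" "mult H.GA (star H.GA a) a = mult GA (star H.GA a) a"
    "scale H.GA c (mult H.GA (star H.GA a) a) = scale GA c (mult H.GA (star H.GA a) a)" for c
    using incl aH H.GA.star_closed[OF aH] H.GA.m_closed[OF H.GA.star_closed[OF aH] aH]
    unfolding star_hom_def ring_hom_def by blast+
  then have "z = scale H.GA (of_real (1 / t)) (mult H.GA (star H.GA a) a)"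
    by (simp add: z_def)
  then have zH: "z \<in> carrier H.GA" using aH by simp
  have z_star: "star GA z = z" using aG by (simp add: z_def GA.star_scale GA.star_mult)
  have "\<tau> z = (\<tau> a)\<^sup>2 / t" using aG t0 by (simp add: z_def T.p_scale T.p_star_mult norm_divide)
  then have z_norm: "\<tau> z < 1" using t t0 by simp
  define q where "q = (cmod (triv.L a))\<^sup>2 / t"
  \<comment> \<open>The trivial value of \<open>z\<close> exceeds 1 by \<open>2 * e\<close>: one
    \<open>e\<close> absorbs the compact error, the other remains as the gap.\<close>
  define e where "e = (q - 1) / 2"
  have "1 < q" using t t0 by (simp add: q_def)
  then have e: "0 < e" and q_eq: "q = 1 + 2 * e" by (simp_all add: e_def field_simps)
  define S where "S = {g. z g \<noteq> 0}"
  have fin: "finite S" and S_\<Lambda>: "S \<subseteq> \<Lambda>" using zH by (auto simp: S_def group_algebra_carrier_iff H_def)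
  then have S_G: "S \<subseteq> carrier G" using \<Lambda>.subset by blast
  have "triv.L z = of_real (1 / t) * (cnj (triv.L a) * triv.L a)"
    using aG by (simp add: z_def triv.linear_extension_scale triv.linear_extension_mult
        triv.linear_extension_star)
  also have "\<dots> = of_real ((cmod (triv.L a))\<^sup>2 / t)"
    using complex_norm_square[of "triv.L a"] by (simp add: mult.commute)
  also have "(cmod (triv.L a))\<^sup>2 / t = 1 + 2 * e" using q_eq by (simp only: q_def)
  finally have eps_z: "(\<Sum>g\<in>S. z g) = of_real (1 + 2 * e)"
    using fin by (simp add: linear_extension_complex S_def)
  \<comment> \<open>Self-adjointness of \<open>z\<close> makes its support symmetric; both the
    boundedness of the increments and the cancellation of their means rest on this.\<close>
  have S_inv: "inv g \<in> S" if "g \<in> S" for g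
  proof -
    have "z g = cnj (z (inv g))"
      using fun_cong[OF z_star, of g] that S_G by (auto simp: group_algebra_simps)
    then show ?thesis using that by (auto simp: S_def)
  qed
  have S_bij: "bij_betw (m_inv G) S S"
    using S_inv S_G by (intro bij_betw_byWitness[where f' = "m_inv G"]) auto
  define C where "C = (\<Sum>g\<in>S. cmod (z g))"
  have C: "1 + 2 * e \<le> C"
    using norm_sum[of z S] eps_z e unfolding C_def by (simp only: norm_of_real)
  have C0: "0 < C" using C e by simp
  define N where "N = real (card S)"

  obtain F where F: "finite F" "F \<subseteq> X" and form: "\<And>f. f \<in> ell2 X \<Longrightarrow> (\<And>x. x \<in> F \<Longrightarrow> f x = 0) \<Longrightarrow>
      Re (\<Sum>g | z g \<noteq> 0. z g * ell2_inner X (\<pi> g f) f) \<le> (1 + e) * (ell2_norm X f)\<^sup>2"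
    using calkin_form_bound[OF norm cont zG z_star z_norm e] by blast
  define Y where "Y = X - F"
  have YX: "Y \<subseteq> X" by (auto simp: Y_def)
  \<comment> \<open>For real \<open>f\<close> each correlation \<open>c g\<close> is real and at
    most \<open>n = ||f||^2\<close> by Cauchy-Schwarz. The gap reads
    \<open>e * n \<le> (\<Sum>g\<in>S. Re (z g) * (n - c g))\<close>, and since
    \<open>n - c g \<ge> 0\<close> every coefficient may be raised to \<open>C\<close>, which leaves
    an unweighted sum.\<close>
  have real_form: "(\<Sum>g\<in>S. \<Sum>\<^sub>\<infinity>x\<in>X. f (\<alpha> g x) * f x) \<le> (N - e / C) * (\<Sum>\<^sub>\<infinity>x\<in>X. (f x)\<^sup>2)"
    if nonneg: "\<And>x. 0 \<le> f x" and off: "\<And>x. x \<notin> Y \<Longrightarrow> f x = 0"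
      and f: "(\<lambda>x. complex_of_real (f x)) \<in> ell2 X" for f :: "'x \<Rightarrow> real"
  proof -
    let ?f = "\<lambda>x. complex_of_real (f x)"
    define c where "c = (\<lambda>g. \<Sum>\<^sub>\<infinity>x\<in>X. f (\<alpha> (inv g) x) * f x)"
    define n where "n = (ell2_norm X ?f)\<^sup>2"
    have inner: "ell2_inner X (\<pi> g ?f) ?f = of_real (c g)" "c g \<le> n" if g: "g \<in> S" for g
    proof -
      have gG: "g \<in> carrier G" using g S_G by blast
      let ?g = "\<lambda>x. if x \<in> X then f (\<alpha> (inv g) x) else 0"
      have eq: "\<pi> g ?f = (\<lambda>x. complex_of_real (?g x))"
        using permutation_rep_apply[OF f] by (auto simp: fun_eq_iff)
      have gl: "(\<lambda>x. complex_of_real (?g x)) \<in> ell2 X"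
        using bounded_operator_closed[OF permutation_rep_bounded[OF gG] f] eq by simp
      have "ell2_norm X (\<lambda>x. complex_of_real (?g x)) = ell2_norm X ?f"
        using ell2_action(2)[OF inv_closed[OF gG] f] permutation_rep_apply[OF f, of g] eq by simp
      moreover have sum: "(\<lambda>x. ?g x * f x) summable_on X"
        and "(\<Sum>\<^sub>\<infinity>x\<in>X. ?g x * f x) \<le> ell2_norm X (\<lambda>x. complex_of_real (?g x)) * ell2_norm X ?f"
        using ell2_of_real_mult[OF gl f] nonneg by auto
      moreover have cg: "c g = (\<Sum>\<^sub>\<infinity>x\<in>X. ?g x * f x)"
        unfolding c_def by (rule infsum_cong) simp
      ultimately show "c g \<le> n" by (simp add: n_def power2_eq_square)
      have "((\<lambda>x. complex_of_real (?g x * f x)) has_sum of_real (c g)) X"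
        unfolding cg by (intro has_sum_of_real has_sum_infsum sum)
      then show "ell2_inner X (\<pi> g ?f) ?f = of_real (c g)"
        unfolding ell2_inner_def eq by (simp add: infsumI)
    qed
    have "Re (\<Sum>g\<in>S. z g * ell2_inner X (\<pi> g ?f) ?f) \<le> (1 + e) * n"
      unfolding n_def S_def by (rule form[OF f]) (use off in \<open>auto simp: Y_def\<close>)
    moreover have "Re (\<Sum>g\<in>S. z g * ell2_inner X (\<pi> g ?f) ?f) = (\<Sum>g\<in>S. Re (z g) * c g)"
      using inner(1) by simp
    moreover have "(\<Sum>g\<in>S. Re (z g) * n) = (1 + 2 * e) * n"
      using arg_cong[OF eps_z, of Re] by (simp add: sum_distrib_right[symmetric])
    ultimately have "e * n \<le> (\<Sum>g\<in>S. Re (z g) * n) - (\<Sum>g\<in>S. Re (z g) * c g)"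
      by (simp add: algebra_simps)
    also have "\<dots> = (\<Sum>g\<in>S. Re (z g) * (n - c g))" by (simp add: right_diff_distrib sum_subtractf)
    also have "\<dots> \<le> (\<Sum>g\<in>S. C * (n - c g))"
    proof (intro sum_mono mult_right_mono)
      fix g assume g: "g \<in> S"
      show "Re (z g) \<le> C"
        using complex_Re_le_cmod[of "z g"] member_le_sum[OF g, of "\<lambda>g. cmod (z g)"] fin
        by (simp add: C_def)
      show "0 \<le> n - c g" using inner(2)[OF g] by simp
    qed
    also have "\<dots> = C * (N * n - (\<Sum>g\<in>S. c g))"
      by (simp add: sum_distrib_left[symmetric] sum_subtractf N_def)
    finally have "(\<Sum>g\<in>S. c g) \<le> (N - e / C) * n" using C0 by (simp add: field_simps)
    \<comment> \<open>Symmetry of \<open>S\<close> converts translation by \<open>inv g\<close>, as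
      it occurs in \<open>\<pi>\<close>, into translation by \<open>g\<close>.\<close>
    moreover have "(\<Sum>g\<in>S. c g) = (\<Sum>g\<in>S. \<Sum>\<^sub>\<infinity>x\<in>X. f (\<alpha> g x) * f x)"
    proof -
      have "(\<Sum>g\<in>S. c g) = (\<Sum>g\<in>S. c (inv g))"
        by (rule sum.reindex_bij_betw[OF S_bij, symmetric])
      also have "\<dots> = (\<Sum>g\<in>S. \<Sum>\<^sub>\<infinity>x\<in>X. f (\<alpha> g x) * f x)"
        using S_G by (intro sum.cong) (auto simp: c_def)
      finally show ?thesis .
    qed
    ultimately show ?thesis by (simp add: n_def ell2_norm_of_real_square)
  qed
  \<comment> \<open>Half of the gap \<open>e / C\<close>: the supersolution needs a constant
    strictly above \<open>N - e / C\<close>, and \<open>N - d\<close> must still be below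
    \<open>N\<close>.\<close>
  define d where "d = e / C / 2"
  have d: "0 < d" using e C0 by (simp add: d_def)
  \<comment> \<open>An empty support would make the coefficient sum 0. Hence
    \<open>N \<ge> 1 > d\<close>, and the constant \<open>N - d\<close> is positive.\<close>
  have "S \<noteq> {}" using eps_z e by (auto simp: of_real_eq_0_iff[symmetric] simp del: of_real_add of_real_mult)
  then have "1 \<le> N" using fin by (simp add: N_def Suc_le_eq card_gt_0_iff)
  moreover have "d < 1" using C C0 e by (simp add: d_def field_simps)
  ultimately have r0: "0 < N - d" by simp
  have S_action: "bij_betw (\<alpha> g) X X" if "g \<in> S" for g using that S_G by (intro action_bij) auto
  have "\<exists>u :: 'x \<Rightarrow> real. (\<forall>x\<in>Y. 0 < u x) \<and> (\<forall>x. x \<notin> Y \<longrightarrow> u x = 0) \<and>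
    (\<forall>x\<in>Y. (\<Sum>g\<in>S. u (\<alpha> g x)) \<le> (N - d) * u x)"
  proof (rule positive_supersolution[OF \<open>countable X\<close> fin S_action YX r0])
    show "N - e / C < N - d" using d by (simp add: d_def)
    show "(\<Sum>g\<in>S. \<Sum>\<^sub>\<infinity>x\<in>X. f (\<alpha> g x) * f x) \<le> (N - e / C) * (\<Sum>\<^sub>\<infinity>x\<in>X. (f x)\<^sup>2)"
      if "\<And>x. 0 \<le> f x" "\<And>x. x \<notin> Y \<Longrightarrow> f x = 0" "(\<lambda>x. complex_of_real (f x)) \<in> ell2 X"
      for f :: "'x \<Rightarrow> real"
      using that by (rule real_form)
  qed
  then obtain u :: "'x \<Rightarrow> real" where u: "\<And>x. x \<in> Y \<Longrightarrow> 0 < u x" "\<And>x. x \<notin> Y \<Longrightarrow> u x = 0"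
    and super: "\<And>x. x \<in> Y \<Longrightarrow> (\<Sum>g\<in>S. u (\<alpha> g x)) \<le> (N - d) * u x"
    by metis
  have u0: "0 \<le> u x" for x using u[of x] by (cases "x \<in> Y") (auto intro: less_imp_le)

  \<comment> \<open>The value 0 off \<open>Y\<close> makes \<open>v\<close> defined on all of
    \<open>X\<close>, so the increments \<open>h\<close> form an exact coboundary there, although
    \<open>v\<close> itself may be unbounded.\<close>
  define v where "v = (\<lambda>x. if x \<in> Y then ln (u x) else 0)"
  define h where "h = (\<lambda>g x. if x \<in> X then complex_of_real (v (\<alpha> g x) - v x) else 0)"
  \<comment> \<open>The Harnack inequality: all terms are nonnegative, so a single one is at most
    the whole sum.\<close>
  have step: "u (\<alpha> g x) \<le> (N - d) * u x" if "x \<in> Y" "g \<in> S" for g x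
    using super[OF that(1)] member_le_sum[OF that(2), of "\<lambda>g. u (\<alpha> g x)"] fin u0 by simp
  have up: "v (\<alpha> g x) - v x \<le> ln (N - d)" if "x \<in> Y" "\<alpha> g x \<in> Y" "g \<in> S" for g x
  proof -
    have "ln (u (\<alpha> g x)) \<le> ln ((N - d) * u x)"
      using step[OF that(1,3)] u(1)[OF that(1)] u(1)[OF that(2)] r0 by (subst ln_le_cancel_iff) auto
    also have "\<dots> = ln (N - d) + ln (u x)" using r0 u(1)[OF that(1)] by (simp add: ln_mult)
    finally show ?thesis using that by (simp add: v_def)
  qed
  \<comment> \<open>Outside \<open>E\<close>, neither \<open>x\<close> nor any
    \<open>\<alpha> g x\<close> with \<open>g\<close> in \<open>S\<close> lies in \<open>F\<close>,
    so both values of \<open>v\<close> are genuine logarithms.\<close>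
  define E where "E = F \<union> (\<Union>g\<in>S. \<alpha> (inv g) ` F)"
  have E: "finite E" "E \<subseteq> X"
    using F fin S_G by (auto simp: E_def subset_iff intro!: action_closed)
  have stays: "\<alpha> g x \<in> Y" if x: "x \<in> X - E" and g: "g \<in> S" for g x
  proof -
    have gG: "g \<in> carrier G" using g S_G by blast
    have "\<alpha> g x \<notin> F"
    proof
      assume "\<alpha> g x \<in> F"
      then have "\<alpha> (inv g) (\<alpha> g x) \<in> E" using g by (auto simp: E_def)
      then show False using x gG by (simp add: action_inv_left)
    qed
    then show ?thesis using x gG by (simp add: Y_def action_closed)
  qed
  have E_Y: "x \<in> Y" if "x \<in> X - E" for x using that by (auto simp: E_def Y_def)
  have h_bounded: "h g \<in> linf X" if g: "g \<in> S" for g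
  proof -
    have gG: "g \<in> carrier G" using g S_G by blast
    have le: "cmod (h g x) \<le> ln (N - d)" if x: "x \<in> X - E" for x
    proof -
      \<comment> \<open>The lower bound for \<open>g\<close> at \<open>x\<close> is the upper bound
        for \<open>inv g\<close> at the point \<open>\<alpha> g x\<close>.\<close>
      have "v (\<alpha> (inv g) (\<alpha> g x)) - v (\<alpha> g x) \<le> ln (N - d)"
        using x gG by (intro up[OF stays[OF x g] _ S_inv[OF g]]) (simp add: action_inv_left E_Y)
      then have "\<bar>v (\<alpha> g x) - v x\<bar> \<le> ln (N - d)"
        using up[OF E_Y[OF x] stays[OF x g] g] x gG by (simp add: action_inv_left abs_le_iff)
      then show ?thesis using x by (simp add: h_def del: of_real_diff)
    qed
    have "h g x \<in> h g ` E \<union> cball 0 (ln (N - d))" if "x \<in> X" for x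
      using that le[of x] by (cases "x \<in> E") auto
    then have "h g ` X \<subseteq> h g ` E \<union> cball 0 (ln (N - d))" by blast
    moreover have "bounded (h g ` E \<union> cball 0 (ln (N - d)))"
      using E(1) by (simp add: finite_imp_bounded)
    ultimately have "bounded (h g ` X)" using bounded_subset by blast
    then show ?thesis by (simp add: ell_infty_def h_def)
  qed
  have cocycle_neg: "(\<Sum>g\<in>S. Re (h g x)) \<le> - d" if x: "x \<in> X - E" for x
  proof -
    have ux: "0 < u x" using u(1) E_Y[OF x] by blast
    have "(\<Sum>g\<in>S. Re (h g x)) \<le> (\<Sum>g\<in>S. u (\<alpha> g x) / u x - 1)"
    proof (rule sum_mono)
      fix g assume g: "g \<in> S"
      have pos: "0 < u (\<alpha> g x)" using u(1) stays[OF x g] by blast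
      have "Re (h g x) = ln (u (\<alpha> g x) / u x)"
        using x E_Y[OF x] stays[OF x g] ux pos by (simp add: h_def v_def ln_div)
      also have "\<dots> \<le> u (\<alpha> g x) / u x - 1" using ux pos by (intro ln_le_minus_one) simp
      finally show "Re (h g x) \<le> u (\<alpha> g x) / u x - 1" .
    qed
    also have "\<dots> = (\<Sum>g\<in>S. u (\<alpha> g x)) / u x - N"
      by (simp add: sum_subtractf sum_divide_distrib N_def)
    also have "\<dots> \<le> - d" using super[OF E_Y[OF x]] ux by (simp add: field_simps)
    finally show ?thesis .
  qed

  obtain M where M: "regular_borel_probability (stone_cech_boundary X) M"
    and inv: "\<And>g A. g \<in> \<Lambda> \<Longrightarrow> A \<in> sets M \<Longrightarrow>
      emeasure M (stone_cech_extension X (\<alpha> g) ` A) = emeasure M A"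
    using fixes_measure unfolding fixes_boundary_probability_def by blast
  interpret prob_space M using M by (simp add: regular_borel_probability_def)
  define I where "I = (\<lambda>g. \<integral>\<omega>. Re (\<omega> (h g)) \<partial>M)"
  \<comment> \<open>Since \<open>v\<close> may be unbounded, the mean of \<open>h g\<close> cannot
    be split into two equal means. Instead \<open>h (inv g) (\<alpha> g x) = - h g x\<close> holds
    on all of \<open>X\<close>, and invariance of \<open>M\<close> removes the translation.\<close>
  have I_inv: "I (inv g) = - I g" if g: "g \<in> S" for g
  proof -
    have gG: "g \<in> carrier G" using g S_G by blast
    have "I (inv g) = (\<integral>\<omega>. Re (\<omega> (\<lambda>x. if x \<in> X then h (inv g) (\<alpha> g x) else 0)) \<partial>M)"
      unfolding I_def
    proof (rule boundary_integral_invariant[OF M, symmetric])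
      show "emeasure M (stone_cech_extension X (\<alpha> (inv g)) ` A) = emeasure M A" if "A \<in> sets M" for A
        using S_inv[OF g] S_\<Lambda> that by (intro inv) auto
    qed (use gG h_bounded[OF S_inv[OF g]] in \<open>auto simp: action_bij action_inv_left action_inv_right\<close>)
    also have "(\<lambda>x. if x \<in> X then h (inv g) (\<alpha> g x) else 0) = (\<lambda>x. (- 1) * h g x)"
      using gG by (auto simp: h_def fun_eq_iff action_closed action_inv_left)
    also have "(\<integral>\<omega>. Re (\<omega> (\<lambda>x. (- 1) * h g x)) \<partial>M) = (\<integral>\<omega>. - Re (\<omega> (h g)) \<partial>M)"
    proof (rule Bochner_Integration.integral_cong[OF refl])
      fix \<omega> assume "\<omega> \<in> space M"
      then have "\<omega> \<in> characters (ell_infty X)" by (simp add: boundary_measure_space[OF M] boundary_iff)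
      from character_scale[OF this h_bounded[OF g], of "- 1"]
      show "Re (\<omega> (\<lambda>x. (- 1) * h g x)) = - Re (\<omega> (h g))" by simp
    qed
    finally show ?thesis by (simp add: I_def)
  qed
  \<comment> \<open>Inversion permutes \<open>S\<close>, so the sum of the means equals its own
    negative.\<close>
  have "(\<Sum>g\<in>S. I g) = (\<Sum>g\<in>S. I (inv g))"
    by (rule sum.reindex_bij_betw[OF S_bij, symmetric])
  also have "\<dots> = - (\<Sum>g\<in>S. I g)" by (simp add: I_inv sum_negf)
  finally have zero: "(\<Sum>g\<in>S. I g) = 0" by simp
  note integrable = boundary_evaluation_integrable[OF M h_bounded]
  have "(\<Sum>g\<in>S. I g) = (\<integral>\<omega>. (\<Sum>g\<in>S. Re (\<omega> (h g))) \<partial>M)"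
    unfolding I_def by (rule Bochner_Integration.integral_sum[symmetric]) (rule integrable)
  also have "\<dots> \<le> (\<integral>\<omega>. - d \<partial>M)"
  proof (rule integral_mono)
    show "integrable M (\<lambda>\<omega>. \<Sum>g\<in>S. Re (\<omega> (h g)))"
      by (rule Bochner_Integration.integrable_sum) (rule integrable)
    fix \<omega> assume "\<omega> \<in> space M"
    then have \<omega>: "\<omega> \<in> topspace (stone_cech_boundary X)" by (simp add: boundary_measure_space[OF M])
    then have char: "\<omega> \<in> characters (ell_infty X)" by (simp add: boundary_iff)
    have "(\<Sum>g\<in>S. Re (\<omega> (h g))) = Re (\<omega> (\<lambda>x. \<Sum>g\<in>S. h g x))"
      using character_sum[OF char, of S h] h_bounded by simp
    also have "\<dots> \<le> - d"
      using cocycle_neg by (intro boundary_Re_le[OF \<omega> E] ell_infty_sum h_bounded) auto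
    finally show "(\<Sum>g\<in>S. Re (\<omega> (h g))) \<le> - d" .
  qed simp
  also have "\<dots> = - d" by (simp add: prob_space)
  finally show False using zero d by simp
qed

end

text \<open>The inequality makes the trivial representation contractive for \<open>\<tau>\<close>,
  so it has limits along \<open>\<tau>\<close>-Cauchy sequences. The factorisation holds because
  both sides are the limit along the same representative.\<close>

lemma (in discrete_group) tau_group_if_trivial_le:
  assumes semi: "cstar_seminorm GA \<tau>"
    and le: "\<And>a. a \<in> carrier GA \<Longrightarrow> cmod (triv.L a) \<le> \<tau> a"
  shows "tau_group G \<tau>"
proof -
  interpret T: cstar_seminormed_algebra GA \<tau> by unfold_locales (rule semi)
  \<comment> \<open>The representative is chosen arbitrarily; contractivity shows below that the
    limit does not depend on it.\<close>
  define \<Psi> where "\<Psi> = (\<lambda>c. lim (\<lambda>n. triv.L ((SOME s. s \<in> c) n)))"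
  have diff: "triv.L a - triv.L b = triv.L (a_minus GA a b)"
    if "a \<in> carrier GA" "b \<in> carrier GA" for a b
    using triv.linear_extension_diff[OF that] by (simp add: complex_algebra_minus)
  have conv: "convergent (\<lambda>n. triv.L (s n))" if s: "s \<in> carrier T.C" for s
  proof (rule Cauchy_convergent, rule CauchyI)
    fix e :: real assume "e > 0"
    then obtain M where M: "\<And>m n. m \<ge> M \<Longrightarrow> n \<ge> M \<Longrightarrow> \<tau> (a_minus GA (s m) (s n)) < e"
      using s unfolding T.cauchy_carrier_iff by blast
    have "norm (triv.L (s m) - triv.L (s n)) < e" if "m \<ge> M" "n \<ge> M" for m n
      using le[of "a_minus GA (s m) (s n)"] M[OF that] T.cauchy_in_carrier[OF s]
      by (simp add: diff)
    then show "\<exists>M. \<forall>m\<ge>M. \<forall>n\<ge>M. norm (triv.L (s m) - triv.L (s n)) < e" by blast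
  qed
  have \<Psi>: "(\<lambda>n. triv.L (s n)) \<longlonglongrightarrow> \<Psi> (T.cls s)" if s: "s \<in> carrier T.C" for s
  proof -
    define t where "t = (SOME t. t \<in> T.cls s)"
    have "t \<in> T.cls s" unfolding t_def by (rule someI[of _ s]) (rule T.cls_self[OF s])
    then have t: "t \<in> carrier T.C" and null: "(\<lambda>n. \<tau> (a_minus GA (t n) (s n))) \<longlonglongrightarrow> 0"
      using s by (auto simp: T.mem_cls_iff T.null_seqs_iff)
    have "(\<lambda>n. triv.L (t n) - triv.L (s n)) \<longlonglongrightarrow> 0"
      by (rule Lim_null_comparison[OF always_eventually null])
         (use le T.cauchy_in_carrier[OF s] T.cauchy_in_carrier[OF t] in \<open>simp add: diff\<close>)
    moreover have "(\<lambda>n. triv.L (t n)) \<longlonglongrightarrow> \<Psi> (T.cls s)"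
      using conv[OF t] by (simp add: \<Psi>_def t_def convergent_LIMSEQ_iff)
    ultimately have "(\<lambda>n. triv.L (t n) - (triv.L (t n) - triv.L (s n))) \<longlonglongrightarrow> \<Psi> (T.cls s) - 0"
      by (intro tendsto_diff)
    then show ?thesis by simp
  qed
  have \<Psi>_eq: "\<Psi> (T.cls s) = l" if "s \<in> carrier T.C" "(\<lambda>n. triv.L (s n)) \<longlonglongrightarrow> l" for s l
    using LIMSEQ_unique[OF \<Psi>[OF that(1)] that(2)] .
  note c = T.cauchy_in_carrier
  have hom: "\<Psi> \<in> star_hom T.CP complex_algebra"
    unfolding star_hom_def
  proof (intro CollectI conjI ballI allI ring_hom_memI)
    show "\<Psi> (one T.CP) = one complex_algebra"
      unfolding T.completion_one
      by (rule \<Psi>_eq) (auto simp: T.cauchy_const group_algebra_one_eq triv.linear_extension_delta)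
    fix x assume "x \<in> carrier T.CP"
    then obtain s where s: "s \<in> carrier T.C" "x = T.cls s" by (rule T.completion_carrierE)
    show "\<Psi> (scale T.CP k x) = scale complex_algebra k (\<Psi> x)" for k
      unfolding s(2) T.completion_scale[OF s(1)]
      by (rule \<Psi>_eq) (use s in \<open>auto simp: T.cauchy_scale triv.linear_extension_scale c intro!: tendsto_mult \<Psi>\<close>)
    show "\<Psi> (star T.CP x) = star complex_algebra (\<Psi> x)"
      unfolding s(2) T.completion_star[OF s(1)]
      by (rule \<Psi>_eq) (use s in \<open>auto simp: T.cauchy_star triv.linear_extension_star c intro!: tendsto_cnj \<Psi>\<close>)
    fix y assume "y \<in> carrier T.CP"
    then obtain t where t: "t \<in> carrier T.C" "y = T.cls t" by (rule T.completion_carrierE)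
    show "\<Psi> (mult T.CP x y) = mult complex_algebra (\<Psi> x) (\<Psi> y)"
      unfolding s(2) t(2) T.completion_mult[OF s(1) t(1)]
      by (rule \<Psi>_eq) (use s t in \<open>auto simp: T.cauchy_mult triv.linear_extension_mult c intro!: tendsto_mult \<Psi>\<close>)
    show "\<Psi> (add T.CP x y) = add complex_algebra (\<Psi> x) (\<Psi> y)"
      unfolding s(2) t(2) T.completion_add[OF s(1) t(1)]
      by (rule \<Psi>_eq) (use s t in \<open>auto simp: T.cauchy_add triv.linear_extension_add c intro!: tendsto_add \<Psi>\<close>)
  qed simp
  have "associated_hom complex_algebra (\<lambda>g. 1) x = \<Psi> (canonical_surjection G \<tau> x)"
    if x: "x \<in> carrier F.CP" for x
  proof -
    obtain s where s: "s \<in> carrier F.C" "x = F.cls s" using x by (rule F.completion_carrierE)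
    note surj = canonical_surjection_cls[OF semi s(1)]
    have "(\<lambda>n. cmod (triv.L (s n) - \<Psi> (T.cls s))) \<longlonglongrightarrow> 0"
      using \<Psi>[OF surj(1)] by (simp add: LIM_zero_iff tendsto_norm_zero_iff)
    then show ?thesis
      unfolding s(2) surj(2)
      by (intro triv.associated_hom_cls[OF s(1)]) (simp_all add: complex_algebra_minus)
  qed
  then show ?thesis
    using hom unfolding tau_group_def tau_continuous_def full_group_cstar_def group_cstar_completion_def
    by blast
qed

theorem theorem2p1:
  fixes G :: "('g, 'm) monoid_scheme"
    and X :: "'x set"
    and \<alpha> :: "'g \<Rightarrow> 'x \<Rightarrow> 'x"
    and \<tau> :: "('g \<Rightarrow> complex) \<Rightarrow> real"
    and \<Lambda> :: "'g set"
  assumes "group G"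
    and "countable (carrier G)"
    and "countable X"
    and "group_action G X \<alpha>"
    and "cstar_norm (group_algebra G) \<tau>"
    and "tau_continuous G \<tau> (calkin_algebra X) (calkin_rep G X \<alpha>)"
    and "subgroup \<Lambda> G"
    and "fixes_boundary_probability \<Lambda> X \<alpha>"
  shows "tau_group (G\<lparr>carrier := \<Lambda>\<rparr>) \<tau>"
proof -
  interpret discrete_group_action G X \<alpha>
    using assms(1,4) by (intro discrete_group_action.intro discrete_group.intro)
  interpret H: discrete_group "G\<lparr>carrier := \<Lambda>\<rparr>"
    using subgroup.subgroup_is_group[OF assms(7,1)] by (intro discrete_group.intro)
  have "cstar_seminorm GA \<tau>" using assms(5) by (simp add: cstar_norm_def)
  from cstar_seminorm_pullback[OF group_algebra_subgroup[OF assms(7)] this H.star_algebra_group_algebra]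
  have "cstar_seminorm H.GA \<tau>" .
  \<comment> \<open>\<open>triv.L\<close> is formed from \<open>complex_algebra\<close> and the
    constant 1 alone, so the estimate stated over \<open>G\<close> is already the one required for
    the subgroup.\<close>
  then show ?thesis
    using trivial_le_if_invariant_measure[OF assms(3,5-8)] by (rule H.tau_group_if_trivial_le)
qed

end
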